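(* Let $\alpha,\beta>0$, $T_{\mathrm m}\in\mathbb R$. Consider the closed-loop system consisting of the one-phase Stefan problem with boundary temperature actuation $$T_t(x,t)=\alpha T_{xx}(x,t)\ (0\le x\le s(t)),\quad T(0,t)=T_{\mathrm m}+T_{\mathrm c}(t),\quad T(s(t),t)=T_{\mathrm m},\quad \dot s(t)=-\beta T_x(s(t),t),$$ with $T(x,0)=T_0(x)$, $s(0)=s_0>0$, and the control law $$T_{\mathrm c}(t)=-c\left(\frac1\alpha\int_0^{s(t)}x\,(T(x,t)-T_{\mathrm m})\,dx+\frac1\beta s(t)(s(t)-s_{\mathrm r})\right),$$ where $c>0$ is the controller gain. Assume that the initial conditions $(T_0,s_0)$ are compatible with the control law and that, for some constant $H$, $0\le T_0(x)-T_{\mathrm m}\le H(s_0-x)$ for all $x\in[0,s_0]$. Then, for any reference setpoint $s_{\mathrm r}$ and control gain $c$ which satisfy $$s_{\mathrm r}>s_0+\frac{\beta}{\alpha}\int_0^{s_0}\frac{x}{s_0}(T_0(x)-T_{\mathrm m})\,dx,\qquad c\le\frac{\alpha}{2\sqrt2\,s_{\mathrm r}},$$ the closed-loop system is exponentially stable in the sense of the norm $$\|T-T_{\mathrm m}\|_{\mathcal H_1}^2+(s(t)-s_{\mathrm r})^2 .$$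
   Context: The unknowns are the liquid temperature $T(x,t)$, $0\le x\le s(t)$, and the moving interface $s(t)>0$; $(T,s)$ denotes the (classical) solution of the closed-loop system for $t\ge0$. $T_{\mathrm c}(t)$ is the controlled boundary temperature measured relative to the melting temperature $T_{\mathrm m}$. Norms at time $t$: $\|u\|_{\mathcal L_2}^2=\int_0^{s(t)}u(x,t)^2dx$ and $\|u\|_{\mathcal H_1}^2=\|u\|_{\mathcal L_2}^2+\|u_x\|_{\mathcal L_2}^2$. "Exponentially stable in the sense of the norm $\Phi(t)$" means: there exist constants $D,b>0$, depending only on the system parameters, the gain and the setpoint (not on the particular solution), such that $\Phi(t)\le D\,\Phi(0)e^{-bt}$ for all $t\ge0$. "Compatible with the control law" means that the initial data satisfy the boundary conditions at $t=0$: $T_0(s_0)=T_{\mathrm m}$ and $T_0(0)=T_{\mathrm m}+T_{\mathrm c}(0)$. *)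

theory Defs
  imports "HOL-Analysis.Analysis"
begin

text \<open>
  A temperature field is a function \<open>T x t\<close> and an interface a function \<open>s t\<close>; the values of \<open>T\<close>
  are meaningful only for \<open>0 \<le> t\<close> and \<open>0 \<le> x \<le> s t\<close>.
\<close>

definition liquid_region :: "(real \<Rightarrow> real) \<Rightarrow> real set \<Rightarrow> (real \<times> real) set" where
  "liquid_region s I = {(x, t). t \<in> I \<and> 0 \<le> x \<and> x \<le> s t}"

definition L2_norm_sq :: "real \<Rightarrow> (real \<Rightarrow> real) \<Rightarrow> real" where
  "L2_norm_sq l u = integral {0..l} (\<lambda>x. (u x)\<^sup>2)"

text \<open>
  \<open>deriv u\<close> at an interior point of \<open>{0..l}\<close> depends only on the values of \<open>u\<close> inside the
  interval, and the two endpoints do not contribute to the integral.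
\<close>

definition H1_norm_sq :: "real \<Rightarrow> (real \<Rightarrow> real) \<Rightarrow> real" where
  "H1_norm_sq l u = L2_norm_sq l u + L2_norm_sq l (deriv u)"

text \<open>
  Membership in the Sobolev space on \<open>{0..l}\<close>: \<open>u\<close> is differentiable almost everywhere, is the
  indefinite integral of its derivative, and the derivative is square integrable. For such \<open>u\<close>,
  \<open>H1_norm_sq l u\<close> is the genuine (finite) squared norm.
\<close>

definition H1_on :: "real \<Rightarrow> (real \<Rightarrow> real) \<Rightarrow> bool" where
  "H1_on l u \<longleftrightarrow>
     (\<exists>N. negligible N \<and> (\<forall>x\<in>{0<..<l} - N. u field_differentiable (at x))) \<and>
     (\<forall>x\<in>{0..l}. (deriv u has_integral (u x - u 0)) {0..x}) \<and>
     (\<lambda>x. (deriv u x)\<^sup>2) integrable_on {0..l}"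

text \<open>
  Classical solutions, for all \<open>t \<ge> 0\<close>, of the one-phase Stefan problem with boundary input \<open>Tc\<close>.
  \<open>Tx\<close>, \<open>Txx\<close>, \<open>Tt\<close> are the partial derivatives of \<open>T\<close>, taken relative to the liquid region (hence
  one-sided on its boundary). They are continuous up to the fixed and the moving boundary for
  \<open>t > 0\<close>, whereas \<open>T\<close> and \<open>s\<close> are continuous up to \<open>t = 0\<close>.
\<close>

definition stefan_solution ::
  "real \<Rightarrow> real \<Rightarrow> real \<Rightarrow> (real \<Rightarrow> real) \<Rightarrow> (real \<Rightarrow> real) \<Rightarrow> real
    \<Rightarrow> (real \<Rightarrow> real \<Rightarrow> real) \<Rightarrow> (real \<Rightarrow> real) \<Rightarrow> bool" where
  "stefan_solution \<alpha> \<beta> Tm Tc T0 s0 T s \<longleftrightarrow>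
     s 0 = s0 \<and> (\<forall>x\<in>{0..s0}. T x 0 = T0 x) \<and>
     (\<forall>t\<ge>0. s t > 0) \<and>
     continuous_on {0..} s \<and>
     continuous_on (liquid_region s {0..}) (\<lambda>(x, t). T x t) \<and>
     (\<exists>Tx Txx Tt.
        continuous_on (liquid_region s {0<..}) (\<lambda>(x, t). Tx x t) \<and>
        continuous_on (liquid_region s {0<..}) (\<lambda>(x, t). Txx x t) \<and>
        continuous_on (liquid_region s {0<..}) (\<lambda>(x, t). Tt x t) \<and>
        (\<forall>t>0. \<forall>x\<in>{0..s t}.
           ((\<lambda>y. T y t) has_real_derivative Tx x t) (at x within {0..s t}) \<and>
           ((\<lambda>y. Tx y t) has_real_derivative Txx x t) (at x within {0..s t}) \<and>
           ((\<lambda>\<tau>. T x \<tau>) has_real_derivative Tt x t) (at t within {\<tau>. 0 \<le> \<tau> \<and> x \<le> s \<tau>}) \<and>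
           Tt x t = \<alpha> * Txx x t) \<and>
        (\<forall>t>0. T 0 t = Tm + Tc t \<and> T (s t) t = Tm \<and>
           (s has_real_derivative - \<beta> * Tx (s t) t) (at t)))"

text \<open>The control law, as state feedback of a temperature profile \<open>f\<close> on \<open>{0..l}\<close>.\<close>

definition control_law ::
  "real \<Rightarrow> real \<Rightarrow> real \<Rightarrow> real \<Rightarrow> real \<Rightarrow> (real \<Rightarrow> real) \<Rightarrow> real \<Rightarrow> real" where
  "control_law \<alpha> \<beta> Tm c sr f l =
     - c * (1 / \<alpha> * integral {0..l} (\<lambda>x. x * (f x - Tm)) + 1 / \<beta> * l * (l - sr))"

definition closed_loop_solution ::
  "real \<Rightarrow> real \<Rightarrow> real \<Rightarrow> real \<Rightarrow> real \<Rightarrow> (real \<Rightarrow> real) \<Rightarrow> real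
    \<Rightarrow> (real \<Rightarrow> real \<Rightarrow> real) \<Rightarrow> (real \<Rightarrow> real) \<Rightarrow> bool" where
  "closed_loop_solution \<alpha> \<beta> Tm c sr T0 s0 T s \<longleftrightarrow>
     stefan_solution \<alpha> \<beta> Tm (\<lambda>t. control_law \<alpha> \<beta> Tm c sr (\<lambda>x. T x t) (s t)) T0 s0 T s"

definition compatible ::
  "real \<Rightarrow> real \<Rightarrow> real \<Rightarrow> real \<Rightarrow> real \<Rightarrow> (real \<Rightarrow> real) \<Rightarrow> real \<Rightarrow> bool" where
  "compatible \<alpha> \<beta> Tm c sr T0 s0 \<longleftrightarrow>
     T0 s0 = Tm \<and> T0 0 = Tm + control_law \<alpha> \<beta> Tm c sr T0 s0"

definition stability_norm ::
  "real \<Rightarrow> real \<Rightarrow> (real \<Rightarrow> real \<Rightarrow> real) \<Rightarrow> (real \<Rightarrow> real) \<Rightarrow> real \<Rightarrow> real" where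
  "stability_norm Tm sr T s t = H1_norm_sq (s t) (\<lambda>x. T x t - Tm) + (s t - sr)\<^sup>2"

end

theory Submission
  imports Defs
begin

text \<open>
  Write \<open>u = T - Tm\<close>, \<open>r = sr - s\<close> and let \<open>Tc = u 0\<close> be the input. Differentiating the control law gives
  \<open>Tc' = - c Tc + (c / \<beta>) r s'\<close>. As long as \<open>Tc \<ge> 0\<close>, the maximum principle yields \<open>u \<ge> 0\<close>, hence
  \<open>s' \<ge> 0\<close> and \<open>r \<ge> 0\<close>, hence \<open>Tc t \<ge> Tc 0 exp (- c t) > 0\<close>; so these signs persist forever.

  Instead of a backstepping transformation, the functional
  \<open>V = \<parallel>u_x\<parallel>\<^sup>2 / 2 + p r\<^sup>2 / 2 + q Tc\<^sup>2 / 2\<close> is used, for which \<open>V' \<le> - b V + a s' V\<close> with suitable \<open>p, q, a, b\<close>.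
  Since \<open>s\<close> increases and stays below \<open>sr\<close>, the term \<open>a s' V\<close> costs only the factor \<open>exp (a sr)\<close>.

  A classical solution need not have a mixed derivative \<open>u_xt\<close>, and \<open>u_x\<close> need not extend to time \<open>0\<close>.
  The first difficulty is met by using left difference quotients of \<open>V\<close> and convexity of the square.
  For the second, an energy estimate for the distance of \<open>u\<close> to a comparison profile built from the
  initial data shows that \<open>\<parallel>u_x\<parallel>\<^sup>2\<close> comes arbitrarily close to its initial value, or below, at
  arbitrarily small times.
\<close>

section \<open>Left difference quotients and integrals over moving intervals\<close>

text \<open>The obstacle is uniformity: \<open>D\<close> and \<open>b\<close> may not depend on the
  solution, whereas the pointwise bound on the interface speed involves \<open>H\<close> and
  \<open>s 0\<close>. Hence the speed enters the decay estimate only through the weight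
  \<open>exp (- a * s t)\<close>, and the pointwise bound serves solely for a limit at time 0. The
  dissipation of the slope energy controls the oscillation of u_x about its mean -Tc/s, but not the
  mean. The mean is damped by the boundary term -u_x(0) Tc', through the part -c Tc of Tc'. The gap
  r has no damping of its own: it is gained from -p r s', because the control law bounds r by Tc/s,
  Tc and the oscillation. The square of Tc in the functional pays for the input terms that these two
  steps leave behind. Left quotients suit a growing liquid: the earlier profile lives on a
  subinterval of the later one, so the two can be compared pointwise. The estimate has to start at
  time 0 itself, because the value of the norm at a positive time is not bounded in advance by its
  initial value.\<close>

lemma nonincreasing_if_left_quotients_le_zero:
  fixes f :: "real \<Rightarrow> real"
  assumes "a \<le> b" and cont: "continuous_on {a..b} f"
    and step: "\<And>t e. a < t \<Longrightarrow> t \<le> b \<Longrightarrow> 0 < e \<Longrightarrow>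
                 \<forall>\<^sub>F \<tau> in at_left t. f t - f \<tau> \<le> e * (t - \<tau>)"
  shows "f b \<le> f a"
proof -
  have main: "f b - f a \<le> e * (b - a)" if "0 < e" for e
  proof -
    \<comment> \<open>Increments are measured up to the fixed end \<open>b\<close>, so the one-sided
      hypothesis at the least point of \<open>S\<close> yields a still smaller point. Closedness of
      \<open>S\<close> supplies that least point.\<close>
    define S where "S = {\<tau> \<in> {a..b}. f b - f \<tau> \<le> e * (b - \<tau>)}"
    have "closed S"
      unfolding S_def
      by (intro continuous_on_closed_Collect_le continuous_intros cont closed_real_atLeastAtMost)
    moreover have "S = S \<inter> {a..b}"
      by (auto simp: S_def)
    ultimately have "compact S"
      by (metis closed_Int_compact compact_Icc)
    moreover have "b \<in> S"
      using \<open>a \<le> b\<close> by (auto simp: S_def)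
    ultimately obtain m where m: "m \<in> S" "\<And>x. x \<in> S \<Longrightarrow> m \<le> x"
      using continuous_attains_inf[of S "\<lambda>x. x"] by (auto simp: continuous_on_id)
    have "m = a"
    proof (rule ccontr)
      assume "m \<noteq> a"
      then have am: "a < m" "m \<le> b"
        using m(1) by (auto simp: S_def)
      have "\<forall>\<^sub>F \<tau> in at_left m. f m - f \<tau> \<le> e * (m - \<tau>) \<and> \<tau> \<in> {a<..<m}"
        using step[OF am \<open>0 < e\<close>] eventually_at_left_real[OF am(1)] by eventually_elim auto
      then obtain \<tau> where \<tau>: "f m - f \<tau> \<le> e * (m - \<tau>)" "a < \<tau>" "\<tau> < m"
        using eventually_happens[of _ "at_left m"] by (auto simp: trivial_limit_at_left_real)
      have "\<tau> \<in> S"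
        using \<tau> m(1) am by (auto simp: S_def algebra_simps)
      with m(2) \<tau> show False by fastforce
    qed
    with m(1) show ?thesis by (auto simp: S_def)
  qed
  show ?thesis
  proof (cases "a = b")
    case False
    then have "0 < b - a" using \<open>a \<le> b\<close> by simp
    show ?thesis
    proof (rule field_le_epsilon)
      fix e :: real assume "0 < e"
      then show "f b \<le> f a + e"
        using main[of "e / (b - a)"] \<open>0 < b - a\<close> by simp
    qed
  qed simp
qed

lemma left_quotient_tendsto:
  fixes f :: "real \<Rightarrow> real"
  assumes "(f has_real_derivative D) (at t within {a..t})" "a < t"
  shows "((\<lambda>\<tau>. (f t - f \<tau>) / (t - \<tau>)) \<longlongrightarrow> D) (at_left t)"
proof -
  have "((\<lambda>y. (f y - f t) / (y - t)) \<longlongrightarrow> D) (at_left t)"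
    using assms by (simp add: has_field_derivative_iff at_within_Icc_at_left)
  moreover have "(f y - f t) / (y - t) = (f t - f y) / (t - y)" for y
    by (metis minus_diff_eq minus_divide_divide)
  ultimately show ?thesis by simp
qed

lemma left_quotient_chain:
  fixes s G :: "real \<Rightarrow> real"
  assumes "a < t" and s: "(s has_real_derivative s') (at t)"
    and range: "\<And>\<tau>. \<tau> \<in> {a..t} \<Longrightarrow> s \<tau> \<in> {0..s t}"
    and G: "(G has_real_derivative G') (at (s t) within {0..s t})"
  shows "((\<lambda>\<tau>. (G (s t) - G (s \<tau>)) / (t - \<tau>)) \<longlongrightarrow> G' * s') (at_left t)"
proof -
  have "(G has_real_derivative G') (at (s t) within s ` {a..t})"
    using G by (rule DERIV_subset) (use range in auto)
  moreover have "(s has_real_derivative s') (at t within {a..t})"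
    using s by (rule has_field_derivative_at_within)
  ultimately have "(G \<circ> s has_real_derivative G' * s') (at t within {a..t})"
    by (rule DERIV_image_chain)
  from left_quotient_tendsto[OF this \<open>a < t\<close>] show ?thesis by simp
qed

lemma left_quotient_integral:
  fixes s g :: "real \<Rightarrow> real"
  assumes "a < t" and s: "(s has_real_derivative s') (at t)"
    and range: "\<And>\<tau>. \<tau> \<in> {a..t} \<Longrightarrow> s \<tau> \<in> {0..s t}"
    and g: "continuous_on {0..s t} g"
  shows "((\<lambda>\<tau>. integral {s \<tau>..s t} g / (t - \<tau>)) \<longlongrightarrow> g (s t) * s') (at_left t)"
proof -
  have "s t \<in> {0..s t}"
    using range[of t] \<open>a < t\<close> by auto
  from left_quotient_chain[OF assms(1-3) integral_has_real_derivative[OF g this]]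
  have "((\<lambda>\<tau>. (integral {0..s t} g - integral {0..s \<tau>} g) / (t - \<tau>))
          \<longlongrightarrow> g (s t) * s') (at_left t)" .
  then show ?thesis
  proof (rule Lim_transform_eventually)
    show "\<forall>\<^sub>F \<tau> in at_left t.
        (integral {0..s t} g - integral {0..s \<tau>} g) / (t - \<tau>) = integral {s \<tau>..s t} g / (t - \<tau>)"
      using eventually_at_left_real[OF \<open>a < t\<close>]
    proof eventually_elim
      case (elim \<tau>)
      then have "0 \<le> s \<tau>" "s \<tau> \<le> s t"
        using range[of \<tau>] by auto
      then show ?case
        using Henstock_Kurzweil_Integration.integral_combine[of 0 "s \<tau>" "s t" g]
          integrable_continuous_interval[OF g]
        by (simp add: field_simps)
    qed
  qed
qed

section \<open>Integrals over moving intervals: bounds, rescaling and continuity in time\<close>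

lemma abs_integral_le_integral:
  fixes f g :: "real \<Rightarrow> real"
  assumes "f integrable_on S" "g integrable_on S" "\<And>x. x \<in> S \<Longrightarrow> \<bar>f x\<bar> \<le> g x"
  shows "\<bar>integral S f\<bar> \<le> integral S g"
  using Henstock_Kurzweil_Integration.integral_norm_bound_integral[of f S g] assms by simp

lemma integral_scale_to_unit:
  fixes f :: "real \<Rightarrow> real"
  assumes "0 < l" "f integrable_on {0..l}"
  shows "integral {0..l} f = l * integral {0..1} (\<lambda>y. f (l * y))"
proof -
  have "((\<lambda>x. f (l * x)) has_integral (1 / \<bar>l\<bar>) *\<^sub>R integral {0..l} f) ((\<lambda>x. x / l) ` {0..l})"
    using assms by (intro has_integral_stretch_real integrable_integral) auto
  moreover have "(\<lambda>x. x / l) ` {0..l} = {0..1}"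
  proof -
    have "y \<in> (\<lambda>x. x / l) ` {0..l}" if "y \<in> {0..1}" for y
      using that assms(1) by (intro image_eqI[of _ _ "y * l"]) (auto simp: mult_left_le_one_le)
    then show ?thesis using assms(1) by auto
  qed
  ultimately have "((\<lambda>x. f (l * x)) has_integral integral {0..l} f / l) {0..1}"
    using assms(1) by simp
  then show ?thesis
    using assms(1) by (simp add: integral_unique)
qed

lemma continuous_on_slice:
  assumes "continuous_on (liquid_region s I) (\<lambda>(x, t). f x t)" "t \<in> I"
  shows "continuous_on {0..s t} (\<lambda>x. f x t)"
proof -
  have "continuous_on {0..s t} ((\<lambda>(x, t). f x t) \<circ> (\<lambda>x. (x, t)))"
    by (rule continuous_on_compose[OF _ continuous_on_subset[OF assms(1)]])
      (use assms(2) in \<open>auto intro!: continuous_intros simp: liquid_region_def\<close>)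
  then show ?thesis by (simp add: o_def)
qed

text \<open>The substitution \<open>x = s t * y\<close> turns the moving interval into a fixed one,
  where continuity of parametric integrals applies.\<close>

lemma continuous_on_integral_region:
  fixes f :: "real \<Rightarrow> real \<Rightarrow> real"
  assumes f: "continuous_on (liquid_region s I) (\<lambda>(x, t). f x t)"
    and s: "continuous_on I s" and pos: "\<And>t. t \<in> I \<Longrightarrow> 0 < s t"
  shows "continuous_on I (\<lambda>t. integral {0..s t} (\<lambda>x. f x t))"
proof -
  have "continuous_on (I \<times> cbox 0 1) ((\<lambda>(x, t). f x t) \<circ> (\<lambda>(t, y). (s t * y, t)))"
  proof (rule continuous_on_compose[OF _ continuous_on_subset[OF f]])
    show "continuous_on (I \<times> cbox 0 1) (\<lambda>(t, y). (s t * y, t))"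
      unfolding case_prod_beta
      by (intro continuous_intros continuous_on_compose2[OF s]) auto
    show "(\<lambda>(t, y). (s t * y, t)) ` (I \<times> cbox 0 1) \<subseteq> liquid_region s I"
      using pos by (fastforce simp: liquid_region_def mult_left_le)
  qed
  then have "continuous_on (I \<times> cbox 0 1) (\<lambda>(t, y). f (s t * y) t)"
    by (simp add: o_def case_prod_beta)
  from integral_continuous_on_param[OF this]
  have "continuous_on I (\<lambda>t. s t * integral {0..1} (\<lambda>y. f (s t * y) t))"
    by (intro continuous_intros s) simp
  moreover have "integral {0..s t} (\<lambda>x. f x t) = s t * integral {0..1} (\<lambda>y. f (s t * y) t)"
    if "t \<in> I" for t
    using integral_scale_to_unit[OF pos[OF that]] continuous_on_slice[OF f that]
      integrable_continuous_interval by blast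
  ultimately show ?thesis
    by (simp cong: continuous_on_cong)
qed

text \<open>Cauchy-Schwarz against the constant 1, obtained from nonnegativity of the variance about
  the mean \<open>m\<close>.\<close>

lemma integral_square_le:
  fixes f :: "real \<Rightarrow> real"
  assumes "a \<le> b" "continuous_on {a..b} f"
  shows "(integral {a..b} f)\<^sup>2 \<le> (b - a) * integral {a..b} (\<lambda>x. (f x)\<^sup>2)"
proof (cases "a = b")
  case False
  define I m where "I = integral {a..b} f" and "m = I / (b - a)"
  have l: "0 < b - a" using False assms by simp
  have int: "f integrable_on {a..b}" "(\<lambda>x. (f x)\<^sup>2) integrable_on {a..b}"
    by (intro integrable_continuous_interval continuous_intros assms)+
  have "0 \<le> integral {a..b} (\<lambda>x. (f x - m)\<^sup>2)"
    by (intro integral_nonneg integrable_continuous_interval continuous_intros assms) auto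
  also have "(\<lambda>x. (f x - m)\<^sup>2) = (\<lambda>x. (f x)\<^sup>2 - 2 * m * f x + m\<^sup>2)"
    by (auto simp: power2_eq_square algebra_simps)
  also have "((\<lambda>x. (f x)\<^sup>2 - 2 * m * f x + m\<^sup>2) has_integral
      integral {a..b} (\<lambda>x. (f x)\<^sup>2) - 2 * m * I + m\<^sup>2 * (b - a)) {a..b}"
    using has_integral_const_real[of "m\<^sup>2" a b] assms(1)
    unfolding I_def
    by (intro has_integral_add has_integral_diff has_integral_mult_right integrable_integral int)
       (simp add: mult.commute)
  then have "integral {a..b} (\<lambda>x. (f x)\<^sup>2 - 2 * m * f x + m\<^sup>2)
     = integral {a..b} (\<lambda>x. (f x)\<^sup>2) - 2 * m * I + m\<^sup>2 * (b - a)" by (rule integral_unique)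
  finally have "0 \<le> integral {a..b} (\<lambda>x. (f x)\<^sup>2) - 2 * m * I + m\<^sup>2 * (b - a)" .
  moreover have "I = m * (b - a)"
    using l by (simp add: m_def)
  ultimately have "m\<^sup>2 * (b - a) \<le> integral {a..b} (\<lambda>x. (f x)\<^sup>2)"
    by (simp add: power2_eq_square algebra_simps)
  from mult_left_mono[OF this, of "b - a"] show ?thesis
    using l \<open>I = m * (b - a)\<close> by (simp add: I_def[symmetric] power2_eq_square ac_simps)
qed simp

section \<open>Maximum principle and integration by parts\<close>

lemma compact_liquid_region:
  assumes s: "continuous_on {a..b} s"
  shows "compact (liquid_region s {a..b})"
proof (cases "a \<le> b")
  case True
  then obtain B where B: "\<And>t. t \<in> {a..b} \<Longrightarrow> s t \<le> B"
    using continuous_attains_sup[OF compact_Icc _ s] by fastforce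
  have eq: "{p \<in> {0..B} \<times> {a..b}. fst p \<le> s (snd p)} = liquid_region s {a..b}"
    using B by (fastforce simp: liquid_region_def)
  have "closed {p \<in> {0..B} \<times> {a..b}. fst p \<le> s (snd p)}"
    by (intro continuous_on_closed_Collect_le closed_Times closed_real_atLeastAtMost
        continuous_on_compose2[OF s] continuous_intros) auto
  then have "compact (liquid_region s {a..b} \<inter> ({0..B} \<times> {a..b}))"
    unfolding eq by (intro closed_Int_compact compact_Times compact_Icc)
  moreover have "liquid_region s {a..b} \<inter> ({0..B} \<times> {a..b}) = liquid_region s {a..b}"
    unfolding eq[symmetric] by blast
  ultimately show ?thesis by simp
qed (auto simp: liquid_region_def)

lemma weak_maximum_principle:
  fixes z zt zx zxx :: "real \<Rightarrow> real \<Rightarrow> real" and s :: "real \<Rightarrow> real"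
  assumes "0 < \<alpha>"
    and cont: "continuous_on (liquid_region s {0..t1}) (\<lambda>(x, t). z x t)"
    and s: "continuous_on {0..t1} s"
    and left: "\<And>t. t \<in> {0..t1} \<Longrightarrow> 0 \<le> z 0 t"
    and right: "\<And>t. t \<in> {0..t1} \<Longrightarrow> 0 \<le> z (s t) t"
    and bottom: "\<And>x. x \<in> {0..s 0} \<Longrightarrow> 0 \<le> z x 0"
    and dx: "\<And>x t. t \<in> {0<..t1} \<Longrightarrow> x \<in> {0<..<s t} \<Longrightarrow>
               ((\<lambda>y. z y t) has_real_derivative zx x t) (at x)"
    and dxx: "\<And>x t. t \<in> {0<..t1} \<Longrightarrow> x \<in> {0<..<s t} \<Longrightarrow>
               ((\<lambda>y. zx y t) has_real_derivative zxx x t) (at x)"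
    and dt: "\<And>x t. t \<in> {0<..t1} \<Longrightarrow> x \<in> {0<..<s t} \<Longrightarrow>
               ((\<lambda>\<tau>. z x \<tau>) has_real_derivative zt x t) (at t)"
    and super: "\<And>x t. t \<in> {0<..t1} \<Longrightarrow> x \<in> {0<..<s t} \<Longrightarrow> \<alpha> * zxx x t \<le> zt x t"
    and mem: "t \<in> {0..t1}" "x \<in> {0..s t}"
  shows "0 \<le> z x t"
proof (rule ccontr)
  assume neg: "\<not> 0 \<le> z x t"
  \<comment> \<open>Adding \<open>e * t\<close> makes the differential inequality strict. The factor
    2 keeps the perturbed value at the violating point negative, and the shift \<open>t + 1\<close>
    covers \<open>t = 0\<close>.\<close>
  define e where "e = - z x t / (2 * (t + 1))"
  have "0 < e" "z x t + e * t < 0"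
  proof -
    show "0 < e" using neg mem(1) by (auto simp: e_def divide_simps)
    have "e * t \<le> - z x t / 2"
      using neg mem(1) by (simp add: e_def divide_simps)
    then show "z x t + e * t < 0" using neg by simp
  qed
  define K where "K = liquid_region s {0..t1}"
  have "compact K"
    unfolding K_def by (rule compact_liquid_region[OF s])
  moreover have "continuous_on K (\<lambda>(x, t). z x t + e * t)"
    using cont unfolding K_def case_prod_beta by (intro continuous_intros)
  moreover have K: "(x, t) \<in> K"
    using mem by (auto simp: K_def liquid_region_def)
  ultimately obtain p where p: "p \<in> K" "\<And>q. q \<in> K \<Longrightarrow> (\<lambda>(x, t). z x t + e * t) p \<le> (\<lambda>(x, t). z x t + e * t) q"
    using continuous_attains_inf[of K "\<lambda>(x, t). z x t + e * t"] by blast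
  obtain x0 t0 where p0: "p = (x0, t0)" by force
  have t0: "0 \<le> t0" "t0 \<le> t1" and x0: "0 \<le> x0" "x0 \<le> s t0"
    using p(1) by (auto simp: p0 K_def liquid_region_def)
  have min: "z x0 t0 + e * t0 \<le> z y \<tau> + e * \<tau>" if "0 \<le> \<tau>" "\<tau> \<le> t1" "0 \<le> y" "y \<le> s \<tau>" for y \<tau>
    using p(2)[of "(y, \<tau>)"] that by (auto simp: p0 K_def liquid_region_def)
  have "z x0 t0 + e * t0 < 0"
    using min[of t x] mem \<open>z x t + e * t < 0\<close> by auto
  then have "z x0 t0 < 0"
    using \<open>0 < e\<close> t0 by (smt (verit) mult_nonneg_nonneg)
  have "t0 \<noteq> 0" "x0 \<noteq> 0" "x0 \<noteq> s t0"
    using \<open>z x0 t0 < 0\<close> bottom[of x0] left[of t0] right[of t0] t0 x0 by auto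
  then have int: "t0 \<in> {0<..t1}" "x0 \<in> {0<..<s t0}"
    using t0 x0 by auto
  \<comment> \<open>Only earlier times can be compared, since \<open>t0\<close> may equal
    \<open>t1\<close>. Continuity of \<open>s\<close> keeps \<open>x0\<close> in the liquid shortly
    before \<open>t0\<close>.\<close>
  have "zt x0 t0 + e \<le> 0"
  proof (rule ccontr)
    assume "\<not> zt x0 t0 + e \<le> 0"
    moreover have "((\<lambda>\<tau>. z x0 \<tau> + e * \<tau>) has_real_derivative zt x0 t0 + e) (at t0)"
      using dt[OF int] by (auto intro!: derivative_eq_intros)
    ultimately obtain d where d: "0 < d" "\<And>h. 0 < h \<Longrightarrow> h < d \<Longrightarrow> z x0 (t0 - h) + e * (t0 - h) < z x0 t0 + e * t0"
      using DERIV_pos_inc_left[of "\<lambda>\<tau>. z x0 \<tau> + e * \<tau>" "zt x0 t0 + e" t0] by auto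
    have "(s \<longlongrightarrow> s t0) (at t0 within {0..t1})"
      using s t0 by (auto simp: continuous_on_def)
    then have "\<forall>\<^sub>F \<tau> in at t0 within {0..t1}. x0 < s \<tau>"
      using int by (intro order_tendstoD) auto
    then obtain d' where d': "0 < d'" "\<And>\<tau>. \<tau> \<in> {0..t1} \<Longrightarrow> \<tau> \<noteq> t0 \<Longrightarrow> dist \<tau> t0 < d' \<Longrightarrow> x0 < s \<tau>"
      by (auto simp: eventually_at)
    define h where "h = Min {d, d', t0} / 2"
    have "0 < Min {d, d', t0}" "Min {d, d', t0} \<le> d" "Min {d, d', t0} \<le> d'" "Min {d, d', t0} \<le> t0"
      using d(1) d'(1) int by auto
    then have h: "0 < h" "h < d" "h < d'" "h < t0"
      unfolding h_def by linarith+
    show False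
      using min[of "t0 - h" x0] d(2)[OF h(1,2)] d'(2)[of "t0 - h"] h x0 t0
      by (auto simp: dist_real_def)
  qed
  then have "zt x0 t0 < 0" using \<open>0 < e\<close> by simp
  then have "\<alpha> * zxx x0 t0 < 0" using super[OF int] by simp
  then have "zxx x0 t0 < 0" using \<open>0 < \<alpha>\<close> by (simp add: mult_less_0_iff)
  have minx: "z x0 t0 \<le> z y t0" if "0 \<le> y" "y \<le> s t0" for y
    using min[of t0 y] that t0 by auto
  have "zx x0 t0 = 0"
  proof (rule DERIV_local_min[OF dx[OF int]])
    show "0 < min x0 (s t0 - x0)" using int by auto
    show "\<forall>y. \<bar>x0 - y\<bar> < min x0 (s t0 - x0) \<longrightarrow> z x0 t0 \<le> z y t0"
      using minx by auto
  qed
  \<comment> \<open>The slope vanishes at the spatial minimum \<open>x0\<close> and turns negative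
    to its right, so \<open>z\<close> would drop below its minimum.\<close>
  then obtain d where d: "0 < d" "\<And>h. 0 < h \<Longrightarrow> h < d \<Longrightarrow> zx (x0 + h) t0 < 0"
    using DERIV_neg_dec_right[OF dxx[OF int] \<open>zxx x0 t0 < 0\<close>] by auto
  define y where "y = x0 + min d (s t0 - x0) / 2"
  have y: "x0 < y" "y < s t0" "y < x0 + d"
    using d(1) int by (auto simp: y_def min_def field_simps)
  have "z y t0 < z x0 t0"
  proof (rule DERIV_neg_imp_decreasing_open[OF y(1)])
    show "\<exists>l. ((\<lambda>y. z y t0) has_real_derivative l) (at v) \<and> l < 0" if "x0 < v" "v < y" for v
      using dx[of t0 v] d(2)[of "v - x0"] that y int by auto
    show "continuous_on {x0..y} (\<lambda>y. z y t0)"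
    proof (rule continuous_on_subset[OF continuous_on_slice[OF cont]])
      show "t0 \<in> {0..t1}" "{x0..y} \<subseteq> {0..s t0}" using t0 x0 y by auto
    qed
  qed
  then show False using minx[of y] y x0 by auto
qed

text \<open>Since \<open>v\<close> is only an indefinite integral, the product rule may fail on a
  null set and cannot simply be integrated. Instead the defect \<open>G\<close> of the identity is
  shown to have derivative zero at every point, hence to be constant.\<close>

lemma integral_by_parts_indefinite_integral:
  fixes v v' f f' :: "real \<Rightarrow> real"
  assumes "0 \<le> l"
    and v: "\<And>x. x \<in> {0..l} \<Longrightarrow> (v' has_integral (v x - v 0)) {0..x}"
    and v2: "(\<lambda>x. (v' x)\<^sup>2) integrable_on {0..l}"
    and f: "\<And>x. x \<in> {0..l} \<Longrightarrow> (f has_real_derivative f' x) (at x within {0..l})"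
    and f': "continuous_on {0..l} f'"
  shows "((\<lambda>x. v' x * f x) has_integral (v l * f l - v 0 * f 0 - integral {0..l} (\<lambda>x. v x * f' x))) {0..l}"
proof -
  have v'_int: "v' integrable_on {0..l}"
    using v[of l] \<open>0 \<le> l\<close> by (auto simp: has_integral_integrable)
  have v_cont: "continuous_on {0..l} v"
  proof -
    have "continuous_on {0..l} (\<lambda>x. v 0 + integral {0..x} v')"
      by (intro continuous_intros indefinite_integral_continuous_1 v'_int)
    then show ?thesis
    proof (rule continuous_on_eq)
      fix x assume "x \<in> {0..l}"
      from integral_unique[OF v[OF this]] show "v 0 + integral {0..x} v' = v x" by simp
    qed
  qed
  have f_cont: "continuous_on {0..l} f"
    using f DERIV_continuous_on by blast
  \<comment> \<open>Square integrability enters here: absolute integrability of \<open>v'\<close>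
    makes its product with the bounded function \<open>f\<close> integrable.\<close>
  have v'_abs: "v' absolutely_integrable_on {0..l}"
  proof (rule absolutely_integrable_integrable_bound[OF _ v'_int])
    show "norm (v' x) \<le> 1 + (v' x)\<^sup>2" for x
    proof -
      have "0 \<le> (\<bar>v' x\<bar> - 1)\<^sup>2" by simp
      then show ?thesis by (simp add: power2_eq_square algebra_simps abs_if split: if_splits)
    qed
    show "(\<lambda>x. 1 + (v' x)\<^sup>2) integrable_on {0..l}"
      by (intro integrable_add v2) auto
  qed
  have absv_int: "(\<lambda>x. \<bar>v' x\<bar>) integrable_on {0..l}"
    using v'_abs by (simp add: absolutely_integrable_on_def)
  have v'f_int: "(\<lambda>x. v' x * f x) integrable_on {0..l}"
  proof -
    have "(\<lambda>x. f x * v' x) absolutely_integrable_on {0..l}"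
    proof (rule absolutely_integrable_bounded_measurable_product_real[OF _ _ _ v'_abs])
      show "f \<in> borel_measurable (lebesgue_on {0..l})"
        by (rule continuous_imp_measurable_on_sets_lebesgue[OF f_cont]) auto
      show "bounded (f ` {0..l})"
        using f_cont compact_continuous_image compact_imp_bounded by blast
    qed auto
    then show ?thesis
      by (simp add: mult.commute set_lebesgue_integral_eq_integral(1))
  qed
  have vf'_int: "(\<lambda>x. v x * f' x) integrable_on {0..l}"
    by (intro integrable_continuous_interval continuous_intros v_cont f')
  obtain M where M: "0 < M" "\<And>x. x \<in> {0..l} \<Longrightarrow> \<bar>f' x\<bar> \<le> M"
    using compact_imp_bounded[OF compact_continuous_image[OF f' compact_Icc]]
    by (auto simp: bounded_pos)
  have f_lip: "\<bar>f y - f x\<bar> \<le> M * \<bar>y - x\<bar>" if "x \<in> {0..l}" "y \<in> {0..l}" for x y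
    using field_differentiable_bound[of "{0..l}" f f' M x y] f M(2) that
    by (auto simp: norm_minus_commute abs_minus_commute)
  \<comment> \<open>The variation of \<open>v\<close>; its continuity makes the part of the error
    that involves \<open>v'\<close> of smaller order than the step.\<close>
  define A where "A x = integral {0..x} (\<lambda>y. \<bar>v' y\<bar>)" for x
  have A_cont: "continuous_on {0..l} A"
    unfolding A_def by (intro indefinite_integral_continuous_1 absv_int)
  define G where "G x = v x * f x - integral {0..x} (\<lambda>y. v y * f' y) - integral {0..x} (\<lambda>y. v' y * f y)" for x
  have sub: "g integrable_on {0..l} \<Longrightarrow> 0 \<le> x \<Longrightarrow> y \<le> l \<Longrightarrow> g integrable_on {x..y}" for g :: "real \<Rightarrow> real" and x y
    by (rule integrable_on_subinterval) auto
  have comb: "integral {0..y} g - integral {0..x} g = integral {x..y} g"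
    if "g integrable_on {0..l}" "0 \<le> x" "x \<le> y" "y \<le> l" for g :: "real \<Rightarrow> real" and x y
    using Henstock_Kurzweil_Integration.integral_combine[of 0 x y g] sub[OF that(1), of 0 y] that by simp
  text \<open>With \<open>f y - f x\<close> and \<open>v y - v x\<close> written as integrals, the product increment telescopes,
    and what is left is of second order in \<open>y - x\<close>, up to the moduli of continuity.\<close>
  have G_small: "\<bar>G y - G x\<bar> \<le> M * (y - x) * (w + (A y - A x))"
    if xy: "0 \<le> x" "x \<le> y" "y \<le> l" and w: "\<And>z. z \<in> {x..y} \<Longrightarrow> \<bar>v y - v z\<bar> \<le> w" for x y w
  proof -
    have If': "(f' has_integral (f y - f x)) {x..y}"
    proof (rule fundamental_theorem_of_calculus[OF xy(2)])
      fix z assume "z \<in> {x..y}"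
      then have "(f has_real_derivative f' z) (at z within {x..y})"
        using xy by (intro DERIV_subset[OF f]) auto
      then show "(f has_vector_derivative f' z) (at z within {x..y})"
        by (simp add: has_real_derivative_iff_has_vector_derivative)
    qed
    have "integral {0..x} v' = v x - v 0" "integral {0..y} v' = v y - v 0"
      using xy by (auto intro!: integral_unique v)
    then have "integral {x..y} v' = v y - v x"
      using comb[OF v'_int xy] by simp
    then have Iv': "(v' has_integral (v y - v x)) {x..y}"
      using integrable_integral[OF sub[OF v'_int xy(1,3)]] by simp
    have i1: "((\<lambda>z. (v y - v z) * f' z) has_integral v y * (f y - f x) - integral {x..y} (\<lambda>z. v z * f' z)) {x..y}"
      unfolding left_diff_distrib
      by (intro has_integral_diff has_integral_mult_right If' integrable_integral sub[OF vf'_int] xy)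
    have i2: "((\<lambda>z. v' z * (f x - f z)) has_integral (v y - v x) * f x - integral {x..y} (\<lambda>z. v' z * f z)) {x..y}"
      unfolding right_diff_distrib
      by (intro has_integral_diff has_integral_mult_left Iv' integrable_integral sub[OF v'f_int] xy)
    have "G y - G x = v y * f y - v x * f x - integral {x..y} (\<lambda>z. v z * f' z) - integral {x..y} (\<lambda>z. v' z * f z)"
      using comb[OF vf'_int xy] comb[OF v'f_int xy] by (simp add: G_def)
    also have "\<dots> = integral {x..y} (\<lambda>z. (v y - v z) * f' z) + integral {x..y} (\<lambda>z. v' z * (f x - f z))"
      using i1 i2 by (simp add: integral_unique algebra_simps)
    finally have eq: "G y - G x = \<dots>" .
    have "\<bar>integral {x..y} (\<lambda>z. (v y - v z) * f' z)\<bar> \<le> integral {x..y} (\<lambda>z. w * M)"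
    proof (rule abs_integral_le_integral)
      show "(\<lambda>z. (v y - v z) * f' z) integrable_on {x..y}"
        using i1 by (rule has_integral_integrable)
      show "(\<lambda>z. w * M) integrable_on {x..y}" by (rule integrable_const_ivl)
      show "\<bar>(v y - v z) * f' z\<bar> \<le> w * M" if z: "z \<in> {x..y}" for z
        unfolding abs_mult using w[OF z] M(2)[of z] z xy by (intro mult_mono) auto
    qed
    then have b1: "\<bar>integral {x..y} (\<lambda>z. (v y - v z) * f' z)\<bar> \<le> w * M * (y - x)"
      using xy by (simp add: ac_simps)
    have "\<bar>integral {x..y} (\<lambda>z. v' z * (f x - f z))\<bar> \<le> integral {x..y} (\<lambda>z. (M * (y - x)) * \<bar>v' z\<bar>)"
    proof (rule abs_integral_le_integral)
      show "(\<lambda>z. v' z * (f x - f z)) integrable_on {x..y}"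
        using i2 by (rule has_integral_integrable)
      show "(\<lambda>z. M * (y - x) * \<bar>v' z\<bar>) integrable_on {x..y}"
        using sub[OF absv_int xy(1,3)] by (intro integrable_on_mult_right)
      show "\<bar>v' z * (f x - f z)\<bar> \<le> M * (y - x) * \<bar>v' z\<bar>" if z: "z \<in> {x..y}" for z
      proof -
        have "\<bar>f x - f z\<bar> \<le> M * \<bar>x - z\<bar>" using f_lip[of z x] z xy by auto
        also have "\<dots> \<le> M * (y - x)" using z M by (intro mult_left_mono) auto
        finally show ?thesis
          by (simp add: abs_mult mult.commute mult_left_mono)
      qed
    qed
    then have b2: "\<bar>integral {x..y} (\<lambda>z. v' z * (f x - f z))\<bar> \<le> M * (y - x) * (A y - A x)"
      using comb[OF absv_int xy] by (simp add: A_def)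
    show ?thesis
      unfolding eq using b1 b2 by (simp add: algebra_simps)
  qed
  have der: "(G has_real_derivative 0) (at x within {0..l})" if x: "x \<in> {0..l}" for x
    unfolding has_field_derivative_def has_derivative_within_alt
  proof (intro conjI allI impI)
    show "bounded_linear ((*) (0::real))" by (rule bounded_linear_mult_right)
    fix e :: real assume "0 < e"
    \<comment> \<open>Of the three parts, two come from the oscillation of \<open>v\<close> (both
      endpoints compared with \<open>x\<close>) and one from \<open>A\<close>.\<close>
    define \<eta> where "\<eta> = e / (3 * M)"
    have \<eta>: "0 < \<eta>" "3 * M * \<eta> = e" using \<open>0 < e\<close> M by (auto simp: \<eta>_def)
    obtain d1 where d1: "0 < d1" "\<And>z. z \<in> {0..l} \<Longrightarrow> dist z x < d1 \<Longrightarrow> dist (v z) (v x) < \<eta>"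
      using v_cont x \<eta>(1) unfolding continuous_on_iff by blast
    obtain d2 where d2: "0 < d2" "\<And>z. z \<in> {0..l} \<Longrightarrow> dist z x < d2 \<Longrightarrow> dist (A z) (A x) < \<eta>"
      using A_cont x \<eta>(1) unfolding continuous_on_iff by blast
    show "\<exists>d>0. \<forall>y\<in>{0..l}. norm (y - x) < d \<longrightarrow> norm (G y - G x - 0 * (y - x)) \<le> e * norm (y - x)"
    proof (intro exI[of _ "min d1 d2"] conjI ballI impI)
      show "0 < min d1 d2" using d1 d2 by simp
      fix y assume y: "y \<in> {0..l}" "norm (y - x) < min d1 d2"
      have vz: "\<bar>v z - v x\<bar> \<le> \<eta>" if "\<bar>z - x\<bar> \<le> \<bar>y - x\<bar>" "z \<in> {0..l}" for z
        using d1(2)[of z] that y by (auto simp: dist_real_def)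
      have Ay: "\<bar>A y - A x\<bar> \<le> \<eta>"
        using d2(2)[of y] y by (auto simp: dist_real_def)
      have "\<bar>G y - G x\<bar> \<le> M * \<bar>y - x\<bar> * (2 * \<eta> + \<bar>A y - A x\<bar>)"
      proof (cases "x \<le> y")
        case True
        have "\<bar>v y - v z\<bar> \<le> 2 * \<eta>" if "z \<in> {x..y}" for z
          using vz[of z] vz[of y] that x y by auto
        from G_small[OF _ True _ this] show ?thesis
          using True x y M(1)
          by (smt (verit) atLeastAtMost_iff mult_left_mono mult_nonneg_nonneg)
      next
        case False
        have "\<bar>v x - v z\<bar> \<le> 2 * \<eta>" if "z \<in> {y..x}" for z
          using vz[of z] \<eta>(1) that x y by auto
        from G_small[OF _ _ _ this] show ?thesis
          using False x y M(1)
          by (smt (verit) atLeastAtMost_iff mult_left_mono mult_nonneg_nonneg)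
      qed
      also have "\<dots> \<le> M * \<bar>y - x\<bar> * (2 * \<eta> + \<eta>)"
        using Ay M(1) by (intro mult_left_mono) auto
      also have "\<dots> = e * \<bar>y - x\<bar>"
        using \<eta>(2) by (simp add: algebra_simps)
      finally show "norm (G y - G x - 0 * (y - x)) \<le> e * norm (y - x)" by simp
    qed
  qed
  have "\<exists>k. \<forall>x\<in>{0..l}. G x = k"
    by (rule has_field_derivative_zero_constant[OF _ der]) simp_all
  then have "G l = G 0"
    using \<open>0 \<le> l\<close> by auto
  then have "integral {0..l} (\<lambda>x. v' x * f x) = v l * f l - v 0 * f 0 - integral {0..l} (\<lambda>x. v x * f' x)"
    by (simp add: G_def)
  then show ?thesis
    using v'f_int by (metis integrable_integral)
qed

section \<open>The closed loop\<close>

text \<open>Here \<open>u\<close> is the temperature relative to melting and \<open>u0'\<close> the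
  almost everywhere defined initial slope. Compatibility of the data appears as
  \<open>control\<close> and \<open>u_front\<close> at time 0, the setpoint condition as
  \<open>initial_input\<close>.\<close>

locale stefan_feedback =
  fixes \<alpha> \<beta> c sr H :: real and u ux uxx ut :: "real \<Rightarrow> real \<Rightarrow> real" and s u0' :: "real \<Rightarrow> real"
  assumes \<alpha>: "0 < \<alpha>" and \<beta>: "0 < \<beta>" and c: "0 < c"
    and s_pos: "0 \<le> t \<Longrightarrow> 0 < s t"
    and s_cont: "continuous_on {0..} s"
    and u_cont: "continuous_on (liquid_region s {0..}) (\<lambda>(x, t). u x t)"
    and ux_cont: "continuous_on (liquid_region s {0<..}) (\<lambda>(x, t). ux x t)"
    and uxx_cont: "continuous_on (liquid_region s {0<..}) (\<lambda>(x, t). uxx x t)"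
    and ut_cont: "continuous_on (liquid_region s {0<..}) (\<lambda>(x, t). ut x t)"
    and u_deriv: "0 < t \<Longrightarrow> x \<in> {0..s t} \<Longrightarrow>
          ((\<lambda>y. u y t) has_real_derivative ux x t) (at x within {0..s t})"
    and ux_deriv: "0 < t \<Longrightarrow> x \<in> {0..s t} \<Longrightarrow>
          ((\<lambda>y. ux y t) has_real_derivative uxx x t) (at x within {0..s t})"
    and u_deriv_t: "0 < t \<Longrightarrow> x \<in> {0..s t} \<Longrightarrow>
          ((\<lambda>\<tau>. u x \<tau>) has_real_derivative ut x t) (at t within {\<tau>. 0 \<le> \<tau> \<and> x \<le> s \<tau>})"
    and heat: "0 < t \<Longrightarrow> x \<in> {0..s t} \<Longrightarrow> ut x t = \<alpha> * uxx x t"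
    and u_front: "0 \<le> t \<Longrightarrow> u (s t) t = 0"
    and s_deriv: "0 < t \<Longrightarrow> (s has_real_derivative - \<beta> * ux (s t) t) (at t)"
    and control: "0 \<le> t \<Longrightarrow>
          u 0 t = - c * (integral {0..s t} (\<lambda>x. x * u x t) / \<alpha> + s t * (s t - sr) / \<beta>)"
    and initial_nonneg: "x \<in> {0..s 0} \<Longrightarrow> 0 \<le> u x 0"
    and initial_le: "x \<in> {0..s 0} \<Longrightarrow> u x 0 \<le> H * (s 0 - x)"
    and initial_input: "0 < u 0 0"
    and initial_deriv: "x \<in> {0..s 0} \<Longrightarrow> (u0' has_integral (u x 0 - u 0 0)) {0..x}"
    and initial_energy: "(\<lambda>x. (u0' x)\<^sup>2) integrable_on {0..s 0}"
begin

section \<open>Regularity of the solution and the equation for the input\<close>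

definition front_speed :: "real \<Rightarrow> real" where
  "front_speed t = - \<beta> * ux (s t) t"

lemma s_has_deriv: "0 < t \<Longrightarrow> (s has_real_derivative front_speed t) (at t)"
  using s_deriv by (simp add: front_speed_def)

lemma s_cont_Icc: "0 \<le> a \<Longrightarrow> continuous_on {a..b} s"
  by (rule continuous_on_subset[OF s_cont]) auto

lemma slices:
  "0 \<le> t \<Longrightarrow> continuous_on {0..s t} (\<lambda>x. u x t)"
  "0 < t \<Longrightarrow> continuous_on {0..s t} (\<lambda>x. ux x t)"
  "0 < t \<Longrightarrow> continuous_on {0..s t} (\<lambda>x. uxx x t)"
  "0 < t \<Longrightarrow> continuous_on {0..s t} (\<lambda>x. ut x t)"
  using u_cont ux_cont uxx_cont ut_cont by (auto elim!: continuous_on_slice)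

lemma input_cont: "continuous_on {0..} (u 0)"
proof -
  have "continuous_on {0..} ((\<lambda>(x, t). u x t) \<circ> (\<lambda>t. (0, t)))"
    by (rule continuous_on_compose[OF _ continuous_on_subset[OF u_cont]])
      (use s_pos in \<open>auto intro!: continuous_intros simp: liquid_region_def less_imp_le\<close>)
  then show ?thesis by (simp add: o_def)
qed

lemma u_deriv_interior:
  assumes "0 < t" "x \<in> {0<..<s t}"
  shows "((\<lambda>y. u y t) has_real_derivative ux x t) (at x)"
    and "((\<lambda>y. ux y t) has_real_derivative uxx x t) (at x)"
    and "((\<lambda>\<tau>. u x \<tau>) has_real_derivative ut x t) (at t)"
proof -
  show "((\<lambda>y. u y t) has_real_derivative ux x t) (at x)"
    using u_deriv[of t x] assms by (auto simp: at_within_Icc_at)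
  show "((\<lambda>y. ux y t) has_real_derivative uxx x t) (at x)"
    using ux_deriv[of t x] assms by (auto simp: at_within_Icc_at)
  have "open ({0<..} \<inter> s -` {x<..})"
    by (intro continuous_open_preimage continuous_on_subset[OF s_cont]) auto
  then have "at t within {\<tau>. 0 \<le> \<tau> \<and> x \<le> s \<tau>} = at t"
    using assms by (subst at_within_nhd[of t "{0<..} \<inter> s -` {x<..}" _ UNIV]) auto
  then show "((\<lambda>\<tau>. u x \<tau>) has_real_derivative ut x t) (at t)"
    using u_deriv_t[of t x] assms by auto
qed

lemma input_deriv: "0 < t \<Longrightarrow> (u 0 has_real_derivative ut 0 t) (at t)"
proof -
  assume t: "0 < t"
  have "{\<tau>. 0 \<le> \<tau> \<and> 0 \<le> s \<tau>} = {0..}"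
    using s_pos by (auto simp: less_imp_le)
  moreover have "at t within {0..} = at t"
    using t by (subst at_within_nhd[of t "{0<..}" _ UNIV]) auto
  ultimately show ?thesis
    using u_deriv_t[OF t, of 0] s_pos[of t] t by simp
qed

text \<open>Monotonicity of \<open>s\<close> keeps \<open>x\<close> in the liquid during all of
  \<open>[\<tau>, t]\<close>. It is a hypothesis here and in the next lemmas because it is at first
  known only on intervals with nonnegative input, inside the continuation argument that ends in
  \<open>input_pos\<close>.\<close>

lemma u_mean_value_t:
  assumes "0 < \<tau>" "\<tau> < t" and mono: "mono_on {0..t} s" and x: "x \<in> {0..s \<tau>}"
  shows "\<exists>\<xi>\<in>{\<tau><..<t}. u x t - u x \<tau> = (t - \<tau>) * ut x \<xi>"
proof -
  have xs: "x \<in> {0..s \<xi>}" if "\<tau> \<le> \<xi>" "\<xi> \<le> t" for \<xi>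
    using monotone_onD[OF mono, of \<tau> \<xi>] assms that by auto
  have "\<exists>\<xi>\<in>{\<tau><..<t}. u x t - u x \<tau> = ut x \<xi> * (t - \<tau>)"
  proof (rule mvt_simple[OF \<open>\<tau> < t\<close>, of "\<lambda>\<tau>. u x \<tau>" "\<lambda>\<xi> h. ut x \<xi> * h"])
    fix \<xi> assume "\<tau> \<le> \<xi>" "\<xi> \<le> t"
    then have "((\<lambda>\<tau>. u x \<tau>) has_real_derivative ut x \<xi>) (at \<xi> within {\<tau>..t})"
      using assms xs by (intro DERIV_subset[OF u_deriv_t]) auto
    then show "((\<lambda>\<tau>. u x \<tau>) has_derivative (\<lambda>h. ut x \<xi> * h)) (at \<xi> within {\<tau>..t})"
      by (simp add: has_field_derivative_def)
  qed
  then show ?thesis by (simp add: mult.commute)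
qed

lemma range_if_mono: "mono_on {0..t} s \<Longrightarrow> \<tau> \<in> {a..t} \<Longrightarrow> 0 \<le> a \<Longrightarrow> s \<tau> \<in> {0..s t}"
  using s_pos[of \<tau>] by (auto dest!: monotone_onD[of _ _ _ s \<tau> t])

text \<open>Time differentiation under the integral, with the test function frozen at the final time:
  no mixed derivative of \<open>u\<close> is involved.\<close>

lemma left_quotient_pairing:
  assumes t: "0 < t" and mono: "mono_on {0..t} s" and \<phi>: "continuous_on {0..s t} \<phi>"
  shows "((\<lambda>\<tau>. integral {0..s \<tau>} (\<lambda>x. \<phi> x * (u x t - u x \<tau>)) / (t - \<tau>))
          \<longlongrightarrow> integral {0..s t} (\<lambda>x. \<phi> x * ut x t)) (at_left t)"
proof -
  define g where "g x = \<phi> x * ut x t" for x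
  define R where "R \<tau> = integral {0..s \<tau>} (\<lambda>x. \<phi> x * ((u x t - u x \<tau>) / (t - \<tau>) - ut x t))" for \<tau>
  define B where "B = integral {0..s t} (\<lambda>x. \<bar>\<phi> x\<bar>)"
  have g: "continuous_on {0..s t} g"
    unfolding g_def using \<phi> t by (intro continuous_intros slices)
  have range: "s \<tau> \<in> {0..s t}" if "\<tau> \<in> {0..t}" for \<tau>
    using range_if_mono[OF mono that] by simp
  have \<phi>_abs: "(\<lambda>x. \<bar>\<phi> x\<bar>) integrable_on {0..s t}"
    by (intro integrable_continuous_interval continuous_intros \<phi>)
  have "0 \<le> B"
    unfolding B_def by (intro integral_nonneg \<phi>_abs) auto
  have near: "\<forall>\<^sub>F \<tau> in at_left t. \<tau> \<in> {t/2<..<t}"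
    using t by (intro eventually_at_left_real) auto
  have sub: "continuous_on {0..s \<tau>} (\<lambda>x. \<phi> x * ((u x t - u x \<tau>) / (t - \<tau>) - ut x t))"
       "continuous_on {0..s \<tau>} g" "(\<lambda>x. \<bar>\<phi> x\<bar>) integrable_on {0..s \<tau>}"
       "{0..s \<tau>} \<subseteq> {0..s t}" if "\<tau> \<in> {0<..<t}" for \<tau>
  proof -
    have le: "{0..s \<tau>} \<subseteq> {0..s t}" using range[of \<tau>] that by auto
    show "continuous_on {0..s \<tau>} (\<lambda>x. \<phi> x * ((u x t - u x \<tau>) / (t - \<tau>) - ut x t))"
      using that t
      by (intro continuous_intros continuous_on_subset[OF \<phi> le] slices
          continuous_on_subset[OF slices(1) le] continuous_on_subset[OF slices(4) le]) auto
    show "continuous_on {0..s \<tau>} g" by (rule continuous_on_subset[OF g le])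
    then show "(\<lambda>x. \<bar>\<phi> x\<bar>) integrable_on {0..s \<tau>}"
      by (intro integrable_continuous_interval continuous_intros continuous_on_subset[OF \<phi> le])
    show "{0..s \<tau>} \<subseteq> {0..s t}" by (rule le)
  qed
  have "(R \<longlongrightarrow> 0) (at_left t)"
  proof (rule tendstoI)
    fix e :: real assume "0 < e"
    define e' where "e' = e / (B + 1)"
    have e': "0 < e'" "e' * B < e"
      using \<open>0 < e\<close> \<open>0 \<le> B\<close> by (auto simp: e'_def field_simps)
    \<comment> \<open>The slab starts at \<open>t/2\<close> because \<open>ut\<close> is continuous
      only at positive times. Its compactness makes the convergence of the quotients uniform in
      \<open>x\<close>.\<close>
    have K: "continuous_on (liquid_region s {t/2..t}) (\<lambda>(x, t). ut x t)"
      by (rule continuous_on_subset[OF ut_cont]) (use t in \<open>auto simp: liquid_region_def\<close>)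
    have "uniformly_continuous_on (liquid_region s {t/2..t}) (\<lambda>(x, t). ut x t)"
      using t by (intro compact_uniformly_continuous K compact_liquid_region s_cont_Icc) auto
    then obtain d where d: "0 < d" "\<And>x \<xi>. (x, \<xi>) \<in> liquid_region s {t/2..t} \<Longrightarrow> (x, t) \<in> liquid_region s {t/2..t}
        \<Longrightarrow> \<bar>t - \<xi>\<bar> < d \<Longrightarrow> \<bar>ut x \<xi> - ut x t\<bar> < e'"
      unfolding uniformly_continuous_on_def using e'(1)
      by (force simp: dist_Pair_Pair dist_real_def)
    have "\<forall>\<^sub>F \<tau> in at_left t. \<tau> \<in> {t - d<..<t}"
      using d(1) by (intro eventually_at_left_real) auto
    with near show "\<forall>\<^sub>F \<tau> in at_left t. dist (R \<tau>) 0 < e"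
    proof eventually_elim
      case (elim \<tau>)
      have \<tau>: "\<tau> \<in> {0<..<t}" using elim t by auto
      have pt: "\<bar>\<phi> x * ((u x t - u x \<tau>) / (t - \<tau>) - ut x t)\<bar> \<le> e' * \<bar>\<phi> x\<bar>" if x: "x \<in> {0..s \<tau>}" for x
      proof -
        obtain \<xi> where \<xi>: "\<xi> \<in> {\<tau><..<t}" "u x t - u x \<tau> = (t - \<tau>) * ut x \<xi>"
          using u_mean_value_t[OF _ _ mono x] \<tau> by auto
        have "s \<tau> \<le> s \<xi>" "s \<xi> \<le> s t"
          using monotone_onD[OF mono, of \<tau> \<xi>] monotone_onD[OF mono, of \<xi> t] \<xi>(1) \<tau> by auto
        then have "\<bar>ut x \<xi> - ut x t\<bar> < e'"
          using x \<xi>(1) elim by (intro d(2)) (auto simp: liquid_region_def)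
        moreover have "(u x t - u x \<tau>) / (t - \<tau>) = ut x \<xi>"
          using \<xi>(2) \<tau> by simp
        ultimately show ?thesis
          using mult_left_mono[of "\<bar>ut x \<xi> - ut x t\<bar>" e' "\<bar>\<phi> x\<bar>"] by (simp add: abs_mult mult.commute)
      qed
      have "\<bar>R \<tau>\<bar> \<le> integral {0..s \<tau>} (\<lambda>x. e' * \<bar>\<phi> x\<bar>)"
        unfolding R_def
        by (intro abs_integral_le_integral pt integrable_continuous_interval sub integrable_on_mult_right \<tau>)
      also have "\<dots> \<le> e' * B"
        using e'(1) unfolding B_def integral_mult_right
        by (intro mult_left_mono Henstock_Kurzweil_Integration.integral_subset_le sub[OF \<tau>] \<phi>_abs) auto
      finally show ?case using e'(2) by simp
    qed
  qed
  \<comment> \<open>The limit integral reaches to \<open>s t\<close>, the quotients only to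
    \<open>s \<tau>\<close>. The strip in between vanishes in the limit, being a convergent quotient
    times \<open>t - \<tau>\<close>.\<close>
  moreover have "((\<lambda>\<tau>. integral {s \<tau>..s t} g / (t - \<tau>) * (t - \<tau>)) \<longlongrightarrow> g (s t) * front_speed t * 0) (at_left t)"
    by (intro tendsto_mult left_quotient_integral[OF t s_has_deriv[OF t] range g])
      (auto intro!: tendsto_eq_intros)
  ultimately have "((\<lambda>\<tau>. R \<tau> + integral {0..s t} g - integral {s \<tau>..s t} g / (t - \<tau>) * (t - \<tau>))
      \<longlongrightarrow> 0 + integral {0..s t} g - g (s t) * front_speed t * 0) (at_left t)"
    by (intro tendsto_add tendsto_diff tendsto_const)
  then have "((\<lambda>\<tau>. integral {0..s \<tau>} (\<lambda>x. \<phi> x * (u x t - u x \<tau>)) / (t - \<tau>))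
      \<longlongrightarrow> 0 + integral {0..s t} g - g (s t) * front_speed t * 0) (at_left t)"
  proof (rule Lim_transform_eventually)
    show "\<forall>\<^sub>F \<tau> in at_left t. R \<tau> + integral {0..s t} g - integral {s \<tau>..s t} g / (t - \<tau>) * (t - \<tau>)
        = integral {0..s \<tau>} (\<lambda>x. \<phi> x * (u x t - u x \<tau>)) / (t - \<tau>)"
      using near
    proof eventually_elim
      case (elim \<tau>)
      then have \<tau>: "\<tau> \<in> {0<..<t}" using t by auto
      have "integral {0..s t} g - integral {s \<tau>..s t} g = integral {0..s \<tau>} g"
        using Henstock_Kurzweil_Integration.integral_combine[of 0 "s \<tau>" "s t" g]
          integrable_continuous_interval[OF g] range[of \<tau>] \<tau> by auto
      moreover have "R \<tau> + integral {0..s \<tau>} g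
          = integral {0..s \<tau>} (\<lambda>x. \<phi> x * (u x t - u x \<tau>) / (t - \<tau>))"
        unfolding R_def
        unfolding Henstock_Kurzweil_Integration.integral_add[OF
            sub(1,2)[OF \<tau>, THEN integrable_continuous_interval], symmetric]
        by (rule Henstock_Kurzweil_Integration.integral_cong) (simp add: g_def algebra_simps)
      ultimately show ?case using \<tau> by simp
    qed
  qed
  then show ?thesis by (simp add: g_def[abs_def])
qed

text \<open>By the heat equation and integration by parts the moment \<open>m\<close> has left
  derivative \<open>\<alpha> * (s t * ux (s t) t + u 0 t)\<close>. Its flux part equals
  \<open>- \<alpha> * s t * front_speed t / \<beta>\<close> and combines with the derivative of
  \<open>s * (s - sr)\<close>, so that only the factor \<open>s t - sr\<close> remains in front of
  the speed.\<close>

lemma input_ode: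
  assumes t: "0 < t" and mono: "mono_on {0..t} s"
  shows "ut 0 t = - c * u 0 t + c / \<beta> * (sr - s t) * front_speed t"
proof -
  define m where "m t = integral {0..s t} (\<lambda>x. x * u x t)" for t
  have range: "s \<tau> \<in> {0..s t}" if "\<tau> \<in> {0..t}" for \<tau>
    using range_if_mono[OF mono that] by simp
  have xu: "continuous_on {0..s t} (\<lambda>x. x * u x t)"
    using t by (intro continuous_intros slices) auto
  have "((\<lambda>\<tau>. integral {0..s \<tau>} (\<lambda>x. x * (u x t - u x \<tau>)) / (t - \<tau>)
          + integral {s \<tau>..s t} (\<lambda>x. x * u x t) / (t - \<tau>))
         \<longlongrightarrow> integral {0..s t} (\<lambda>x. x * ut x t) + s t * u (s t) t * front_speed t) (at_left t)"
    by (intro tendsto_add left_quotient_pairing[OF t mono]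
        left_quotient_integral[OF t s_has_deriv[OF t] range xu] continuous_intros)
  then have "((\<lambda>\<tau>. (m t - m \<tau>) / (t - \<tau>))
         \<longlongrightarrow> integral {0..s t} (\<lambda>x. x * ut x t) + s t * u (s t) t * front_speed t) (at_left t)"
  proof (rule Lim_transform_eventually)
    show "\<forall>\<^sub>F \<tau> in at_left t. integral {0..s \<tau>} (\<lambda>x. x * (u x t - u x \<tau>)) / (t - \<tau>)
          + integral {s \<tau>..s t} (\<lambda>x. x * u x t) / (t - \<tau>) = (m t - m \<tau>) / (t - \<tau>)"
      using eventually_at_left_real[OF t]
    proof eventually_elim
      case (elim \<tau>)
      then have le: "{0..s \<tau>} \<subseteq> {0..s t}" "0 \<le> s \<tau>" "s \<tau> \<le> s t" using range[of \<tau>] by auto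
      have "integral {0..s \<tau>} (\<lambda>x. x * (u x t - u x \<tau>))
          = integral {0..s \<tau>} (\<lambda>x. x * u x t) - m \<tau>"
        unfolding m_def right_diff_distrib using elim
        by (intro Henstock_Kurzweil_Integration.integral_diff integrable_continuous_interval continuous_intros slices
            continuous_on_subset[OF xu le(1)]) auto
      moreover have "integral {0..s \<tau>} (\<lambda>x. x * u x t) + integral {s \<tau>..s t} (\<lambda>x. x * u x t) = m t"
        unfolding m_def
        using Henstock_Kurzweil_Integration.integral_combine[of 0 "s \<tau>" "s t"]
          integrable_continuous_interval[OF xu] le by blast
      ultimately show ?case by (simp flip: add_divide_distrib)
    qed
  qed
  moreover have "integral {0..s t} (\<lambda>x. x * ut x t) = \<alpha> * (s t * ux (s t) t + u 0 t)"
  proof -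
    have "((\<lambda>x. \<alpha> * (x * uxx x t)) has_integral
        \<alpha> * ((s t * ux (s t) t - u (s t) t) - (0 * ux 0 t - u 0 t))) {0..s t}"
      using s_pos[of t] t
      by (intro has_integral_mult_right fundamental_theorem_of_calculus)
        (auto simp flip: has_real_derivative_iff_has_vector_derivative
           intro!: derivative_eq_intros u_deriv ux_deriv)
    then have "integral {0..s t} (\<lambda>x. \<alpha> * (x * uxx x t)) = \<alpha> * (s t * ux (s t) t + u 0 t)"
      by (rule integral_unique[THEN trans]) (use u_front[of t] t in simp)
    moreover have "integral {0..s t} (\<lambda>x. x * ut x t) = integral {0..s t} (\<lambda>x. \<alpha> * (x * uxx x t))"
      using t by (intro Henstock_Kurzweil_Integration.integral_cong) (simp add: heat)
    ultimately show ?thesis by (rule trans[rotated])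
  qed
  ultimately have m: "((\<lambda>\<tau>. (m t - m \<tau>) / (t - \<tau>)) \<longlongrightarrow> \<alpha> * (s t * ux (s t) t + u 0 t)) (at_left t)"
    using u_front[of t] t by simp
  have "((\<lambda>\<tau>. s \<tau> * (s \<tau> - sr)) has_real_derivative (2 * s t - sr) * front_speed t) (at t within {0..t})"
    by (rule has_field_derivative_at_within)
      (auto intro!: derivative_eq_intros s_has_deriv t simp: algebra_simps)
  from tendsto_add[OF tendsto_divide[OF m tendsto_const[of \<alpha>]]
        tendsto_divide[OF left_quotient_tendsto[OF this t] tendsto_const[of \<beta>]]]
  have "((\<lambda>\<tau>. - c * ((m t - m \<tau>) / (t - \<tau>) / \<alpha> + (s t * (s t - sr) - s \<tau> * (s \<tau> - sr)) / (t - \<tau>) / \<beta>))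
     \<longlongrightarrow> - c * (\<alpha> * (s t * ux (s t) t + u 0 t) / \<alpha> + (2 * s t - sr) * front_speed t / \<beta>)) (at_left t)"
    using \<alpha> \<beta> by (intro tendsto_mult tendsto_const) auto
  then have "((\<lambda>\<tau>. (u 0 t - u 0 \<tau>) / (t - \<tau>))
     \<longlongrightarrow> - c * (\<alpha> * (s t * ux (s t) t + u 0 t) / \<alpha> + (2 * s t - sr) * front_speed t / \<beta>)) (at_left t)"
  proof (rule Lim_transform_eventually)
    show "\<forall>\<^sub>F \<tau> in at_left t. - c * ((m t - m \<tau>) / (t - \<tau>) / \<alpha> + (s t * (s t - sr) - s \<tau> * (s \<tau> - sr)) / (t - \<tau>) / \<beta>)
        = (u 0 t - u 0 \<tau>) / (t - \<tau>)"
      using eventually_at_left_real[OF t]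
    proof eventually_elim
      case (elim \<tau>)
      then have "u 0 \<tau> = - c * (m \<tau> / \<alpha> + s \<tau> * (s \<tau> - sr) / \<beta>)"
          "u 0 t = - c * (m t / \<alpha> + s t * (s t - sr) / \<beta>)"
        using control[of \<tau>] control[of t] t by (auto simp: m_def)
      then have "u 0 t - u 0 \<tau> = - c * ((m t - m \<tau>) / \<alpha> + (s t * (s t - sr) - s \<tau> * (s \<tau> - sr)) / \<beta>)"
        by (simp add: diff_divide_distrib algebra_simps)
      moreover have "- c * (A / h / \<alpha> + B / h / \<beta>) = (- c * (A / \<alpha> + B / \<beta>)) / h" for A B h :: real
        by (simp add: add_divide_distrib diff_divide_distrib distrib_left mult.commute)
      ultimately show ?case by simp
    qed
  qed
  \<comment> \<open>The input is differentiable in time as the trace of \<open>u\<close> at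
    \<open>x = 0\<close>, so uniqueness of the limit identifies the two expressions.\<close>
  moreover have "((\<lambda>\<tau>. (u 0 t - u 0 \<tau>) / (t - \<tau>)) \<longlongrightarrow> ut 0 t) (at_left t)"
    by (rule left_quotient_tendsto[OF has_field_derivative_at_within[OF input_deriv[OF t]] t])
  ultimately have "ut 0 t = - c * (\<alpha> * (s t * ux (s t) t + u 0 t) / \<alpha> + (2 * s t - sr) * front_speed t / \<beta>)"
    using tendsto_unique trivial_limit_at_left_real by blast
  moreover have "\<alpha> * (s t * ux (s t) t + u 0 t) / \<alpha> = s t * ux (s t) t + u 0 t"
    using \<alpha> by simp
  ultimately have "ut 0 t = - c * (s t * ux (s t) t + u 0 t + (2 * s t - sr) * front_speed t / \<beta>)"
    by simp
  then show ?thesis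
    using \<beta> by (simp add: front_speed_def field_simps)
qed

end

section \<open>Sign of the temperature and monotonicity of the interface\<close>

context stefan_feedback
begin

lemma u_nonneg:
  assumes bd: "\<And>\<tau>. \<tau> \<in> {0..t1} \<Longrightarrow> 0 \<le> u 0 \<tau>" and mem: "t \<in> {0..t1}" "x \<in> {0..s t}"
  shows "0 \<le> u x t"
proof (rule weak_maximum_principle[where z = u and zx = ux and zxx = uxx and zt = ut and s = s, OF \<alpha> _ _ _ _ _ _ _ _ _ mem])
  show "continuous_on (liquid_region s {0..t1}) (\<lambda>(x, t). u x t)"
    by (rule continuous_on_subset[OF u_cont]) (auto simp: liquid_region_def)
  show "continuous_on {0..t1} s" by (rule s_cont_Icc) simp
  show "\<alpha> * uxx x t \<le> ut x t" if "t \<in> {0<..t1}" "x \<in> {0<..<s t}" for x t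
    using heat[of t x] that by auto
qed (use bd initial_nonneg in \<open>auto simp: u_front u_deriv_interior\<close>)

lemma slope_front_nonpos:
  assumes t: "0 < t" and nonneg: "\<And>x. x \<in> {0..s t} \<Longrightarrow> 0 \<le> u x t"
  shows "ux (s t) t \<le> 0"
proof (rule ccontr)
  assume "\<not> ux (s t) t \<le> 0"
  then have pos: "0 < ux (s t) t" by simp
  have "s t \<in> {0..s t}" using s_pos[of t] t by simp
  from has_real_derivative_pos_inc_left[OF u_deriv[OF t this] pos]
  obtain d where d: "0 < d" "\<And>h. 0 < h \<Longrightarrow> s t - h \<in> {0..s t} \<Longrightarrow> h < d \<Longrightarrow> u (s t - h) t < u (s t) t"
    by blast
  define h where "h = min d (s t) / 2"
  have h: "0 < h" "h < d" "h < s t"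
    using d(1) s_pos[of t] t by (auto simp: h_def min_def)
  show False
    using d(2)[of h] nonneg[of "s t - h"] h u_front[of t] t by auto
qed

lemma mono_if_front_speed_nonneg:
  assumes "\<And>\<tau>. 0 < \<tau> \<Longrightarrow> \<tau> \<le> t1 \<Longrightarrow> 0 \<le> front_speed \<tau>"
  shows "mono_on {0..t1} s"
proof (rule monotone_onI)
  fix a b assume ab: "a \<in> {0..t1}" "b \<in> {0..t1}" "a \<le> b"
  show "s a \<le> s b"
  proof (rule DERIV_nonneg_imp_increasing_open[OF ab(3)])
    show "\<exists>y. (s has_real_derivative y) (at x) \<and> 0 \<le> y" if "a < x" "x < b" for x
      using s_has_deriv[of x] assms[of x] that ab by auto
    show "continuous_on {a..b} s" using ab by (intro s_cont_Icc) auto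
  qed
qed

text \<open>A nonnegative moment and a nonnegative input leave the control law no choice but
  \<open>s t * (s t - sr) \<le> 0\<close>.\<close>

lemma s_le_setpoint:
  assumes t: "0 \<le> t" and "0 \<le> u 0 t" and nonneg: "\<And>x. x \<in> {0..s t} \<Longrightarrow> 0 \<le> u x t"
  shows "s t \<le> sr"
proof -
  have "0 \<le> integral {0..s t} (\<lambda>x. x * u x t)"
    using t nonneg
    by (intro integral_nonneg integrable_continuous_interval continuous_intros slices) auto
  then have "0 \<le> integral {0..s t} (\<lambda>x. x * u x t) / \<alpha>"
    using \<alpha> by simp
  moreover have "integral {0..s t} (\<lambda>x. x * u x t) / \<alpha> + s t * (s t - sr) / \<beta> \<le> 0"
    using control[OF t] \<open>0 \<le> u 0 t\<close> c by (simp add: zero_le_mult_iff mult_le_0_iff)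
  ultimately have "s t * (s t - sr) / \<beta> \<le> 0" by linarith
  then show ?thesis
    using \<beta> s_pos[OF t] by (simp add: divide_le_0_iff mult_le_0_iff)
qed

text \<open>This quantitative form is what the continuation needs: a weak sign condition on a closed
  interval gives strict positivity at its right end. The forcing in \<open>input_ode\<close> is
  nonnegative, so \<open>exp (c * t) * u 0 t\<close> is nondecreasing.\<close>

lemma input_lower_bound:
  assumes "0 \<le> t1" and bd: "\<And>\<tau>. \<tau> \<in> {0..t1} \<Longrightarrow> 0 \<le> u 0 \<tau>"
  shows "u 0 0 \<le> exp (c * t1) * u 0 t1"
proof -
  have speed: "0 \<le> front_speed \<tau>" if "0 < \<tau>" "\<tau> \<le> t1" for \<tau>
    using slope_front_nonpos[of \<tau>] u_nonneg[OF bd, of t1 \<tau>] that \<beta>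
    by (simp add: front_speed_def mult_nonneg_nonpos)
  note mono = mono_if_front_speed_nonneg[OF speed]
  have "exp (c * 0) * u 0 0 \<le> exp (c * t1) * u 0 t1"
  proof (rule DERIV_nonneg_imp_increasing_open[OF \<open>0 \<le> t1\<close>, of "\<lambda>t. exp (c * t) * u 0 t"])
    show "continuous_on {0..t1} (\<lambda>t. exp (c * t) * u 0 t)"
      by (intro continuous_intros continuous_on_subset[OF input_cont]) auto
    fix \<tau> assume \<tau>: "0 < \<tau>" "\<tau> < t1"
    have "s \<tau> \<le> sr"
      using \<tau> bd u_nonneg[OF bd, of t1 \<tau>] by (intro s_le_setpoint) auto
    then have nn: "0 \<le> c / \<beta> * (sr - s \<tau>) * front_speed \<tau>"
      using c \<beta> speed[of \<tau>] \<tau> by simp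
    have "ut 0 \<tau> = - c * u 0 \<tau> + c / \<beta> * (sr - s \<tau>) * front_speed \<tau>"
      by (rule input_ode[OF \<tau>(1) mono_on_subset[OF mono]]) (use \<tau> in auto)
    then have eq: "c * u 0 \<tau> + ut 0 \<tau> = c / \<beta> * (sr - s \<tau>) * front_speed \<tau>" by simp
    have "((\<lambda>t. exp (c * t) * u 0 t) has_real_derivative
        exp (c * \<tau>) * (c * u 0 \<tau> + ut 0 \<tau>)) (at \<tau>)"
      by (auto intro!: derivative_eq_intros input_deriv \<tau> simp: algebra_simps)
    then show "\<exists>y. ((\<lambda>t. exp (c * t) * u 0 t) has_real_derivative y) (at \<tau>) \<and> 0 \<le> y"
      unfolding eq by (intro exI conjI) (assumption, rule mult_nonneg_nonneg[OF exp_ge_zero nn])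
  qed
  then show ?thesis by simp
qed

text \<open>Continuation up to the first time \<open>m\<close> at which the input is not positive;
  there \<open>input_lower_bound\<close> contradicts the choice of \<open>m\<close>.\<close>

lemma input_pos:
  assumes "0 \<le> t"
  shows "0 < u 0 t"
proof (rule ccontr)
  assume neg: "\<not> 0 < u 0 t"
  define S where "S = {\<tau> \<in> {0..t}. u 0 \<tau> \<le> 0}"
  have cont: "continuous_on {0..t} (u 0)"
    by (rule continuous_on_subset[OF input_cont]) auto
  have "closed S"
    unfolding S_def
    by (intro continuous_on_closed_Collect_le continuous_intros cont closed_real_atLeastAtMost)
  moreover have "S = S \<inter> {0..t}" by (auto simp: S_def)
  ultimately have "compact S"
    by (metis closed_Int_compact compact_Icc)
  moreover have "t \<in> S" using neg \<open>0 \<le> t\<close> by (auto simp: S_def)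
  ultimately obtain m where m: "m \<in> S" "\<And>x. x \<in> S \<Longrightarrow> m \<le> x"
    using continuous_attains_inf[of S "\<lambda>x. x"] by (auto simp: continuous_on_id)
  have mt: "0 \<le> m" "m \<le> t" "u 0 m \<le> 0" using m(1) by (auto simp: S_def)
  have before: "0 < u 0 \<tau>" if "0 \<le> \<tau>" "\<tau> < m" for \<tau>
    using m(2)[of \<tau>] that mt by (force simp: S_def)
  have "m \<noteq> 0" using mt(3) initial_input by auto
  \<comment> \<open>\<open>input_lower_bound\<close> requires the sign on the closed interval, and
    at \<open>m\<close> itself it comes from the limit from the left.\<close>
  have "0 \<le> u 0 m"
  proof (rule tendsto_lowerbound)
    have "(u 0 \<longlongrightarrow> u 0 m) (at m within {0..t})"
      using cont mt by (auto simp: continuous_on_def)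
    then show "(u 0 \<longlongrightarrow> u 0 m) (at m within {0..m})"
      by (rule tendsto_within_subset) (use mt in auto)
    show "\<forall>\<^sub>F \<tau> in at m within {0..m}. 0 \<le> u 0 \<tau>"
      using before by (auto simp: eventually_at_filter intro!: always_eventually less_imp_le)
    show "at m within {0..m} \<noteq> bot"
      using mt \<open>m \<noteq> 0\<close> by (simp add: at_within_Icc_at_left)
  qed
  then have "0 \<le> u 0 \<tau>" if "\<tau> \<in> {0..m}" for \<tau>
    using before[of \<tau>] that by (cases "\<tau> = m") auto
  from input_lower_bound[OF mt(1) this] initial_input have "0 < exp (c * m) * u 0 m"
    by simp
  then show False using mt(3) by (simp add: zero_less_mult_iff)
qed

lemma u_pos: "0 \<le> t \<Longrightarrow> x \<in> {0..s t} \<Longrightarrow> 0 \<le> u x t"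
  by (rule u_nonneg[of t]) (auto intro!: less_imp_le[OF input_pos])

lemma front_speed_nonneg: "0 < t \<Longrightarrow> 0 \<le> front_speed t"
  using slope_front_nonpos[of t] u_pos[of t] \<beta> by (simp add: front_speed_def mult_nonneg_nonpos)

lemma s_mono: "mono_on {0..t} s"
  by (rule mono_if_front_speed_nonneg) (rule front_speed_nonneg)

lemma s_le: "0 \<le> t \<Longrightarrow> s t \<le> sr"
  by (rule s_le_setpoint) (auto intro!: less_imp_le[OF input_pos] u_pos)

lemma s_range: "0 \<le> a \<Longrightarrow> \<tau> \<in> {a..t} \<Longrightarrow> s \<tau> \<in> {0..s t}"
  by (rule range_if_mono[OF s_mono])

lemma sr_pos: "0 < sr"
  using s_pos[of 0] s_le[of 0] by simp

lemma input_deriv_eq: "0 < t \<Longrightarrow> ut 0 t = - c * u 0 t + c / \<beta> * (sr - s t) * front_speed t"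
  by (rule input_ode[OF _ s_mono])

lemma input_le:
  assumes t: "0 \<le> t"
  shows "u 0 t \<le> c * s t * (sr - s t) / \<beta>"
proof -
  have "0 \<le> integral {0..s t} (\<lambda>x. x * u x t)"
    using t u_pos
    by (intro integral_nonneg integrable_continuous_interval continuous_intros slices) auto
  then have "0 \<le> c * (integral {0..s t} (\<lambda>x. x * u x t) / \<alpha>)"
    using \<alpha> c by simp
  moreover have "u 0 t = c * s t * (sr - s t) / \<beta> - c * (integral {0..s t} (\<lambda>x. x * u x t) / \<alpha>)"
    using control[OF t] by (simp add: algebra_simps diff_divide_distrib)
  ultimately show ?thesis by linarith
qed

text \<open>The barrier \<open>h (s t - x)\<close> is a supersolution because the interface moves outwards.\<close>

lemma front_speed_bounded: "\<exists>K>0. \<forall>t>0. front_speed t \<le> K"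
proof -
  \<comment> \<open>The first entry dominates the initial profile. The second makes the barrier at
    \<open>x = 0\<close>, which is at least \<open>h * s 0\<close>, exceed the bound on the input
    from \<open>input_le\<close>.\<close>
  define h where "h = max \<bar>H\<bar> (c * sr * sr / (\<beta> * s 0))"
  have s0: "0 < s 0" by (simp add: s_pos)
  have h: "0 \<le> h" "H \<le> h" "c * sr * sr / \<beta> \<le> h * s 0"
  proof -
    have "c * sr * sr / (\<beta> * s 0) \<le> h" by (simp add: h_def)
    then show "c * sr * sr / \<beta> \<le> h * s 0" using s0 \<beta> by (simp add: field_simps)
  qed (auto simp: h_def)
  have barrier: "0 \<le> h * (s t - x) - u x t" if t: "0 \<le> t" "x \<in> {0..s t}" for t x
  proof (rule weak_maximum_principle[where z = "\<lambda>x t. h * (s t - x) - u x t"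
        and zx = "\<lambda>x t. - h - ux x t" and zxx = "\<lambda>x t. - uxx x t"
        and zt = "\<lambda>x t. h * front_speed t - ut x t" and s = s and ?t1.0 = t, OF \<alpha>])
    have sc: "continuous_on (liquid_region s {0..t}) (\<lambda>p. s (snd p))"
      by (rule continuous_on_compose2[OF s_cont]) (auto intro!: continuous_intros simp: liquid_region_def)
    have uc: "continuous_on (liquid_region s {0..t}) (\<lambda>p. u (fst p) (snd p))"
      by (rule continuous_on_subset[OF u_cont[unfolded case_prod_beta]]) (auto simp: liquid_region_def)
    show "continuous_on (liquid_region s {0..t}) (\<lambda>(x, t). h * (s t - x) - u x t)"
      unfolding case_prod_beta by (intro continuous_intros sc uc)
    show "continuous_on {0..t} s" by (rule s_cont_Icc) simp
    show "0 \<le> h * (s \<tau> - 0) - u 0 \<tau>" if "\<tau> \<in> {0..t}" for \<tau>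
    proof -
      have tt: "0 \<le> \<tau>" using that by simp
      have "c * s \<tau> * (sr - s \<tau>) / \<beta> \<le> c * sr * sr / \<beta>"
        using c \<beta> s_pos[OF tt] s_le[OF tt] by (intro divide_right_mono mult_mono) auto
      moreover have "h * s 0 \<le> h * s \<tau>"
        using s_range[of 0 0 \<tau>] tt h(1) by (intro mult_left_mono) auto
      ultimately show ?thesis
        using input_le[OF tt] h(3) by simp
    qed
    show "0 \<le> h * (s \<tau> - s \<tau>) - u (s \<tau>) \<tau>" if "\<tau> \<in> {0..t}" for \<tau>
      using that by (simp add: u_front)
    show "0 \<le> h * (s 0 - x) - u x 0" if x: "x \<in> {0..s 0}" for x
      using initial_le[OF x] mult_right_mono[OF h(2), of "s 0 - x"] x by simp
    show "\<alpha> * - uxx x \<tau> \<le> h * front_speed \<tau> - ut x \<tau>" if "\<tau> \<in> {0<..t}" "x \<in> {0<..<s \<tau>}" for x \<tau>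
      using heat[of \<tau> x] front_speed_nonneg[of \<tau>] h(1) that by simp
    show "((\<lambda>y. h * (s \<tau> - y) - u y \<tau>) has_real_derivative - h - ux x \<tau>) (at x)"
      if "\<tau> \<in> {0<..t}" "x \<in> {0<..<s \<tau>}" for x \<tau>
      using that by (auto intro!: derivative_eq_intros u_deriv_interior)
    show "((\<lambda>y. - h - ux y \<tau>) has_real_derivative - uxx x \<tau>) (at x)"
      if "\<tau> \<in> {0<..t}" "x \<in> {0<..<s \<tau>}" for x \<tau>
      using that by (auto intro!: derivative_eq_intros u_deriv_interior)
    show "((\<lambda>\<tau>. h * (s \<tau> - x) - u x \<tau>) has_real_derivative h * front_speed \<tau> - ut x \<tau>) (at \<tau>)"
      if "\<tau> \<in> {0<..t}" "x \<in> {0<..<s \<tau>}" for x \<tau>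
      using that by (auto intro!: derivative_eq_intros u_deriv_interior s_has_deriv)
  qed (use t in auto)
  \<comment> \<open>Barrier and temperature both vanish at the interface, so their ordering in the
    liquid passes to the slopes there.\<close>
  have "- ux (s t) t \<le> h" if t: "0 < t" for t
  proof (rule ccontr)
    assume "\<not> - ux (s t) t \<le> h"
    then have "0 < - h - ux (s t) t" by simp
    moreover have "((\<lambda>y. h * (s t - y) - u y t) has_real_derivative - h - ux (s t) t) (at (s t) within {0..s t})"
      using t s_pos[of t] by (auto intro!: derivative_eq_intros u_deriv)
    ultimately obtain d where d: "0 < d" "\<And>k. 0 < k \<Longrightarrow> s t - k \<in> {0..s t} \<Longrightarrow> k < d \<Longrightarrow>
        h * (s t - (s t - k)) - u (s t - k) t < h * (s t - s t) - u (s t) t"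
      using has_real_derivative_pos_inc_left by blast
    define k where "k = min d (s t) / 2"
    have k: "0 < k" "k < d" "k < s t"
      using d(1) s_pos[of t] t by (auto simp: k_def min_def)
    show False
      using d(2)[of k] barrier[of t "s t - k"] k u_front[of t] t by auto
  qed
  then have "front_speed t \<le> \<beta> * h + 1" if "0 < t" for t
    using mult_left_mono[of "- ux (s t) t" h \<beta>] that \<beta> by (fastforce simp: front_speed_def)
  moreover have "0 < \<beta> * h + 1" using \<beta> h(1) by (simp add: add_nonneg_pos)
  ultimately show ?thesis by blast
qed

end

section \<open>Energy of the temperature slope\<close>

text \<open>The tangent line inequality for the square: the increment is paired with the later
  profile \<open>y\<close> alone, which is frozen when the earlier profile \<open>w\<close> varies.
  The first term on the right is the strip gained by the moving interface.\<close>

lemma integral_square_increment_le: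
  fixes y w :: "real \<Rightarrow> real"
  assumes "0 \<le> l'" "l' \<le> l" and y: "continuous_on {0..l} y" and w: "continuous_on {0..l'} w"
  shows "integral {0..l} (\<lambda>x. (y x)\<^sup>2) / 2 - integral {0..l'} (\<lambda>x. (w x)\<^sup>2) / 2
    \<le> integral {l'..l} (\<lambda>x. (y x)\<^sup>2) / 2 + integral {0..l'} (\<lambda>x. y x * (y x - w x))"
proof -
  have y': "continuous_on {0..l'} y"
    by (rule continuous_on_subset[OF y]) (use assms in auto)
  have i: "(\<lambda>x. (y x)\<^sup>2) integrable_on {0..l'}" "(\<lambda>x. (w x)\<^sup>2) integrable_on {0..l'}"
      "(\<lambda>x. 2 * (y x * (y x - w x))) integrable_on {0..l'}" "(\<lambda>x. (y x)\<^sup>2) integrable_on {0..l}"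
    by (intro integrable_continuous_interval continuous_intros y y' w)+
  have "integral {0..l'} (\<lambda>x. (y x)\<^sup>2 - (w x)\<^sup>2) \<le> integral {0..l'} (\<lambda>x. 2 * (y x * (y x - w x)))"
  proof (rule integral_le[OF integrable_diff[OF i(1,2)] i(3)])
    fix x
    have "0 \<le> (y x - w x)\<^sup>2" by simp
    then show "(y x)\<^sup>2 - (w x)\<^sup>2 \<le> 2 * (y x * (y x - w x))"
      by (simp add: power2_eq_square algebra_simps)
  qed
  also have "integral {0..l'} (\<lambda>x. (y x)\<^sup>2 - (w x)\<^sup>2)
      = integral {0..l'} (\<lambda>x. (y x)\<^sup>2) - integral {0..l'} (\<lambda>x. (w x)\<^sup>2)"
    by (rule Henstock_Kurzweil_Integration.integral_diff[OF i(1,2)])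
  finally show ?thesis
    using Henstock_Kurzweil_Integration.integral_combine[OF assms(1,2) i(4)] by simp
qed

context stefan_feedback
begin

definition slope_energy :: "real \<Rightarrow> real" where
  "slope_energy t = integral {0..s t} (\<lambda>x. (ux x t)\<^sup>2) / 2"

text \<open>The total variation of the slope in space. It bounds the oscillation of the slope
  pointwise, and by Cauchy-Schwarz its square is bounded by \<open>s t\<close> times the integral of
  the squared second derivative.\<close>

definition curvature :: "real \<Rightarrow> real" where
  "curvature t = integral {0..s t} (\<lambda>x. \<bar>uxx x t\<bar>)"

lemma curvature_nonneg: "0 < t \<Longrightarrow> 0 \<le> curvature t"
  unfolding curvature_def
  by (intro integral_nonneg integrable_continuous_interval continuous_intros slices) auto

lemma slope_energy_cont: "continuous_on {0<..} slope_energy"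
proof -
  have "continuous_on (liquid_region s {0<..}) (\<lambda>(x, t). (ux x t)\<^sup>2)"
    using ux_cont unfolding case_prod_beta by (intro continuous_intros)
  then show ?thesis
    unfolding slope_energy_def
    by (intro continuous_intros continuous_on_integral_region continuous_on_subset[OF s_cont])
      (auto simp: s_pos)
qed

lemma slope_energy_left_quotient:
  assumes t: "0 < t" and "0 < e"
  shows "\<forall>\<^sub>F \<tau> in at_left t. slope_energy t - slope_energy \<tau> \<le>
     (- front_speed t * (ux (s t) t)\<^sup>2 / 2 - \<alpha> / s t * (curvature t)\<^sup>2 - ux 0 t * ut 0 t + e) * (t - \<tau>)"
    (is "\<forall>\<^sub>F \<tau> in _. _ \<le> (?\<psi> + e) * _")
proof -
  define W where "W \<tau> = integral {s \<tau>..s t} (\<lambda>x. (ux x t)\<^sup>2) / (t - \<tau>) / 2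
     - ux (s \<tau>) t * ((u (s t) t - u (s \<tau>) t) / (t - \<tau>))
     - ux 0 t * ((u 0 t - u 0 \<tau>) / (t - \<tau>))
     - integral {0..s \<tau>} (\<lambda>x. uxx x t * (u x t - u x \<tau>)) / (t - \<tau>)" for \<tau>
  have range: "s \<tau> \<in> {0..s t}" if "\<tau> \<in> {0..t}" for \<tau>
    using s_range[OF _ that] by simp
  have st: "s t \<in> {0..s t}" using s_pos[of t] t by simp
  have "continuous_on {0..t} (\<lambda>\<tau>. ux (s \<tau>) t)"
    by (rule continuous_on_compose2[OF slices(2)[OF t] s_cont_Icc]) (use range in auto)
  then have "((\<lambda>\<tau>. ux (s \<tau>) t) \<longlongrightarrow> ux (s t) t) (at_left t)"
    using t by (auto simp: continuous_on_def at_within_Icc_at_left dest!: bspec[of _ _ t])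
  moreover have "((\<lambda>\<tau>. integral {s \<tau>..s t} (\<lambda>x. (ux x t)\<^sup>2) / (t - \<tau>)) \<longlongrightarrow> (ux (s t) t)\<^sup>2 * front_speed t) (at_left t)"
    by (intro left_quotient_integral[OF t s_has_deriv[OF t] range] continuous_intros slices t)
  moreover have "((\<lambda>\<tau>. (u (s t) t - u (s \<tau>) t) / (t - \<tau>)) \<longlongrightarrow> ux (s t) t * front_speed t) (at_left t)"
    by (rule left_quotient_chain[OF t s_has_deriv[OF t] range u_deriv[OF t st]])
  moreover have "((\<lambda>\<tau>. (u 0 t - u 0 \<tau>) / (t - \<tau>)) \<longlongrightarrow> ut 0 t) (at_left t)"
    by (rule left_quotient_tendsto[OF has_field_derivative_at_within[OF input_deriv[OF t]] t])
  moreover have "((\<lambda>\<tau>. integral {0..s \<tau>} (\<lambda>x. uxx x t * (u x t - u x \<tau>)) / (t - \<tau>))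
      \<longlongrightarrow> integral {0..s t} (\<lambda>x. uxx x t * ut x t)) (at_left t)"
    by (rule left_quotient_pairing[OF t s_mono slices(3)[OF t]])
  ultimately have "(W \<longlongrightarrow> (ux (s t) t)\<^sup>2 * front_speed t / 2 - ux (s t) t * (ux (s t) t * front_speed t)
      - ux 0 t * ut 0 t - integral {0..s t} (\<lambda>x. uxx x t * ut x t)) (at_left t)"
    unfolding W_def by (intro tendsto_diff tendsto_mult tendsto_divide tendsto_const) auto
  moreover have "\<alpha> / s t * (curvature t)\<^sup>2 \<le> integral {0..s t} (\<lambda>x. uxx x t * ut x t)"
  proof -
    have "(curvature t)\<^sup>2 \<le> s t * integral {0..s t} (\<lambda>x. (uxx x t)\<^sup>2)"
      using integral_square_le[of 0 "s t" "\<lambda>x. \<bar>uxx x t\<bar>"] s_pos[of t] t slices(3)[OF t]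
      by (simp add: curvature_def continuous_on_rabs)
    then have "\<alpha> / s t * (curvature t)\<^sup>2 \<le> \<alpha> / s t * (s t * integral {0..s t} (\<lambda>x. (uxx x t)\<^sup>2))"
      using \<alpha> s_pos[of t] t by (intro mult_left_mono) auto
    also have "\<dots> = integral {0..s t} (\<lambda>x. \<alpha> * (uxx x t)\<^sup>2)"
      using s_pos[of t] t by simp
    also have "\<dots> = integral {0..s t} (\<lambda>x. uxx x t * ut x t)"
      using t by (intro Henstock_Kurzweil_Integration.integral_cong) (simp add: heat power2_eq_square)
    finally show ?thesis .
  qed
  ultimately have "\<forall>\<^sub>F \<tau> in at_left t. W \<tau> < ?\<psi> + e"
    using \<open>0 < e\<close> by (elim order_tendstoD) (simp add: power2_eq_square ac_simps)
  then show ?thesis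
    using eventually_at_left_real[OF t]
  proof eventually_elim
    case (elim \<tau>)
    then have \<tau>: "0 < \<tau>" "\<tau> < t" by auto
    have le: "0 \<le> s \<tau>" "s \<tau> \<le> s t" "{0..s \<tau>} \<subseteq> {0..s t}" using range[of \<tau>] \<tau> by auto
    have parts: "((\<lambda>x. uxx x t * (u x t - u x \<tau>) + ux x t * (ux x t - ux x \<tau>)) has_integral
        ux (s \<tau>) t * (u (s \<tau>) t - u (s \<tau>) \<tau>) - ux 0 t * (u 0 t - u 0 \<tau>)) {0..s \<tau>}"
    proof (rule fundamental_theorem_of_calculus[OF le(1)])
      fix x assume x: "x \<in> {0..s \<tau>}"
      have "((\<lambda>y. u y t) has_real_derivative ux x t) (at x within {0..s \<tau>})"
        "((\<lambda>y. ux y t) has_real_derivative uxx x t) (at x within {0..s \<tau>})"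
        "((\<lambda>y. u y \<tau>) has_real_derivative ux x \<tau>) (at x within {0..s \<tau>})"
        using x \<tau> le(3) by (auto intro!: DERIV_subset[OF u_deriv[OF t]] DERIV_subset[OF ux_deriv[OF t]] u_deriv)
      then have "((\<lambda>x. ux x t * (u x t - u x \<tau>)) has_real_derivative
          uxx x t * (u x t - u x \<tau>) + ux x t * (ux x t - ux x \<tau>)) (at x within {0..s \<tau>})"
        by (auto intro!: derivative_eq_intros)
      then show "((\<lambda>x. ux x t * (u x t - u x \<tau>)) has_vector_derivative
          uxx x t * (u x t - u x \<tau>) + ux x t * (ux x t - ux x \<tau>)) (at x within {0..s \<tau>})"
        by (simp add: has_real_derivative_iff_has_vector_derivative)
    qed
    have "integral {0..s \<tau>} (\<lambda>x. uxx x t * (u x t - u x \<tau>)) + integral {0..s \<tau>} (\<lambda>x. ux x t * (ux x t - ux x \<tau>))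
        = integral {0..s \<tau>} (\<lambda>x. uxx x t * (u x t - u x \<tau>) + ux x t * (ux x t - ux x \<tau>))"
      using \<tau> t
      by (intro Henstock_Kurzweil_Integration.integral_add[symmetric] integrable_continuous_interval
          continuous_intros continuous_on_subset[OF slices(1) le(3)] continuous_on_subset[OF slices(2) le(3)]
          continuous_on_subset[OF slices(3) le(3)] slices) auto
    also have "\<dots> = ux (s \<tau>) t * (u (s \<tau>) t - u (s \<tau>) \<tau>) - ux 0 t * (u 0 t - u 0 \<tau>)"
      by (rule integral_unique[OF parts])
    finally have "integral {0..s \<tau>} (\<lambda>x. ux x t * (ux x t - ux x \<tau>)) =
        - ux (s \<tau>) t * (u (s t) t - u (s \<tau>) t) - ux 0 t * (u 0 t - u 0 \<tau>)
        - integral {0..s \<tau>} (\<lambda>x. uxx x t * (u x t - u x \<tau>))"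
      \<comment> \<open>As \<open>u\<close> vanishes on the interface at both times, the difference
        in time at \<open>s \<tau>\<close> becomes a difference in space at time
        \<open>t\<close>.\<close>
      using u_front[of t] u_front[of \<tau>] t \<tau> by (simp add: algebra_simps)
    then have "slope_energy t - slope_energy \<tau> \<le> integral {s \<tau>..s t} (\<lambda>x. (ux x t)\<^sup>2) / 2
        + (- ux (s \<tau>) t * (u (s t) t - u (s \<tau>) t) - ux 0 t * (u 0 t - u 0 \<tau>)
        - integral {0..s \<tau>} (\<lambda>x. uxx x t * (u x t - u x \<tau>)))"
      using integral_square_increment_le[OF le(1,2) slices(2)[OF t] slices(2)[OF \<tau>(1)]]
      by (simp add: slope_energy_def)
    also have "\<dots> = W \<tau> * (t - \<tau>)"
    proof -
      have "A / 2 + (- a * B - b * C - D) = (A / h / 2 - a * (B / h) - b * (C / h) - D / h) * h"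
        if "h \<noteq> 0" for A B C D a b h :: real
        using that by (simp add: field_simps)
      from this[of "t - \<tau>"] show ?thesis unfolding W_def using \<tau> by simp
    qed
    also have "\<dots> \<le> (?\<psi> + e) * (t - \<tau>)"
      using elim \<tau> by (intro mult_right_mono) auto
    finally show ?case .
  qed
qed

section \<open>Bounds by the input and the oscillation of the slope\<close>

lemma slope_mean_value:
  assumes t: "0 < t" and x: "x \<in> {0..<s t}"
  obtains \<xi> where "\<xi> \<in> {x<..<s t}" "u x t = - ux \<xi> t * (s t - x)"
proof -
  have "\<exists>\<xi>\<in>{x<..<s t}. u (s t) t - u x t = ux \<xi> t * (s t - x)"
  proof (rule mvt_simple[where f = "\<lambda>y. u y t" and f' = "\<lambda>\<xi> h. ux \<xi> t * h"])
    show "((\<lambda>y. u y t) has_derivative (*) (ux y t)) (at y within {x..s t})" if "x \<le> y" "y \<le> s t" for y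
      using DERIV_subset[OF u_deriv[OF t], of y "{x..s t}"] x that
      by (simp add: has_field_derivative_def)
  qed (use x in auto)
  then show ?thesis
    using that u_front[of t] t by fastforce
qed

text \<open>The mean slope \<open>- u 0 t / s t\<close> is attained at some \<open>\<xi>\<close>,
  and the slope varies by at most \<open>curvature t\<close> between any two points.\<close>

lemma slope_near_mean:
  assumes t: "0 < t" and x: "x \<in> {0..s t}"
  shows "\<bar>ux x t + u 0 t / s t\<bar> \<le> curvature t"
proof -
  obtain \<xi> where \<xi>: "\<xi> \<in> {0<..<s t}" "u 0 t = - ux \<xi> t * s t"
    using slope_mean_value[OF t, of 0] s_pos[of t] t by auto
  have abs_int: "(\<lambda>x. \<bar>uxx x t\<bar>) integrable_on {0..s t}"
    by (intro integrable_continuous_interval continuous_intros slices t)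
  have diff: "\<bar>ux b t - ux a t\<bar> \<le> curvature t" if ab: "0 \<le> a" "a \<le> b" "b \<le> s t" for a b
  proof -
    have "((\<lambda>x. uxx x t) has_integral (ux b t - ux a t)) {a..b}"
    proof (rule fundamental_theorem_of_calculus[OF ab(2)])
      fix y assume "y \<in> {a..b}"
      then have "((\<lambda>y. ux y t) has_real_derivative uxx y t) (at y within {a..b})"
        using ab by (intro DERIV_subset[OF ux_deriv[OF t]]) auto
      then show "((\<lambda>y. ux y t) has_vector_derivative uxx y t) (at y within {a..b})"
        by (simp add: has_real_derivative_iff_has_vector_derivative)
    qed
    then have "\<bar>ux b t - ux a t\<bar> \<le> integral {a..b} (\<lambda>x. \<bar>uxx x t\<bar>)"
      using abs_integral_le_integral[of "\<lambda>x. uxx x t" "{a..b}" "\<lambda>x. \<bar>uxx x t\<bar>"]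
        integrable_on_subinterval[OF abs_int, of a b] ab
      by (auto simp: integral_unique has_integral_integrable)
    also have "\<dots> \<le> curvature t"
      unfolding curvature_def using ab
      by (intro Henstock_Kurzweil_Integration.integral_subset_le abs_int
          integrable_on_subinterval[OF abs_int, of a b]) auto
    finally show ?thesis .
  qed
  have "\<bar>ux x t - ux \<xi> t\<bar> \<le> curvature t"
    using diff[of x \<xi>] diff[of \<xi> x] \<xi>(1) x by (cases "x \<le> \<xi>") auto
  moreover have "u 0 t / s t = - ux \<xi> t"
    using \<xi> s_pos[of t] t by simp
  ultimately show ?thesis by simp
qed

lemma slope_abs_le:
  assumes t: "0 < t" and x: "x \<in> {0..s t}"
  shows "\<bar>ux x t\<bar> \<le> u 0 t / s t + curvature t"
  using slope_near_mean[OF assms] input_pos[of t] s_pos[of t] t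
  by (smt (verit) divide_nonneg_nonneg)

lemma slope_energy_le:
  assumes t: "0 < t"
  shows "slope_energy t \<le> s t * (u 0 t / s t + curvature t)\<^sup>2 / 2"
proof -
  have "integral {0..s t} (\<lambda>x. (ux x t)\<^sup>2) \<le> integral {0..s t} (\<lambda>x. (u 0 t / s t + curvature t)\<^sup>2)"
    using slope_abs_le[OF t] t
    by (intro integral_le integrable_continuous_interval continuous_intros slices) (auto simp flip: abs_le_square_iff intro: order_trans[OF _ abs_ge_self])
  then show ?thesis using s_pos[of t] t by (simp add: slope_energy_def)
qed

text \<open>The control law, solved for the gap, leaves the input and the moment, and the moment is
  bounded by the input and the curvature. This is how damping of the temperature is passed on to the
  interface error.\<close>

lemma gap_le:
  assumes t: "0 < t"
  shows "sr - s t \<le> \<beta> / c * (u 0 t / s t) + \<beta> * sr / \<alpha> * u 0 t + \<beta> * sr\<^sup>2 / \<alpha> * curvature t"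
proof -
  define M where "M = curvature t"
  have s: "0 < s t" "s t \<le> sr" using s_pos[of t] s_le[of t] t by auto
  have M: "0 \<le> M" using curvature_nonneg[OF t] by (simp add: M_def)
  have T: "0 < u 0 t" using input_pos[of t] t by simp
  have ule: "u x t \<le> u 0 t + sr * M" if x: "x \<in> {0..s t}" for x
  proof (cases "x = s t")
    case True
    then show ?thesis using u_front[of t] t T M sr_pos by simp
  next
    case False
    then obtain \<xi> where \<xi>: "\<xi> \<in> {x<..<s t}" "u x t = - ux \<xi> t * (s t - x)"
      using slope_mean_value[OF t, of x] x by auto
    have "- ux \<xi> t \<le> u 0 t / s t + M"
      using slope_abs_le[OF t, of \<xi>] \<xi>(1) x by (simp add: M_def)
    then have "u x t \<le> (u 0 t / s t + M) * (s t - x)"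
      unfolding \<xi>(2) using \<xi>(1) by (intro mult_right_mono) auto
    also have "\<dots> \<le> (u 0 t / s t + M) * s t"
      using x s T M by (intro mult_left_mono) auto
    also have "\<dots> = u 0 t + s t * M" using s by (simp add: field_simps)
    also have "\<dots> \<le> u 0 t + sr * M" using s M by (simp add: mult_right_mono)
    finally show ?thesis .
  qed
  have "integral {0..s t} (\<lambda>x. x * u x t) \<le> integral {0..s t} (\<lambda>x. s t * (u 0 t + sr * M))"
  proof (intro integral_le integrable_continuous_interval continuous_intros slices)
    fix x assume x: "x \<in> {0..s t}"
    have "x * u x t \<le> s t * u x t" using x u_pos[of t x] t by (intro mult_right_mono) auto
    also have "\<dots> \<le> s t * (u 0 t + sr * M)" using ule[OF x] s by simp
    finally show "x * u x t \<le> s t * (u 0 t + sr * M)" .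
  qed (use t in auto)
  then have I: "integral {0..s t} (\<lambda>x. x * u x t) \<le> s t * (s t * (u 0 t + sr * M))"
    using s by simp
  have "u 0 t / c = - (integral {0..s t} (\<lambda>x. x * u x t) / \<alpha> + s t * (s t - sr) / \<beta>)"
    by (subst control) (use t c in simp_all)
  then have "s t * (sr - s t) / \<beta> = u 0 t / c + integral {0..s t} (\<lambda>x. x * u x t) / \<alpha>"
    by (simp add: right_diff_distrib diff_divide_distrib)
  also have "\<dots> \<le> u 0 t / c + s t * (s t * (u 0 t + sr * M)) / \<alpha>"
    using I \<alpha> by (simp add: divide_right_mono)
  also have "\<dots> \<le> u 0 t / c + s t * (sr * (u 0 t + sr * M)) / \<alpha>"
    using s T M \<alpha> by (intro add_left_mono divide_right_mono mult_left_mono mult_right_mono) auto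
  finally have "\<beta> / s t * (s t * (sr - s t) / \<beta>) \<le> \<beta> / s t * (u 0 t / c + s t * (sr * (u 0 t + sr * M)) / \<alpha>)"
    using s \<beta> by (intro mult_left_mono) auto
  moreover have "\<beta> / s t * (s t * (sr - s t) / \<beta>) = sr - s t"
    using s \<beta> by simp
  moreover have "\<beta> / s t * (u 0 t / c + s t * (sr * (u 0 t + sr * M)) / \<alpha>)
      = \<beta> / c * (u 0 t / s t) + \<beta> * sr / \<alpha> * u 0 t + \<beta> * sr\<^sup>2 / \<alpha> * M"
    using s c \<alpha> by (simp add: power2_eq_square field_simps)
  ultimately show ?thesis
    by (simp only: M_def)
qed

text \<open>A Poincare inequality, available because \<open>u\<close> vanishes at the interface; the
  factor 2 undoes the half in \<open>slope_energy\<close>.\<close>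

lemma temperature_energy_le:
  assumes t: "0 < t"
  shows "integral {0..s t} (\<lambda>x. (u x t)\<^sup>2) \<le> sr\<^sup>2 * (2 * slope_energy t)"
proof -
  have s: "0 < s t" "s t \<le> sr" using s_pos[of t] s_le[of t] t by auto
  have sq: "continuous_on {0..s t} (\<lambda>x. (ux x t)\<^sup>2)"
    by (intro continuous_intros slices t)
  have E: "0 \<le> slope_energy t"
    unfolding slope_energy_def
    by (intro divide_nonneg_nonneg integral_nonneg integrable_continuous_interval sq) auto
  have pt: "(u x t)\<^sup>2 \<le> sr * (2 * slope_energy t)" if x: "x \<in> {0..s t}" for x
  proof -
    have "((\<lambda>x. ux x t) has_integral (u (s t) t - u x t)) {x..s t}"
    proof (rule fundamental_theorem_of_calculus)
      show "x \<le> s t" using x by simp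
      fix y assume "y \<in> {x..s t}"
      then have "((\<lambda>y. u y t) has_real_derivative ux y t) (at y within {x..s t})"
        using x by (intro DERIV_subset[OF u_deriv[OF t]]) auto
      then show "((\<lambda>y. u y t) has_vector_derivative ux y t) (at y within {x..s t})"
        by (simp add: has_real_derivative_iff_has_vector_derivative)
    qed
    then have "(u x t)\<^sup>2 = (integral {x..s t} (\<lambda>x. ux x t))\<^sup>2"
      using u_front[of t] t by (simp add: integral_unique)
    also have "\<dots> \<le> (s t - x) * integral {x..s t} (\<lambda>x. (ux x t)\<^sup>2)"
      using x by (intro integral_square_le continuous_on_subset[OF slices(2)[OF t]]) auto
    also have "\<dots> \<le> sr * integral {0..s t} (\<lambda>x. (ux x t)\<^sup>2)"
      using x s
      by (intro mult_mono Henstock_Kurzweil_Integration.integral_subset_le integral_nonneg integrable_continuous_interval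
          continuous_on_subset[OF sq]) auto
    finally show ?thesis by (simp add: slope_energy_def)
  qed
  have "integral {0..s t} (\<lambda>x. (u x t)\<^sup>2) \<le> integral {0..s t} (\<lambda>x. sr * (2 * slope_energy t))"
    using t by (intro integral_le integrable_continuous_interval continuous_intros slices pt) auto
  also have "\<dots> = s t * (sr * (2 * slope_energy t))" using s by simp
  also have "\<dots> \<le> sr * (sr * (2 * slope_energy t))"
    using s E by (intro mult_right_mono) auto
  finally show ?thesis by (simp add: power2_eq_square)
qed

end

section \<open>The energy at the initial time\<close>

context stefan_feedback
begin

text \<open>Comparison profile for the behaviour as \<open>t\<close> tends to \<open>0\<close>: the initial temperature, extended
  by zero and lifted so that it takes the boundary value of \<open>u\<close> at \<open>0\<close>.\<close>

definition lift :: "real \<Rightarrow> real" where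
  "lift x = 1 - min x (s 0) / s 0"

definition profile :: "real \<Rightarrow> real \<Rightarrow> real" where
  "profile x t = u (min x (s 0)) 0 + (u 0 t - u 0 0) * lift x"

definition deviation :: "real \<Rightarrow> real \<Rightarrow> real" where
  "deviation x t = u x t - profile x t"

definition profile_deriv :: "real \<Rightarrow> real \<Rightarrow> real" where
  "profile_deriv x t = u0' x - (u 0 t - u 0 0) / s 0"

lemma s0_pos: "0 < s 0"
  by (simp add: s_pos)

lemma lift_cont: "continuous_on A lift"
  unfolding lift_def by (intro continuous_intros) (use s0_pos in auto)

lemma lift_bounds: "0 \<le> x \<Longrightarrow> lift x \<in> {0..1}"
  using s0_pos by (auto simp: lift_def field_simps)

lemma deviation_cont: "continuous_on (liquid_region s {0..}) (\<lambda>(x, t). deviation x t)"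
proof -
  have "continuous_on (liquid_region s {0..}) (\<lambda>p. u (min (fst p) (s 0)) 0)"
    by (rule continuous_on_compose2[OF slices(1)[of 0]])
      (use s0_pos in \<open>auto intro!: continuous_intros simp: liquid_region_def\<close>)
  moreover have "continuous_on (liquid_region s {0..}) (\<lambda>p. u 0 (snd p))"
    by (rule continuous_on_compose2[OF input_cont]) (auto intro!: continuous_intros simp: liquid_region_def)
  moreover have "continuous_on (liquid_region s {0..}) (\<lambda>p. lift (fst p))"
    by (rule continuous_on_compose2[OF lift_cont]) (auto intro!: continuous_intros)
  moreover have "continuous_on (liquid_region s {0..}) (\<lambda>p. u (fst p) (snd p))"
    using u_cont by (simp add: case_prod_beta)
  ultimately show ?thesis
    unfolding deviation_def profile_def case_prod_beta by (intro continuous_intros)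
qed

lemma deviation_slice: "0 \<le> t \<Longrightarrow> continuous_on {0..s t} (\<lambda>x. deviation x t)"
  by (rule continuous_on_slice[OF deviation_cont]) simp

lemma deviation_front: "0 \<le> t \<Longrightarrow> deviation (s t) t = 0"
  using s_range[of 0 0 t] s0_pos by (simp add: deviation_def profile_def lift_def u_front)

lemma deviation_initial: "x \<in> {0..s 0} \<Longrightarrow> deviation x 0 = 0"
  by (simp add: deviation_def profile_def)

lemma profile_beyond: "s 0 \<le> x \<Longrightarrow> profile x t = 0"
  using s0_pos by (simp add: profile_def lift_def u_front)

definition deviation_energy :: "real \<Rightarrow> real" where
  "deviation_energy t = integral {0..s t} (\<lambda>x. (deviation x t)\<^sup>2) / 2"

lemma deviation_energy_cont: "continuous_on {0..} deviation_energy"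
proof -
  have "continuous_on (liquid_region s {0..}) (\<lambda>(x, t). (deviation x t)\<^sup>2)"
    using deviation_cont unfolding case_prod_beta by (intro continuous_intros)
  then show ?thesis
    unfolding deviation_energy_def
    by (intro continuous_intros continuous_on_integral_region s_cont) (auto simp: s_pos)
qed

text \<open>The profile depends on time only through the input times \<open>lift\<close>, which
  accounts for the second integral. No strip term survives, since the deviation vanishes at the
  interface.\<close>

lemma deviation_energy_left_quotient:
  assumes t: "0 < t" and "0 < e"
  shows "\<forall>\<^sub>F \<tau> in at_left t. deviation_energy t - deviation_energy \<tau> \<le>
     (integral {0..s t} (\<lambda>x. deviation x t * ut x t)
        - ut 0 t * integral {0..s t} (\<lambda>x. deviation x t * lift x) + e) * (t - \<tau>)"
    (is "\<forall>\<^sub>F \<tau> in _. _ \<le> (?\<chi> + e) * _")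
proof -
  define W where "W \<tau> = integral {s \<tau>..s t} (\<lambda>x. (deviation x t)\<^sup>2) / (t - \<tau>) / 2
     + integral {0..s \<tau>} (\<lambda>x. deviation x t * (u x t - u x \<tau>)) / (t - \<tau>)
     - (u 0 t - u 0 \<tau>) / (t - \<tau>) * integral {0..s \<tau>} (\<lambda>x. deviation x t * lift x)" for \<tau>
  have range: "s \<tau> \<in> {0..s t}" if "\<tau> \<in> {0..t}" for \<tau>
    using s_range[OF _ that] by simp
  have dl: "continuous_on {0..s t} (\<lambda>x. deviation x t * lift x)"
    using t by (intro continuous_intros deviation_slice lift_cont) simp
  have "continuous_on {0..t} (\<lambda>\<tau>. integral {0..s \<tau>} (\<lambda>x. deviation x t * lift x))"
    by (rule continuous_on_compose2[OF indefinite_integral_continuous_1[OF integrable_continuous_interval[OF dl]] s_cont_Icc])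
      (use range in auto)
  then have "((\<lambda>\<tau>. integral {0..s \<tau>} (\<lambda>x. deviation x t * lift x)) \<longlongrightarrow>
      integral {0..s t} (\<lambda>x. deviation x t * lift x)) (at_left t)"
    using t by (auto simp: continuous_on_def at_within_Icc_at_left dest!: bspec[of _ _ t])
  moreover have "((\<lambda>\<tau>. integral {s \<tau>..s t} (\<lambda>x. (deviation x t)\<^sup>2) / (t - \<tau>)) \<longlongrightarrow> (deviation (s t) t)\<^sup>2 * front_speed t) (at_left t)"
    by (intro left_quotient_integral[OF t s_has_deriv[OF t] range] continuous_intros deviation_slice) (use t in auto)
  moreover have "((\<lambda>\<tau>. (u 0 t - u 0 \<tau>) / (t - \<tau>)) \<longlongrightarrow> ut 0 t) (at_left t)"
    by (rule left_quotient_tendsto[OF has_field_derivative_at_within[OF input_deriv[OF t]] t])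
  moreover have "((\<lambda>\<tau>. integral {0..s \<tau>} (\<lambda>x. deviation x t * (u x t - u x \<tau>)) / (t - \<tau>))
      \<longlongrightarrow> integral {0..s t} (\<lambda>x. deviation x t * ut x t)) (at_left t)"
    by (rule left_quotient_pairing[OF t s_mono deviation_slice]) (use t in simp)
  ultimately have "(W \<longlongrightarrow> (deviation (s t) t)\<^sup>2 * front_speed t / 2
      + integral {0..s t} (\<lambda>x. deviation x t * ut x t)
      - ut 0 t * integral {0..s t} (\<lambda>x. deviation x t * lift x)) (at_left t)"
    unfolding W_def by (intro tendsto_add tendsto_diff tendsto_mult tendsto_divide tendsto_const) auto
  then have "\<forall>\<^sub>F \<tau> in at_left t. W \<tau> < ?\<chi> + e"
    using \<open>0 < e\<close> t by (elim order_tendstoD) (simp add: deviation_front)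
  then show ?thesis
    using eventually_at_left_real[OF t]
  proof eventually_elim
    case (elim \<tau>)
    then have \<tau>: "0 < \<tau>" "\<tau> < t" by auto
    have le: "0 \<le> s \<tau>" "s \<tau> \<le> s t" "{0..s \<tau>} \<subseteq> {0..s t}" using range[of \<tau>] \<tau> by auto
    have c1: "continuous_on {0..s \<tau>} (\<lambda>x. deviation x t)"
      by (rule continuous_on_subset[OF deviation_slice le(3)]) (use t in simp)
    have c2: "continuous_on {0..s \<tau>} (\<lambda>x. u x t)"
      by (rule continuous_on_subset[OF slices(1) le(3)]) (use t in simp)
    have c3: "continuous_on {0..s \<tau>} (\<lambda>x. u x \<tau>)"
      by (rule slices(1)) (use \<tau> in simp)
    have "integral {0..s \<tau>} (\<lambda>x. deviation x t * (deviation x t - deviation x \<tau>))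
       = integral {0..s \<tau>} (\<lambda>x. deviation x t * (u x t - u x \<tau>) - (u 0 t - u 0 \<tau>) * (deviation x t * lift x))"
      by (rule Henstock_Kurzweil_Integration.integral_cong) (simp add: deviation_def profile_def algebra_simps)
    also have "\<dots> = integral {0..s \<tau>} (\<lambda>x. deviation x t * (u x t - u x \<tau>))
         - integral {0..s \<tau>} (\<lambda>x. (u 0 t - u 0 \<tau>) * (deviation x t * lift x))"
      by (intro Henstock_Kurzweil_Integration.integral_diff integrable_continuous_interval continuous_intros c1 c2 c3 lift_cont)
    finally have "integral {0..s \<tau>} (\<lambda>x. deviation x t * (deviation x t - deviation x \<tau>))
       = integral {0..s \<tau>} (\<lambda>x. deviation x t * (u x t - u x \<tau>))
         - (u 0 t - u 0 \<tau>) * integral {0..s \<tau>} (\<lambda>x. deviation x t * lift x)" by simp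
    then have "deviation_energy t - deviation_energy \<tau> \<le> integral {s \<tau>..s t} (\<lambda>x. (deviation x t)\<^sup>2) / 2
        + (integral {0..s \<tau>} (\<lambda>x. deviation x t * (u x t - u x \<tau>))
         - (u 0 t - u 0 \<tau>) * integral {0..s \<tau>} (\<lambda>x. deviation x t * lift x))"
      using integral_square_increment_le[OF le(1,2) deviation_slice[of t] deviation_slice[of \<tau>]] t \<tau>
      by (simp add: deviation_energy_def)
    also have "\<dots> = W \<tau> * (t - \<tau>)"
    proof -
      have "A / 2 + (B - a * C) = (A / h / 2 + B / h - a / h * C) * h"
        if "h \<noteq> 0" for A B C a h :: real
        using that by (simp add: field_simps)
      from this[of "t - \<tau>"] show ?thesis unfolding W_def using \<tau> by simp
    qed
    also have "\<dots> \<le> (?\<chi> + e) * (t - \<tau>)"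
      using elim \<tau> by (intro mult_right_mono) auto
    finally show ?case .
  qed
qed

section \<open>Dissipation of the deviation and the limit at time 0\<close>

lemma profile_deriv_integral:
  assumes "x \<in> {0..s 0}"
  shows "((\<lambda>y. profile_deriv y t) has_integral (profile x t - profile 0 t)) {0..x}"
proof -
  have "((\<lambda>y. profile_deriv y t) has_integral (u x 0 - u 0 0) - x * ((u 0 t - u 0 0) / s 0)) {0..x}"
    unfolding profile_deriv_def
    using has_integral_const_real[of "(u 0 t - u 0 0) / s 0" 0 x] assms
    by (intro has_integral_diff initial_deriv) auto
  moreover have "profile x t - profile 0 t = (u x 0 - u 0 0) - x * ((u 0 t - u 0 0) / s 0)"
    using assms s0_pos by (simp add: profile_def lift_def min_def diff_divide_distrib algebra_simps)
  ultimately show ?thesis by simp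
qed

text \<open>The correction to the initial energy is explicit and tends to 0 with
  \<open>u 0 t - u 0 0\<close>; the cross term is evaluated by \<open>u (s 0) 0 = 0\<close>.\<close>

lemma profile_deriv_square:
  "((\<lambda>x. (profile_deriv x t)\<^sup>2) has_integral
     (integral {0..s 0} (\<lambda>x. (u0' x)\<^sup>2) + 2 * ((u 0 t - u 0 0) / s 0) * u 0 0
       + ((u 0 t - u 0 0) / s 0)\<^sup>2 * s 0)) {0..s 0}"
proof -
  define d where "d = (u 0 t - u 0 0) / s 0"
  have "((\<lambda>x. (u0' x)\<^sup>2 - 2 * d * u0' x + d\<^sup>2) has_integral
      integral {0..s 0} (\<lambda>x. (u0' x)\<^sup>2) - 2 * d * (u (s 0) 0 - u 0 0) + d\<^sup>2 * s 0) {0..s 0}"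
    using has_integral_const_real[of "d\<^sup>2" 0 "s 0"] s0_pos
    by (intro has_integral_add has_integral_diff has_integral_mult_right initial_deriv
        integrable_integral initial_energy) (auto simp: mult.commute)
  moreover have "(profile_deriv x t)\<^sup>2 = (u0' x)\<^sup>2 - 2 * d * u0' x + d\<^sup>2" for x
    by (simp add: profile_deriv_def d_def[symmetric] power2_eq_square algebra_simps)
  ultimately show ?thesis
    unfolding d_def[symmetric] by (simp add: u_front)
qed

text \<open>All boundary terms cancel: at 0 the profile equals \<open>u\<close>, at
  \<open>s t\<close> the temperature vanishes, and at \<open>s 0\<close> the profile does. What
  remains is the pairing of the two slopes minus twice the slope energy, and Young's inequality
  spends one of the two copies.\<close>

lemma deviation_dissipation:
  assumes t: "0 < t"
  shows "integral {0..s t} (\<lambda>x. deviation x t * ut x t)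
     \<le> \<alpha> / 2 * integral {0..s 0} (\<lambda>x. (profile_deriv x t)\<^sup>2) - \<alpha> * slope_energy t"
proof -
  have range: "{0..s 0} \<subseteq> {0..s t}" using s_range[of 0 0 t] t by auto
  have st: "0 \<le> s t" "0 \<le> s 0" using s_pos[of t] s_pos[of 0] t by auto
  have profile_cont: "continuous_on {0..s t} (\<lambda>x. profile x t)"
  proof -
    have "continuous_on {0..s t} (\<lambda>x. u x t - deviation x t)"
      using t by (intro continuous_intros slices deviation_slice) auto
    then show ?thesis by (simp add: deviation_def)
  qed
  have "((\<lambda>x. u x t * uxx x t + ux x t * ux x t) has_integral
     u (s t) t * ux (s t) t - u 0 t * ux 0 t) {0..s t}"
  proof (rule fundamental_theorem_of_calculus[OF st(1)])
    fix x assume x: "x \<in> {0..s t}"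
    have "((\<lambda>x. u x t * ux x t) has_real_derivative u x t * uxx x t + ux x t * ux x t) (at x within {0..s t})"
      using x t by (auto intro!: derivative_eq_intros u_deriv ux_deriv)
    then show "((\<lambda>x. u x t * ux x t) has_vector_derivative u x t * uxx x t + ux x t * ux x t) (at x within {0..s t})"
      by (simp add: has_real_derivative_iff_has_vector_derivative)
  qed
  moreover have "integral {0..s t} (\<lambda>x. u x t * uxx x t + ux x t * ux x t)
      = integral {0..s t} (\<lambda>x. u x t * uxx x t) + integral {0..s t} (\<lambda>x. ux x t * ux x t)"
    using t by (intro Henstock_Kurzweil_Integration.integral_add integrable_continuous_interval continuous_intros slices) auto
  ultimately have uu: "integral {0..s t} (\<lambda>x. u x t * uxx x t) = - u 0 t * ux 0 t - 2 * slope_energy t"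
    using u_front[of t] t by (simp add: integral_unique slope_energy_def power2_eq_square)
  \<comment> \<open>Integration by parts stops at \<open>s 0\<close>, where the profile may have a
    kink; beyond that point the profile is zero.\<close>
  have pux: "((\<lambda>x. profile_deriv x t * ux x t) has_integral
      profile (s 0) t * ux (s 0) t - profile 0 t * ux 0 t - integral {0..s 0} (\<lambda>x. profile x t * uxx x t)) {0..s 0}"
  proof (rule integral_by_parts_indefinite_integral[OF st(2)])
    show "((\<lambda>y. profile_deriv y t) has_integral (profile x t - profile 0 t)) {0..x}" if "x \<in> {0..s 0}" for x
      by (rule profile_deriv_integral[OF that])
    show "(\<lambda>x. (profile_deriv x t)\<^sup>2) integrable_on {0..s 0}"
      using profile_deriv_square by blast
    show "((\<lambda>x. ux x t) has_real_derivative uxx x t) (at x within {0..s 0})" if "x \<in> {0..s 0}" for x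
      by (rule DERIV_subset[OF ux_deriv[OF t] range]) (use range that in auto)
    show "continuous_on {0..s 0} (\<lambda>x. uxx x t)"
      by (rule continuous_on_subset[OF slices(3)[OF t] range])
  qed
  have p0: "profile 0 t = u 0 t" "profile (s 0) t = 0"
    using s0_pos by (simp_all add: profile_def lift_def u_front)
  have tail: "integral {0..s t} (\<lambda>x. profile x t * uxx x t) = integral {0..s 0} (\<lambda>x. profile x t * uxx x t)"
  proof -
    have "integral {s 0..s t} (\<lambda>x. profile x t * uxx x t) = integral {s 0..s t} (\<lambda>x. 0)"
      by (rule Henstock_Kurzweil_Integration.integral_cong) (simp add: profile_beyond)
    moreover have "integral {0..s 0} (\<lambda>x. profile x t * uxx x t) + integral {s 0..s t} (\<lambda>x. profile x t * uxx x t)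
       = integral {0..s t} (\<lambda>x. profile x t * uxx x t)"
      using st s_range[of 0 0 t] t
      by (intro Henstock_Kurzweil_Integration.integral_combine integrable_continuous_interval
          continuous_intros profile_cont slices) auto
    ultimately show ?thesis by simp
  qed
  have young: "integral {0..s 0} (\<lambda>x. profile_deriv x t * ux x t)
     \<le> integral {0..s 0} (\<lambda>x. (profile_deriv x t)\<^sup>2) / 2 + slope_energy t"
  proof -
    have sq: "continuous_on {0..s t} (\<lambda>x. (ux x t)\<^sup>2)"
      by (intro continuous_intros slices t)
    have i: "(\<lambda>x. (profile_deriv x t)\<^sup>2 / 2) integrable_on {0..s 0}" "(\<lambda>x. (ux x t)\<^sup>2 / 2) integrable_on {0..s 0}"
      using profile_deriv_square integrable_continuous_interval[OF continuous_on_subset[OF sq range]]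
      by (auto intro!: integrable_on_divide)
    have "integral {0..s 0} (\<lambda>x. profile_deriv x t * ux x t)
       \<le> integral {0..s 0} (\<lambda>x. (profile_deriv x t)\<^sup>2 / 2 + (ux x t)\<^sup>2 / 2)"
    proof (rule integral_le[OF has_integral_integrable[OF pux] integrable_add[OF i]])
      fix x
      have "0 \<le> (profile_deriv x t - ux x t)\<^sup>2" by simp
      then show "profile_deriv x t * ux x t \<le> (profile_deriv x t)\<^sup>2 / 2 + (ux x t)\<^sup>2 / 2"
        by (simp add: power2_eq_square algebra_simps)
    qed
    also have "\<dots> = integral {0..s 0} (\<lambda>x. (profile_deriv x t)\<^sup>2) / 2 + integral {0..s 0} (\<lambda>x. (ux x t)\<^sup>2) / 2"
      using Henstock_Kurzweil_Integration.integral_add[OF i] by simp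
    also have "integral {0..s 0} (\<lambda>x. (ux x t)\<^sup>2) \<le> integral {0..s t} (\<lambda>x. (ux x t)\<^sup>2)"
      by (intro Henstock_Kurzweil_Integration.integral_subset_le range integrable_continuous_interval sq
          continuous_on_subset[OF sq range]) auto
    finally show ?thesis by (simp add: slope_energy_def)
  qed
  have "integral {0..s t} (\<lambda>x. deviation x t * ut x t) = integral {0..s t} (\<lambda>x. \<alpha> * (u x t * uxx x t - profile x t * uxx x t))"
    using t by (intro Henstock_Kurzweil_Integration.integral_cong) (simp add: heat deviation_def algebra_simps)
  also have "\<dots> = \<alpha> * integral {0..s t} (\<lambda>x. u x t * uxx x t - profile x t * uxx x t)"
    by simp
  also have "integral {0..s t} (\<lambda>x. u x t * uxx x t - profile x t * uxx x t)
     = integral {0..s t} (\<lambda>x. u x t * uxx x t) - integral {0..s t} (\<lambda>x. profile x t * uxx x t)"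
    using t by (intro Henstock_Kurzweil_Integration.integral_diff integrable_continuous_interval
        continuous_intros slices profile_cont) auto
  also have "\<dots> = integral {0..s 0} (\<lambda>x. profile_deriv x t * ux x t) - 2 * slope_energy t"
    using integral_unique[OF pux] by (simp add: uu tail p0)
  also have "\<alpha> * \<dots> \<le> \<alpha> * (integral {0..s 0} (\<lambda>x. (profile_deriv x t)\<^sup>2) / 2 + slope_energy t - 2 * slope_energy t)"
    using young \<alpha> by (intro mult_left_mono) auto
  also have "\<dots> = \<alpha> / 2 * integral {0..s 0} (\<lambda>x. (profile_deriv x t)\<^sup>2) - \<alpha> * slope_energy t"
    by (simp add: algebra_simps)
  finally show ?thesis .
qed

text \<open>If the slope energy stayed above its initial value by \<open>e\<close> on a whole
  initial interval, the dissipation would make the deviation energy decrease strictly from its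
  initial value 0, contradicting its nonnegativity.\<close>

lemma slope_energy_near_initial:
  assumes "0 < e" "0 < \<delta>"
  shows "\<exists>t\<in>{0<..<\<delta>}. slope_energy t < integral {0..s 0} (\<lambda>x. (u0' x)\<^sup>2) / 2 + e"
proof (rule ccontr)
  define A where "A = integral {0..s 0} (\<lambda>x. (u0' x)\<^sup>2)"
  assume "\<not> ?thesis"
  then have large: "A / 2 + e \<le> slope_energy t" if "0 < t" "t < \<delta>" for t
    using that by (force simp: A_def)
  obtain K where K: "0 < K" "\<And>t. 0 < t \<Longrightarrow> front_speed t \<le> K"
    using front_speed_bounded by blast
  \<comment> \<open>A bound on the time derivative of the input up to time 0, read off from its
    equation; it needs the bounded interface speed.\<close>
  define K2 where "K2 = c * (c * sr * sr / \<beta>) + c / \<beta> * sr * K"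
  define d where "d t = (u 0 t - u 0 0) / s 0" for t
  \<comment> \<open>Everything in the rate of the deviation energy that vanishes as \<open>t\<close>
    tends to 0.\<close>
  define B where "B t = \<alpha> / 2 * (2 * d t * u 0 0 + (d t)\<^sup>2 * s 0)
      + K2 * integral {0..s t} (\<lambda>x. \<bar>deviation x t\<bar>)" for t
  have ut_le: "\<bar>ut 0 t\<bar> \<le> K2" if t: "0 < t" for t
  proof -
    have s: "0 < s t" "s t \<le> sr" using s_pos[of t] s_le[of t] t by auto
    have "u 0 t \<le> c * s t * (sr - s t) / \<beta>" using input_le[of t] t by simp
    also have "\<dots> \<le> c * sr * sr / \<beta>"
      using c \<beta> s by (intro divide_right_mono mult_mono) auto
    finally have "c * u 0 t \<le> c * (c * sr * sr / \<beta>)"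
      by (rule mult_left_mono) (use c in simp)
    moreover have "0 < c * u 0 t" using c input_pos[of t] t by simp
    moreover have "c / \<beta> * (sr - s t) * front_speed t \<le> c / \<beta> * sr * K"
      using c \<beta> s K(2)[OF t] front_speed_nonneg[OF t] by (intro mult_mono) auto
    moreover have "0 \<le> c / \<beta> * (sr - s t) * front_speed t"
      using c \<beta> s front_speed_nonneg[OF t] by simp
    moreover have "0 \<le> c * (c * sr * sr / \<beta>)"
      using c \<beta> sr_pos by simp
    ultimately show ?thesis
      unfolding input_deriv_eq[OF t] K2_def by (simp add: abs_le_iff)
  qed
  have "continuous_on {0..} B"
  proof -
    have "continuous_on (liquid_region s {0..}) (\<lambda>(x, t). \<bar>deviation x t\<bar>)"
      using deviation_cont unfolding case_prod_beta by (intro continuous_intros)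
    from continuous_on_integral_region[OF this s_cont]
    have "continuous_on {0..} (\<lambda>t. integral {0..s t} (\<lambda>x. \<bar>deviation x t\<bar>))"
      by (simp add: s_pos)
    then show ?thesis
      unfolding B_def d_def using s0_pos by (intro continuous_intros input_cont) auto
  qed
  moreover have "B 0 = 0"
  proof -
    have "integral {0..s 0} (\<lambda>x. \<bar>deviation x 0\<bar>) = integral {0..s 0} (\<lambda>x. 0)"
      by (rule Henstock_Kurzweil_Integration.integral_cong) (simp add: deviation_initial)
    then show ?thesis by (simp add: B_def d_def)
  qed
  ultimately have "\<exists>\<delta>'>0. \<forall>t\<in>{0..}. dist t 0 < \<delta>' \<longrightarrow> dist (B t) 0 < \<alpha> * e / 2"
    using \<alpha> \<open>0 < e\<close> by (metis atLeast_iff continuous_on_iff half_gt_zero mult_pos_pos order_refl)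
  then obtain \<delta>' where \<delta>': "0 < \<delta>'" "\<And>t. 0 \<le> t \<Longrightarrow> t < \<delta>' \<Longrightarrow> \<bar>B t\<bar> < \<alpha> * e / 2"
    by (auto simp: dist_real_def)
  define t1 where "t1 = min \<delta> \<delta>' / 2"
  have t1: "0 < t1" "t1 < \<delta>" "t1 < \<delta>'"
    using \<delta>'(1) \<open>0 < \<delta>\<close> by (auto simp: t1_def min_def)
  have "deviation_energy t1 + \<alpha> * e / 2 * t1 \<le> deviation_energy 0 + \<alpha> * e / 2 * 0"
  proof (rule nonincreasing_if_left_quotients_le_zero[of 0 t1 "\<lambda>t. deviation_energy t + \<alpha> * e / 2 * t"])
    show "0 \<le> t1" using t1 by simp
    show "continuous_on {0..t1} (\<lambda>t. deviation_energy t + \<alpha> * e / 2 * t)"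
      by (intro continuous_intros continuous_on_subset[OF deviation_energy_cont]) auto
    fix t e' :: real assume t: "0 < t" "t \<le> t1" and "0 < e'"
    let ?Z = "integral {0..s t} (\<lambda>x. deviation x t * lift x)"
    have "\<bar>?Z\<bar> \<le> integral {0..s t} (\<lambda>x. \<bar>deviation x t\<bar>)"
    proof (rule abs_integral_le_integral)
      show "\<bar>deviation x t * lift x\<bar> \<le> \<bar>deviation x t\<bar>" if "x \<in> {0..s t}" for x
        using lift_bounds[of x] that by (auto simp: abs_mult intro!: mult_left_le)
    qed (use t in \<open>auto intro!: integrable_continuous_interval continuous_intros deviation_slice lift_cont\<close>)
    then have Z: "\<bar>ut 0 t * ?Z\<bar> \<le> K2 * integral {0..s t} (\<lambda>x. \<bar>deviation x t\<bar>)"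
      unfolding abs_mult using ut_le[OF t(1)] by (intro mult_mono) auto
    have "integral {0..s t} (\<lambda>x. deviation x t * ut x t)
        \<le> \<alpha> / 2 * (A + 2 * d t * u 0 0 + (d t)\<^sup>2 * s 0) - \<alpha> * slope_energy t"
      using deviation_dissipation[OF t(1)] integral_unique[OF profile_deriv_square[of t]]
      by (simp add: A_def d_def)
    also have "\<dots> \<le> \<alpha> / 2 * (A + 2 * d t * u 0 0 + (d t)\<^sup>2 * s 0) - \<alpha> * (A / 2 + e)"
      using large[of t] t t1 \<alpha> by simp
    finally have "integral {0..s t} (\<lambda>x. deviation x t * ut x t) - ut 0 t * ?Z \<le> B t - \<alpha> * e"
      using Z by (simp add: B_def algebra_simps abs_le_iff)
    also have "\<dots> \<le> - (\<alpha> * e / 2)"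
      using \<delta>'(2)[of t] t t1 by (simp add: abs_less_iff)
    finally have \<chi>: "integral {0..s t} (\<lambda>x. deviation x t * ut x t) - ut 0 t * ?Z \<le> - (\<alpha> * e / 2)" .
    show "\<forall>\<^sub>F \<tau> in at_left t. deviation_energy t + \<alpha> * e / 2 * t
        - (deviation_energy \<tau> + \<alpha> * e / 2 * \<tau>) \<le> e' * (t - \<tau>)"
      using deviation_energy_left_quotient[OF t(1) \<open>0 < e'\<close>] eventually_at_left_real[OF t(1)]
    proof eventually_elim
      case (elim \<tau>)
      have "deviation_energy t - deviation_energy \<tau> \<le> (- (\<alpha> * e / 2) + e') * (t - \<tau>)"
        using elim(1) by (rule order_trans) (use \<chi> elim(2) in \<open>auto intro!: mult_right_mono\<close>)
      then show ?case by (simp add: diff_divide_distrib algebra_simps)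
    qed
  qed
  moreover have "deviation_energy 0 = 0"
  proof -
    have "integral {0..s 0} (\<lambda>x. (deviation x 0)\<^sup>2) = integral {0..s 0} (\<lambda>x. 0)"
      by (rule Henstock_Kurzweil_Integration.integral_cong) (simp add: deviation_initial)
    then show ?thesis by (simp add: deviation_energy_def)
  qed
  moreover have "0 \<le> deviation_energy t1"
    unfolding deviation_energy_def using t1
    by (intro divide_nonneg_nonneg integral_nonneg integrable_continuous_interval continuous_intros deviation_slice) auto
  moreover have "0 < \<alpha> * e / 2 * t1"
    using \<alpha> \<open>0 < e\<close> t1 by simp
  ultimately show False by linarith
qed

end

section \<open>Lyapunov functional\<close>

lemma young_product_le:
  fixes x y k :: real
  assumes "0 < k"
  shows "x * y \<le> k * x\<^sup>2 + y\<^sup>2 / (4 * k)"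
proof -
  have "0 \<le> (2 * k * x - y)\<^sup>2 / (4 * k)" using assms by simp
  also have "\<dots> = k * x\<^sup>2 + y\<^sup>2 / (4 * k) - x * y"
    using assms by (simp add: power2_eq_square field_simps)
  finally show ?thesis by simp
qed

text \<open>At a fixed time, \<open>s\<close> is the interface position, \<open>\<theta>\<close> the input divided by \<open>s\<close>, \<open>r\<close> the
  distance of the interface to the setpoint, \<open>M\<close> the integral of the modulus of the second space
  derivative, and \<open>e - \<theta>\<close>, \<open>e' - \<theta>\<close> are the slopes of the temperature at \<open>0\<close> and at the interface;
  \<open>S\<close> and \<open>T'\<close> are the interface speed and the time derivative of the input. The inequality is
  \<open>V' \<le> - b V + a S V\<close>, with \<open>V'\<close>, \<open>V\<close> replaced by an upper bound except for the last \<open>V\<close>, which is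
  bounded below by \<open>p r\<^sup>2 / 2\<close>.\<close>

definition lyapunov_rates :: "real \<Rightarrow> real \<Rightarrow> real \<Rightarrow> real \<Rightarrow> real \<Rightarrow> real \<Rightarrow> real \<Rightarrow> real \<Rightarrow> bool" where
  "lyapunov_rates \<alpha> \<beta> c R p q a b \<longleftrightarrow>
     (\<forall>s \<theta> M r e e' S T'. 0 < s \<longrightarrow> s \<le> R \<longrightarrow> 0 \<le> \<theta> \<longrightarrow> \<theta> \<le> c * r / \<beta> \<longrightarrow> 0 \<le> r \<longrightarrow> r \<le> R \<longrightarrow>
        \<bar>e\<bar> \<le> M \<longrightarrow> \<bar>e'\<bar> \<le> M \<longrightarrow> e' \<le> \<theta> \<longrightarrow>
        r \<le> \<beta> / c * \<theta> + \<beta> * R / \<alpha> * (s * \<theta>) + \<beta> * R\<^sup>2 / \<alpha> * M \<longrightarrow>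
        S = \<beta> * (\<theta> - e') \<longrightarrow> T' = - c * (s * \<theta>) + c / \<beta> * r * S \<longrightarrow>
        - S * (\<theta> - e')\<^sup>2 / 2 - \<alpha> / s * M\<^sup>2 - (e - \<theta>) * T' - p * r * S + q * (s * \<theta>) * T'
        \<le> - b * (s * (\<theta> + M)\<^sup>2 / 2 + p * r\<^sup>2 / 2 + q * (s * \<theta>)\<^sup>2 / 2) + a * S * (p * r\<^sup>2 / 2))"

text \<open>Young's inequality charges each indefinite term to one of the dampings in
  \<open>M\<^sup>2\<close>, \<open>s * \<theta>\<^sup>2\<close>, \<open>r\<^sup>2\<close> and
  \<open>T\<^sup>2\<close>. What cannot be charged there is bounded by a multiple of
  \<open>r\<^sup>2 * S\<close> and absorbed by the growth term with \<open>a\<close>. Of the budget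
  \<open>\<gamma> * M\<^sup>2\<close>, a quarter goes to \<open>slope0\<close>, a quarter to
  \<open>gap\<close>, and half is left for \<open>b\<close>.\<close>

lemma lyapunov_rates_exist:
  fixes \<alpha> \<beta> c R :: real
  assumes pos: "0 < \<alpha>" "0 < \<beta>" "0 < c" "0 < R"
  shows "\<exists>p>0. \<exists>q>0. \<exists>a>0. \<exists>b>0. lyapunov_rates \<alpha> \<beta> c R p q a b"
proof -
  define k1 k2 \<gamma> where "k1 = \<beta> * R / \<alpha>" and "k2 = \<beta> * R\<^sup>2 / \<alpha>" and "\<gamma> = \<alpha> / R"
  \<comment> \<open>So small that the curvature error in \<open>gap\<close> costs exactly a quarter
    of the budget, see \<open>pM\<close>.\<close>
  define p where "p = \<gamma> / (4 * c * (k2 + \<beta> / c)\<^sup>2)"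
  \<comment> \<open>The damping \<open>q * c * T\<^sup>2\<close> has to pay exactly for the
    \<open>T\<^sup>2\<close> terms of \<open>gap\<close> and \<open>slope0\<close>, see
    \<open>qT\<close>.\<close>
  define q where "q = p * k1\<^sup>2 + 2 * c / \<gamma>"
  define k3 where "k3 = 2 * (c / \<beta>)\<^sup>2 / \<gamma>"
  \<comment> \<open>The coefficients of \<open>r\<^sup>2 * S\<close>: two from
    \<open>slope0\<close>, one from \<open>input\<close>.\<close>
  define C where "C = (c / \<beta>)\<^sup>2 + (k3 * \<beta>)\<^sup>2 * R\<^sup>2 / 2 + q * (c / \<beta>)\<^sup>2 * R"
  define a where "a = 2 * C / p"
  define b where "b = min (c / (1 + q * R / 2)) (\<gamma> / (2 * R))"
  have k: "0 < k1" "0 < k2" "0 < \<gamma>" using pos by (auto simp: k1_def k2_def \<gamma>_def)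
  have kc: "0 < k2 + \<beta> / c" using k pos by (simp add: add_pos_pos)
  have p: "0 < p" using k pos kc by (simp add: p_def)
  have q: "0 < q" using k pos p by (simp add: q_def add_nonneg_pos)
  have C: "0 < C" using pos q by (simp add: C_def add_pos_nonneg)
  have a: "0 < a" using C p by (simp add: a_def)
  have b: "0 < b" using pos q k by (auto simp: b_def add_pos_nonneg)
  have pM: "p * c * (k2 + \<beta> / c)\<^sup>2 = \<gamma> / 4"
    using kc pos by (simp add: p_def field_simps)
  have qT: "q * c = p * c * k1\<^sup>2 + 2 * c\<^sup>2 / \<gamma>"
    using k by (simp add: q_def power2_eq_square field_simps)
  have aC: "a * p / 2 = C" using p by (simp add: a_def)
  have b1: "b * (1 + q * R / 2) \<le> c"
  proof -
    have "b \<le> c / (1 + q * R / 2)" by (simp add: b_def)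
    moreover have "0 < 1 + q * R / 2" using q pos by (simp add: add_pos_nonneg)
    ultimately show ?thesis by (simp add: pos_le_divide_eq)
  qed
  have b2: "b * R \<le> \<gamma> / 2"
  proof -
    have "b \<le> \<gamma> / (2 * R)" by (simp add: b_def)
    from mult_right_mono[OF this, of R] show ?thesis using pos by simp
  qed
  have b3: "b \<le> c"
  proof -
    have "b * 1 \<le> b * (1 + q * R / 2)" using b q pos by (intro mult_left_mono) auto
    also note b1
    finally show ?thesis by simp
  qed
  have "lyapunov_rates \<alpha> \<beta> c R p q a b"
    unfolding lyapunov_rates_def
  proof (intro allI impI)
    fix s \<theta> M r e e' S T' :: real
    assume s: "0 < s" "s \<le> R" and \<theta>: "0 \<le> \<theta>" "\<theta> \<le> c * r / \<beta>" and r: "0 \<le> r" "r \<le> R"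
      and e: "\<bar>e\<bar> \<le> M" "\<bar>e'\<bar> \<le> M" "e' \<le> \<theta>"
      and r_le: "r \<le> \<beta> / c * \<theta> + \<beta> * R / \<alpha> * (s * \<theta>) + \<beta> * R\<^sup>2 / \<alpha> * M"
      and S_eq: "S = \<beta> * (\<theta> - e')" and T': "T' = - c * (s * \<theta>) + c / \<beta> * r * S"
    define T w where "T = s * \<theta>" and "w = \<theta> - e'"
    have M: "0 \<le> M" using e by linarith
    have T: "0 \<le> T" using s \<theta> by (simp add: T_def)
    have w: "0 \<le> w" "S = \<beta> * w" using e by (auto simp: w_def S_eq)
    have S: "0 \<le> S" using w pos by simp
    have rS: "0 \<le> r * S" using r S by simp
    \<comment> \<open>The product \<open>\<theta> * T'\<close> contains
      \<open>- c * (s * \<theta>\<^sup>2)\<close>, the damping of the mean slope. The products of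
      \<open>e\<close> with \<open>T'\<close> are errors.\<close>
    have slope0: "- (e - \<theta>) * T' \<le> - c * (s * \<theta>\<^sup>2) + (c / \<beta>)\<^sup>2 * (r\<^sup>2 * S) + \<gamma> / 4 * M\<^sup>2
        + 2 * c\<^sup>2 / \<gamma> * T\<^sup>2 + S * w\<^sup>2 / 2 + (k3 * \<beta>)\<^sup>2 * R\<^sup>2 / 2 * (r\<^sup>2 * S)"
    proof -
      have "- (e - \<theta>) * T' = - c * (s * \<theta>\<^sup>2) + c / \<beta> * \<theta> * (r * S) + e * (c * T) - e * (c / \<beta> * (r * S))"
        by (simp add: T' T_def power2_eq_square diff_divide_distrib algebra_simps)
      moreover have "c / \<beta> * \<theta> * (r * S) \<le> (c / \<beta>)\<^sup>2 * (r\<^sup>2 * S)"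
      proof -
        have "c / \<beta> * \<theta> * (r * S) \<le> c / \<beta> * (c * r / \<beta>) * (r * S)"
          using \<theta> pos rS by (intro mult_right_mono mult_left_mono) auto
        then show ?thesis by (simp add: power2_eq_square ac_simps)
      qed
      moreover have "e * (c * T) \<le> \<gamma> / 8 * M\<^sup>2 + 2 * c\<^sup>2 / \<gamma> * T\<^sup>2"
      proof -
        have "e * (c * T) \<le> M * (c * T)" using e T pos by (intro mult_right_mono) auto
        also have "\<dots> \<le> \<gamma> / 8 * M\<^sup>2 + (c * T)\<^sup>2 / (4 * (\<gamma> / 8))"
          by (rule young_product_le) (use k in simp)
        also have "(c * T)\<^sup>2 / (4 * (\<gamma> / 8)) = 2 * c\<^sup>2 / \<gamma> * T\<^sup>2"
          by (simp add: power_mult_distrib)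
        finally show ?thesis .
      qed
      moreover have "- e * (c / \<beta> * (r * S)) \<le> \<gamma> / 8 * M\<^sup>2 + k3 * (r * S)\<^sup>2"
      proof -
        have "- e * (c / \<beta> * (r * S)) \<le> M * (c / \<beta> * (r * S))"
          using e rS pos by (intro mult_right_mono) auto
        also have "\<dots> \<le> \<gamma> / 8 * M\<^sup>2 + (c / \<beta> * (r * S))\<^sup>2 / (4 * (\<gamma> / 8))"
          by (rule young_product_le) (use k in simp)
        also have "(c / \<beta> * (r * S))\<^sup>2 / (4 * (\<gamma> / 8)) = k3 * (r * S)\<^sup>2"
          by (simp add: power_mult_distrib k3_def power_divide)
        finally show ?thesis .
      qed
      \<comment> \<open>This error is quadratic in the speed, so no multiple of
        \<open>S * (p * r\<^sup>2 / 2)\<close> absorbs it directly. With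
        \<open>S = \<beta> * w\<close> it is split against the favourable cubic term
        \<open>S * w\<^sup>2 / 2\<close>, and the rest is linear in \<open>S\<close>.\<close>
      moreover have "k3 * (r * S)\<^sup>2 \<le> S * w\<^sup>2 / 2 + (k3 * \<beta>)\<^sup>2 * R\<^sup>2 / 2 * (r\<^sup>2 * S)"
      proof -
        have "k3 * (r * S)\<^sup>2 = S * (w * (k3 * \<beta> * r\<^sup>2))"
          by (simp add: w power2_eq_square)
        also have "\<dots> \<le> S * (1 / 2 * w\<^sup>2 + (k3 * \<beta> * r\<^sup>2)\<^sup>2 / (4 * (1 / 2)))"
          using S by (intro mult_left_mono young_product_le) auto
        also have "\<dots> = S * w\<^sup>2 / 2 + (k3 * \<beta>)\<^sup>2 / 2 * (r\<^sup>2 * S) * r\<^sup>2"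
          by (simp add: power2_eq_square algebra_simps)
        also have "(k3 * \<beta>)\<^sup>2 / 2 * (r\<^sup>2 * S) * r\<^sup>2 \<le> (k3 * \<beta>)\<^sup>2 / 2 * (r\<^sup>2 * S) * R\<^sup>2"
          using r S by (intro mult_left_mono power_mono) auto
        finally show ?thesis by (simp add: ac_simps)
      qed
      ultimately show ?thesis by simp
    qed
    \<comment> \<open>The bound on \<open>r\<close> is read as a lower bound on
      \<open>\<theta>\<close>, so \<open>- p * \<beta> * r * \<theta>\<close> yields
      \<open>- p * c * r\<^sup>2\<close>; the two errors take a quarter of it each.\<close>
    have gap: "- p * r * S \<le> - (p * c / 2) * r\<^sup>2 + p * c * k1\<^sup>2 * T\<^sup>2 + \<gamma> / 4 * M\<^sup>2"
    proof -
      have "r - k1 * T - k2 * M \<le> \<beta> / c * \<theta>"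
        using r_le by (simp add: k1_def k2_def T_def)
      then have "p * c * r * (r - k1 * T - k2 * M) \<le> p * c * r * (\<beta> / c * \<theta>)"
        using p pos r by (intro mult_left_mono) auto
      then have "- p * \<beta> * r * \<theta> \<le> - (p * c) * r\<^sup>2 + p * c * (r * (k1 * T)) + p * c * (r * (k2 * M))"
        using pos by (simp add: power2_eq_square algebra_simps)
      moreover have "p * \<beta> * r * e' \<le> p * c * (r * (\<beta> / c * M))"
      proof -
        have "p * \<beta> * r * e' \<le> p * \<beta> * r * M"
          using e p pos r by (intro mult_left_mono) auto
        then show ?thesis using pos by (simp add: ac_simps)
      qed
      moreover have "p * c * (r * (k1 * T)) \<le> p * c / 4 * r\<^sup>2 + p * c * k1\<^sup>2 * T\<^sup>2"
      proof -
        have "r * (k1 * T) \<le> 1 / 4 * r\<^sup>2 + (k1 * T)\<^sup>2 / (4 * (1 / 4))"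
          by (rule young_product_le) simp
        from mult_left_mono[OF this, of "p * c"] show ?thesis
          using p pos by (simp add: power_mult_distrib algebra_simps)
      qed
      moreover have "p * c * (r * (k2 * M)) + p * c * (r * (\<beta> / c * M)) \<le> p * c / 4 * r\<^sup>2 + \<gamma> / 4 * M\<^sup>2"
      proof -
        have "r * ((k2 + \<beta> / c) * M) \<le> 1 / 4 * r\<^sup>2 + ((k2 + \<beta> / c) * M)\<^sup>2 / (4 * (1 / 4))"
          by (rule young_product_le) simp
        from mult_left_mono[OF this, of "p * c"]
        have "p * c * (r * ((k2 + \<beta> / c) * M)) \<le> p * c / 4 * r\<^sup>2 + p * c * (k2 + \<beta> / c)\<^sup>2 * M\<^sup>2"
          using p pos by (simp add: power_mult_distrib distrib_left)
        then show ?thesis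
          unfolding pM by (simp add: distrib_left distrib_right)
      qed
      moreover have "- p * r * S = - p * \<beta> * r * \<theta> + p * \<beta> * r * e'"
        by (simp add: S_eq algebra_simps)
      ultimately show ?thesis by simp
    qed
    \<comment> \<open>The mixed term joins \<open>r\<^sup>2 * S\<close> because the input is at most
      a multiple of the gap.\<close>
    have input: "q * T * T' \<le> - (p * c * k1\<^sup>2 + 2 * c\<^sup>2 / \<gamma>) * T\<^sup>2 + q * (c / \<beta>)\<^sup>2 * R * (r\<^sup>2 * S)"
    proof -
      have "T \<le> R * (c * r / \<beta>)"
        unfolding T_def using s \<theta> by (intro mult_mono) auto
      then have "q * (c / \<beta>) * (r * S) * T \<le> q * (c / \<beta>) * (r * S) * (R * (c * r / \<beta>))"
        using q pos rS by (intro mult_left_mono) auto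
      moreover have "q * T * T' = - (q * c) * T\<^sup>2 + q * (c / \<beta>) * (r * S) * T"
        by (simp add: T' T_def power2_eq_square algebra_simps)
      ultimately show ?thesis
        unfolding qT by (simp add: power2_eq_square ac_simps)
    qed
    have "\<gamma> * M\<^sup>2 \<le> \<alpha> / s * M\<^sup>2"
      using pos s by (auto simp: \<gamma>_def intro!: mult_right_mono divide_left_mono)
    then have upper: "- S * w\<^sup>2 / 2 - \<alpha> / s * M\<^sup>2 - (e - \<theta>) * T' - p * r * S + q * T * T'
       \<le> - (\<gamma> / 2) * M\<^sup>2 - c * (s * \<theta>\<^sup>2) - p * c / 2 * r\<^sup>2 + C * (r\<^sup>2 * S)"
      using slope0 gap input by (simp add: C_def algebra_simps)
    have "b * (s * (\<theta> + M)\<^sup>2 / 2 + p * r\<^sup>2 / 2 + q * T\<^sup>2 / 2)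
       \<le> b * ((1 + q * R / 2) * (s * \<theta>\<^sup>2) + R * M\<^sup>2 + p * r\<^sup>2 / 2)"
    proof (intro mult_left_mono)
      have "(\<theta> + M)\<^sup>2 \<le> 2 * \<theta>\<^sup>2 + 2 * M\<^sup>2"
        using zero_le_power2[of "\<theta> - M"] by (simp add: power2_eq_square algebra_simps)
      from mult_left_mono[OF this, of s] have "s * (\<theta> + M)\<^sup>2 / 2 \<le> s * \<theta>\<^sup>2 + s * M\<^sup>2"
        using s by (simp add: algebra_simps)
      moreover have "s * M\<^sup>2 \<le> R * M\<^sup>2" using s by (intro mult_right_mono) auto
      moreover have "q * T\<^sup>2 \<le> q * R * (s * \<theta>\<^sup>2)"
      proof -
        have "s * (s * \<theta>\<^sup>2) \<le> R * (s * \<theta>\<^sup>2)" using s by (intro mult_right_mono) auto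
        from mult_left_mono[OF this, of q] show ?thesis
          using q by (simp add: T_def power2_eq_square ac_simps)
      qed
      ultimately show "s * (\<theta> + M)\<^sup>2 / 2 + p * r\<^sup>2 / 2 + q * T\<^sup>2 / 2
         \<le> (1 + q * R / 2) * (s * \<theta>\<^sup>2) + R * M\<^sup>2 + p * r\<^sup>2 / 2"
        by (simp add: distrib_right)
    qed (use b in simp)
    also have "\<dots> = (b * (1 + q * R / 2)) * (s * \<theta>\<^sup>2) + (b * R) * M\<^sup>2 + b * (p * r\<^sup>2 / 2)"
      by (simp add: algebra_simps)
    also have "\<dots> \<le> c * (s * \<theta>\<^sup>2) + \<gamma> / 2 * M\<^sup>2 + c * (p * r\<^sup>2 / 2)"
      using b1 b2 b3 s p by (intro add_mono mult_right_mono) auto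
    finally have lower: "b * (s * (\<theta> + M)\<^sup>2 / 2 + p * r\<^sup>2 / 2 + q * T\<^sup>2 / 2)
       \<le> c * (s * \<theta>\<^sup>2) + \<gamma> / 2 * M\<^sup>2 + c * (p * r\<^sup>2 / 2)" .
    have growth: "a * S * (p * r\<^sup>2 / 2) = C * (r\<^sup>2 * S)"
      unfolding aC[symmetric] by simp
    have "p * c / 2 * r\<^sup>2 = c * (p * r\<^sup>2 / 2)" by simp
    then show "- S * (\<theta> - e')\<^sup>2 / 2 - \<alpha> / s * M\<^sup>2 - (e - \<theta>) * T' - p * r * S + q * (s * \<theta>) * T'
        \<le> - b * (s * (\<theta> + M)\<^sup>2 / 2 + p * r\<^sup>2 / 2 + q * (s * \<theta>)\<^sup>2 / 2) + a * S * (p * r\<^sup>2 / 2)"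
      using upper lower unfolding T_def[symmetric] w_def[symmetric] growth mult_minus_left by linarith
  qed
  then show ?thesis using p q a b by blast
qed

section \<open>Decay of the functional along a solution\<close>

locale stefan_lyapunov = stefan_feedback +
  fixes p q a b :: real
  assumes p: "0 < p" and q: "0 < q" and a: "0 < a" and b: "0 < b"
    and rates: "lyapunov_rates \<alpha> \<beta> c sr p q a b"
begin

text \<open>The part of the functional that is continuous up to time 0; for the slope energy,
  continuity is known only at positive times.\<close>

definition reduced :: "real \<Rightarrow> real" where
  "reduced t = p * (sr - s t)\<^sup>2 / 2 + q * (u 0 t)\<^sup>2 / 2"

definition lyapunov :: "real \<Rightarrow> real" where
  "lyapunov t = slope_energy t + reduced t"

lemma reduced_cont: "continuous_on {0..} reduced"
  unfolding reduced_def[abs_def] by (intro continuous_intros s_cont input_cont) auto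

lemma slope_energy_nonneg: "0 < t \<Longrightarrow> 0 \<le> slope_energy t"
  unfolding slope_energy_def
  by (intro divide_nonneg_nonneg integral_nonneg integrable_continuous_interval continuous_intros slices) auto

lemma reduced_nonneg: "0 \<le> reduced t"
  using p q by (simp add: reduced_def)

lemma lyapunov_nonneg: "0 < t \<Longrightarrow> 0 \<le> lyapunov t"
  using slope_energy_nonneg[of t] reduced_nonneg[of t] by (simp add: lyapunov_def)

text \<open>The rates are applied to the deviations of the two end slopes from the mean slope. The
  factor \<open>- b\<close> multiplies an upper bound of the functional and
  \<open>a * front_speed t \<ge> 0\<close> a lower one, so both may be replaced by the functional
  itself.\<close>

lemma lyapunov_rate:
  assumes t: "0 < t"
  shows "- front_speed t * (ux (s t) t)\<^sup>2 / 2 - \<alpha> / s t * (curvature t)\<^sup>2 - ux 0 t * ut 0 t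
     - p * (sr - s t) * front_speed t + q * u 0 t * ut 0 t
     \<le> (a * front_speed t - b) * lyapunov t"
proof -
  define \<theta> r where "\<theta> = u 0 t / s t" and "r = sr - s t"
  have s: "0 < s t" "s t \<le> sr" using s_pos[of t] s_le[of t] t by auto
  have T: "u 0 t = s t * \<theta>" using s by (simp add: \<theta>_def)
  have \<theta>: "0 \<le> \<theta>" using input_pos[of t] t s by (simp add: \<theta>_def)
  have "s t * \<theta> \<le> s t * (c * r / \<beta>)"
    using input_le[of t] t unfolding T by (simp add: r_def ac_simps)
  then have \<theta>_le: "\<theta> \<le> c * r / \<beta>"
    by (rule mult_left_le_imp_le) (use s in simp)
  have e: "\<bar>ux 0 t + \<theta>\<bar> \<le> curvature t" "\<bar>ux (s t) t + \<theta>\<bar> \<le> curvature t"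
    using slope_near_mean[OF t] s by (auto simp: \<theta>_def)
  have e': "ux (s t) t + \<theta> \<le> \<theta>"
    using front_speed_nonneg[OF t] \<beta> by (simp add: front_speed_def mult_le_0_iff zero_le_mult_iff)
  have r_le: "r \<le> \<beta> / c * \<theta> + \<beta> * sr / \<alpha> * (s t * \<theta>) + \<beta> * sr\<^sup>2 / \<alpha> * curvature t"
    using gap_le[OF t] unfolding T[symmetric] by (simp add: r_def \<theta>_def)
  have S: "front_speed t = \<beta> * (\<theta> - (ux (s t) t + \<theta>))" by (simp add: front_speed_def)
  have ut: "ut 0 t = - c * (s t * \<theta>) + c / \<beta> * r * front_speed t"
    using input_deriv_eq[OF t] unfolding T by (simp add: r_def)
  have "- front_speed t * (\<theta> - (ux (s t) t + \<theta>))\<^sup>2 / 2 - \<alpha> / s t * (curvature t)\<^sup>2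
      - (ux 0 t + \<theta> - \<theta>) * ut 0 t - p * r * front_speed t + q * (s t * \<theta>) * ut 0 t
      \<le> - b * (s t * (\<theta> + curvature t)\<^sup>2 / 2 + p * r\<^sup>2 / 2 + q * (s t * \<theta>)\<^sup>2 / 2)
        + a * front_speed t * (p * r\<^sup>2 / 2)"
    using rates[unfolded lyapunov_rates_def, rule_format, OF s \<theta> \<theta>_le _ _ e e' r_le S ut] s
    by (simp add: r_def)
  also have "\<dots> \<le> - b * lyapunov t + a * front_speed t * lyapunov t"
  proof (rule add_mono)
    have "lyapunov t \<le> s t * (\<theta> + curvature t)\<^sup>2 / 2 + p * r\<^sup>2 / 2 + q * (s t * \<theta>)\<^sup>2 / 2"
      using slope_energy_le[OF t] unfolding T[symmetric]
      by (simp add: lyapunov_def reduced_def r_def \<theta>_def)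
    from mult_left_mono[OF this, of b] b
    show "- b * (s t * (\<theta> + curvature t)\<^sup>2 / 2 + p * r\<^sup>2 / 2 + q * (s t * \<theta>)\<^sup>2 / 2) \<le> - b * lyapunov t"
      by simp
    have "p * r\<^sup>2 / 2 \<le> lyapunov t"
      using slope_energy_nonneg[OF t] q by (simp add: lyapunov_def reduced_def r_def)
    then show "a * front_speed t * (p * r\<^sup>2 / 2) \<le> a * front_speed t * lyapunov t"
      using a front_speed_nonneg[OF t] by (intro mult_left_mono) auto
  qed
  finally show ?thesis
    unfolding T[symmetric] by (simp add: r_def left_diff_distrib)
qed

text \<open>The weight is the integrating factor of
  \<open>V' \<le> (a * front_speed t - b) * V\<close>, with the time integral of the speed written
  as \<open>s\<close>.\<close>

lemma lyapunov_decay: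
  assumes "0 < t0" "t0 \<le> t1"
  shows "lyapunov t1 * exp (b * t1 - a * s t1) \<le> lyapunov t0 * exp (b * t0 - a * s t0)"
proof (rule nonincreasing_if_left_quotients_le_zero[OF \<open>t0 \<le> t1\<close>])
  define \<mu> where "\<mu> t = exp (b * t - a * s t)" for t
  have lyap_cont: "continuous_on {0<..} lyapunov"
    unfolding lyapunov_def[abs_def]
    by (intro continuous_intros slope_energy_cont continuous_on_subset[OF reduced_cont]) auto
  show "continuous_on {t0..t1} (\<lambda>t. lyapunov t * exp (b * t - a * s t))"
    using assms by (intro continuous_intros continuous_on_subset[OF lyap_cont] s_cont_Icc) auto
  fix t e :: real assume "t0 < t" and "0 < e"
  then have t: "0 < t" using assms by simp
  define \<psi> where "\<psi> = - front_speed t * (ux (s t) t)\<^sup>2 / 2 - \<alpha> / s t * (curvature t)\<^sup>2 - ux 0 t * ut 0 t"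
  define G' where "G' = - p * (sr - s t) * front_speed t + q * u 0 t * ut 0 t"
  define e1 where "e1 = e / (2 * \<mu> t)"
  have \<mu>: "0 < \<mu> x" for x by (simp add: \<mu>_def)
  have e1: "0 < e1" "\<mu> t * e1 < e" using \<open>0 < e\<close> \<mu>[of t] by (auto simp: e1_def)
  \<comment> \<open>The discrete product rule: the increment of the functional carries the weight at
    \<open>t\<close>, the increment of the weight the functional at \<open>x\<close>. Thus the
    one-sided estimate of the slope energy is multiplied by a fixed positive number.\<close>
  define Y where "Y x = \<mu> t * (\<psi> + e1 + (reduced t - reduced x) / (t - x))
      + lyapunov x * ((\<mu> t - \<mu> x) / (t - x))" for x
  have "(reduced has_real_derivative G') (at t)"
    unfolding reduced_def[abs_def] G'_def
    by (auto intro!: derivative_eq_intros s_has_deriv input_deriv t simp: diff_divide_distrib algebra_simps)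
  then have "((\<lambda>x. (reduced t - reduced x) / (t - x)) \<longlongrightarrow> G') (at_left t)"
    by (rule left_quotient_tendsto[OF has_field_derivative_at_within t])
  moreover have "(\<mu> has_real_derivative \<mu> t * (b - a * front_speed t)) (at t)"
    unfolding \<mu>_def[abs_def] by (auto intro!: derivative_eq_intros s_has_deriv t)
  then have "((\<lambda>x. (\<mu> t - \<mu> x) / (t - x)) \<longlongrightarrow> \<mu> t * (b - a * front_speed t)) (at_left t)"
    by (rule left_quotient_tendsto[OF has_field_derivative_at_within t])
  moreover have "(lyapunov \<longlongrightarrow> lyapunov t) (at_left t)"
  proof -
    have "isCont lyapunov t"
      using lyap_cont t by (simp add: continuous_on_eq_continuous_at)
    then show ?thesis by (auto simp: isCont_def intro: filterlim_mono at_le)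
  qed
  ultimately have "(Y \<longlongrightarrow> \<mu> t * (\<psi> + e1 + G') + lyapunov t * (\<mu> t * (b - a * front_speed t))) (at_left t)"
    unfolding Y_def[abs_def] by (intro tendsto_add tendsto_mult tendsto_const)
  moreover have "\<mu> t * (\<psi> + e1 + G') + lyapunov t * (\<mu> t * (b - a * front_speed t)) < e"
  proof -
    have "\<psi> + G' \<le> (a * front_speed t - b) * lyapunov t"
      using lyapunov_rate[OF t] by (simp add: \<psi>_def G'_def)
    from mult_left_mono[OF this, of "\<mu> t"] show ?thesis
      using e1(2) \<mu>[of t] by (simp add: algebra_simps)
  qed
  ultimately have "\<forall>\<^sub>F x in at_left t. Y x < e"
    by (rule order_tendstoD)
  then show "\<forall>\<^sub>F \<tau> in at_left t. lyapunov t * exp (b * t - a * s t)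
      - lyapunov \<tau> * exp (b * \<tau> - a * s \<tau>) \<le> e * (t - \<tau>)"
    using slope_energy_left_quotient[OF t e1(1)] eventually_at_left_real[OF t]
  proof eventually_elim
    case (elim x)
    have "lyapunov t - lyapunov x \<le> (\<psi> + e1) * (t - x) + (reduced t - reduced x)"
      using elim(2) by (simp add: lyapunov_def \<psi>_def)
    then have "\<mu> t * (lyapunov t - lyapunov x) \<le> \<mu> t * ((\<psi> + e1) * (t - x) + (reduced t - reduced x))"
      using \<mu>[of t] by (intro mult_left_mono) auto
    moreover have "\<mu> t * ((\<psi> + e1) * (t - x) + (reduced t - reduced x)) + lyapunov x * (\<mu> t - \<mu> x) = Y x * (t - x)"
    proof -
      have "m * (E * h + B) + L * D = (m * (E + B / h) + L * (D / h)) * h" if "h \<noteq> 0" for m E h B L D :: real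
        using that by (simp add: field_simps)
      from this[of "t - x"] show ?thesis unfolding Y_def using elim(3) by simp
    qed
    ultimately have "lyapunov t * \<mu> t - lyapunov x * \<mu> x \<le> Y x * (t - x)"
      by (simp add: algebra_simps)
    also have "\<dots> \<le> e * (t - x)"
      using elim by (intro mult_right_mono) auto
    finally show ?case by (simp add: \<mu>_def)
  qed
qed

text \<open>Decay is started at times \<open>\<tau> n\<close> tending to 0 at which the slope energy
  nearly stays below its initial value. The interface weight costs at most
  \<open>exp (a * sr)\<close>, because \<open>s\<close> is positive and at most
  \<open>sr\<close>.\<close>

lemma lyapunov_bound:
  assumes t: "0 < t"
  shows "lyapunov t \<le> exp (a * sr) * exp (- b * t) * (integral {0..s 0} (\<lambda>x. (u0' x)\<^sup>2) / 2 + reduced 0)"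
proof -
  define A where "A = integral {0..s 0} (\<lambda>x. (u0' x)\<^sup>2) / 2"
  have "\<exists>\<tau>. \<tau> \<in> {0<..<min t (1 / real (Suc n))} \<and> slope_energy \<tau> < A + 1 / real (Suc n)" for n
    using slope_energy_near_initial[of "1 / real (Suc n)" "min t (1 / real (Suc n))"] t
    by (auto simp: A_def)
  then obtain \<tau> where \<tau>: "\<And>n. \<tau> n \<in> {0<..<min t (1 / real (Suc n))}"
      "\<And>n. slope_energy (\<tau> n) < A + 1 / real (Suc n)" by metis
  have \<tau>0: "\<tau> \<longlonglongrightarrow> 0"
  proof (rule tendsto_sandwich[OF _ _ tendsto_const LIMSEQ_inverse_real_of_nat])
    show "\<forall>\<^sub>F n in sequentially. 0 \<le> \<tau> n" "\<forall>\<^sub>F n in sequentially. \<tau> n \<le> inverse (real (Suc n))"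
      using \<tau>(1) by (auto intro!: always_eventually simp: divide_inverse less_imp_le)
  qed
  have red: "(\<lambda>n. reduced (\<tau> n)) \<longlonglongrightarrow> reduced 0"
    by (rule continuous_on_tendsto_compose[OF reduced_cont \<tau>0])
      (use \<tau>(1) in \<open>auto intro!: always_eventually less_imp_le\<close>)
  have "(\<lambda>n. exp (a * sr) * exp (- b * t) * (exp (b * \<tau> n) * (A + inverse (real (Suc n)) + reduced (\<tau> n))))
      \<longlonglongrightarrow> exp (a * sr) * exp (- b * t) * (exp (b * 0) * (A + 0 + reduced 0))"
    by (intro tendsto_mult tendsto_add tendsto_const tendsto_exp \<tau>0 red LIMSEQ_inverse_real_of_nat)
  moreover have "lyapunov t \<le> exp (a * sr) * exp (- b * t) * (exp (b * \<tau> n) * (A + inverse (real (Suc n)) + reduced (\<tau> n)))" for n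
  proof -
    have \<tau>n: "0 < \<tau> n" "\<tau> n < t" using \<tau>(1)[of n] by auto
    have V: "lyapunov (\<tau> n) \<le> A + inverse (real (Suc n)) + reduced (\<tau> n)"
      using \<tau>(2)[of n] by (simp add: lyapunov_def divide_inverse)
    have "lyapunov t = lyapunov t * exp (b * t - a * s t) * exp (a * s t - b * t)"
      by (simp flip: exp_add add: mult.assoc)
    also have "\<dots> \<le> lyapunov (\<tau> n) * exp (b * \<tau> n - a * s (\<tau> n)) * exp (a * s t - b * t)"
      using \<tau>n by (intro mult_right_mono lyapunov_decay) auto
    also have "\<dots> = lyapunov (\<tau> n) * exp (b * \<tau> n - a * s (\<tau> n) + (a * s t - b * t))"
      by (simp add: exp_add)
    also have "\<dots> \<le> lyapunov (\<tau> n) * exp (a * sr + - b * t + b * \<tau> n)"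
    proof (rule mult_left_mono)
      have "a * s t \<le> a * sr" "0 \<le> a * s (\<tau> n)"
        using a s_le[of t] t s_pos[of "\<tau> n"] \<tau>n by auto
      then show "exp (b * \<tau> n - a * s (\<tau> n) + (a * s t - b * t)) \<le> exp (a * sr + - b * t + b * \<tau> n)"
        by simp
      show "0 \<le> lyapunov (\<tau> n)" using \<tau>n by (simp add: lyapunov_nonneg)
    qed
    also have "\<dots> \<le> (A + inverse (real (Suc n)) + reduced (\<tau> n)) * exp (a * sr + - b * t + b * \<tau> n)"
      by (rule mult_right_mono[OF V]) simp
    also have "exp (a * sr + - b * t + b * \<tau> n) = exp (a * sr) * exp (- b * t) * exp (b * \<tau> n)"
      by (simp only: exp_add)
    finally show ?thesis by (simp only: ac_simps)
  qed
  ultimately have "lyapunov t \<le> exp (a * sr) * exp (- b * t) * (exp (b * 0) * (A + 0 + reduced 0))"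
    using LIMSEQ_le_const by blast
  then show ?thesis by (simp add: A_def)
qed

text \<open>The first bracket bounds the norm by the functional, via the Poincare inequality and the
  weight \<open>p\<close>. The last bracket bounds the initial functional by the initial norm; the
  input is not part of the norm but is at most a multiple of the gap by
  \<open>input_le\<close>.\<close>

lemma exponential_bound:
  assumes t: "0 < t"
  shows "integral {0..s t} (\<lambda>x. (u x t)\<^sup>2) + integral {0..s t} (\<lambda>x. (ux x t)\<^sup>2) + (s t - sr)\<^sup>2
    \<le> (2 * sr\<^sup>2 + 2 + 2 / p) * exp (a * sr) * (1 / 2 + p / 2 + q / 2 * (c * sr / \<beta>)\<^sup>2)
       * (integral {0..s 0} (\<lambda>x. (u0' x)\<^sup>2) + (s 0 - sr)\<^sup>2) * exp (- b * t)"
proof -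
  define A r where "A = integral {0..s 0} (\<lambda>x. (u0' x)\<^sup>2)" and "r = (s 0 - sr)\<^sup>2"
  have A: "0 \<le> A" unfolding A_def by (intro integral_nonneg initial_energy) auto
  have r: "0 \<le> r" by (simp add: r_def)
  have "integral {0..s t} (\<lambda>x. (u x t)\<^sup>2) + integral {0..s t} (\<lambda>x. (ux x t)\<^sup>2) + (s t - sr)\<^sup>2
     \<le> sr\<^sup>2 * (2 * slope_energy t) + 2 * slope_energy t + 2 / p * (p * (sr - s t)\<^sup>2 / 2)"
    using temperature_energy_le[OF t] p by (simp add: slope_energy_def power2_commute)
  also have "\<dots> \<le> (2 * sr\<^sup>2 + 2) * lyapunov t + 2 / p * lyapunov t"
  proof (intro add_mono)
    have "sr\<^sup>2 * (2 * slope_energy t) + 2 * slope_energy t = (2 * sr\<^sup>2 + 2) * slope_energy t"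
      by (simp add: algebra_simps)
    also have "\<dots> \<le> (2 * sr\<^sup>2 + 2) * lyapunov t"
      using reduced_nonneg[of t] by (intro mult_left_mono) (auto simp: lyapunov_def)
    finally show "sr\<^sup>2 * (2 * slope_energy t) + 2 * slope_energy t \<le> (2 * sr\<^sup>2 + 2) * lyapunov t" .
    show "2 / p * (p * (sr - s t)\<^sup>2 / 2) \<le> 2 / p * lyapunov t"
      using p q slope_energy_nonneg[OF t] by (intro mult_left_mono) (auto simp: lyapunov_def reduced_def)
  qed
  also have "\<dots> = (2 * sr\<^sup>2 + 2 + 2 / p) * lyapunov t"
    by (simp add: distrib_right)
  also have "\<dots> \<le> (2 * sr\<^sup>2 + 2 + 2 / p) * (exp (a * sr) * exp (- b * t)
      * ((1 / 2 + p / 2 + q / 2 * (c * sr / \<beta>)\<^sup>2) * (A + r)))"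
  proof (rule mult_left_mono)
    have "u 0 0 \<le> c * sr * (sr - s 0) / \<beta>"
    proof -
      have "c * s 0 * (sr - s 0) / \<beta> \<le> c * sr * (sr - s 0) / \<beta>"
        using c \<beta> s_le[of 0] by (intro divide_right_mono mult_right_mono mult_left_mono) auto
      then show ?thesis using input_le[of 0] by simp
    qed
    then have "(u 0 0)\<^sup>2 \<le> (c * sr * (sr - s 0) / \<beta>)\<^sup>2"
      using initial_input by (intro power_mono) auto
    also have "\<dots> = (c * sr / \<beta>)\<^sup>2 * r"
      by (simp add: r_def power_mult_distrib power_divide power2_commute)
    finally have "q / 2 * (u 0 0)\<^sup>2 \<le> q / 2 * ((c * sr / \<beta>)\<^sup>2 * r)"
      using q by (intro mult_left_mono) auto
    then have "A / 2 + reduced 0 \<le> A / 2 + p / 2 * r + q / 2 * (c * sr / \<beta>)\<^sup>2 * r"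
      by (simp add: reduced_def r_def power2_commute)
    also have "\<dots> \<le> (1 / 2 + p / 2 + q / 2 * (c * sr / \<beta>)\<^sup>2) * (A + r)"
    proof -
      have "0 \<le> p / 2 * A" "0 \<le> q / 2 * (c * sr / \<beta>)\<^sup>2 * A" using p q A by auto
      then show ?thesis using r by (simp add: distrib_left distrib_right)
    qed
    finally have "exp (a * sr) * exp (- b * t) * (A / 2 + reduced 0) \<le> exp (a * sr) * exp (- b * t)
       * ((1 / 2 + p / 2 + q / 2 * (c * sr / \<beta>)\<^sup>2) * (A + r))"
      by (intro mult_left_mono) auto
    then show "lyapunov t \<le> exp (a * sr) * exp (- b * t)
       * ((1 / 2 + p / 2 + q / 2 * (c * sr / \<beta>)\<^sup>2) * (A + r))"
      by (rule order_trans[OF lyapunov_bound[OF t, folded A_def]])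
  qed (use p in auto)
  finally show ?thesis by (simp add: A_def r_def ac_simps)
qed

end

section \<open>From the closed loop to the stability norm\<close>

lemma stability_norm_nonneg: "0 \<le> stability_norm Tm sr T s t"
proof -
  \<comment> \<open>If the square is not integrable, its integral has the default value 0.\<close>
  have "0 \<le> integral S (\<lambda>x. (f x)\<^sup>2)" for S :: "real set" and f :: "real \<Rightarrow> real"
    by (cases "(\<lambda>x. (f x)\<^sup>2) integrable_on S") (auto intro: integral_nonneg simp: not_integrable_integral)
  then show ?thesis by (simp add: stability_norm_def H1_norm_sq_def L2_norm_sq_def)
qed

lemma closed_loop_is_stefan_feedback:
  assumes par: "0 < \<alpha>" "0 < \<beta>" "0 < c" and s0: "0 < s0"
    and H1: "H1_on s0 T0" and comp: "compatible \<alpha> \<beta> Tm c sr T0 s0"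
    and T0: "\<forall>x\<in>{0..s0}. 0 \<le> T0 x - Tm \<and> T0 x - Tm \<le> H * (s0 - x)"
    and sr: "sr > s0 + \<beta> / \<alpha> * integral {0..s0} (\<lambda>x. x / s0 * (T0 x - Tm))"
    and sol: "closed_loop_solution \<alpha> \<beta> Tm c sr T0 s0 T s"
  obtains Tx Txx Tt where
    "stefan_feedback \<alpha> \<beta> c sr H (\<lambda>x t. T x t - Tm) Tx Txx Tt s (deriv T0)"
proof -
  have s_0: "s 0 = s0" and T_0: "\<And>x. x \<in> {0..s0} \<Longrightarrow> T x 0 = T0 x"
    and s_pos: "\<And>t. 0 \<le> t \<Longrightarrow> 0 < s t" and s_cont: "continuous_on {0..} s"
    and T_cont: "continuous_on (liquid_region s {0..}) (\<lambda>(x, t). T x t)"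
    using sol by (auto simp: closed_loop_solution_def stefan_solution_def)
  obtain Tx Txx Tt where
    cont: "continuous_on (liquid_region s {0<..}) (\<lambda>(x, t). Tx x t)"
      "continuous_on (liquid_region s {0<..}) (\<lambda>(x, t). Txx x t)"
      "continuous_on (liquid_region s {0<..}) (\<lambda>(x, t). Tt x t)"
    and deriv_all: "\<forall>t>0. \<forall>x\<in>{0..s t}.
           ((\<lambda>y. T y t) has_real_derivative Tx x t) (at x within {0..s t}) \<and>
           ((\<lambda>y. Tx y t) has_real_derivative Txx x t) (at x within {0..s t}) \<and>
           ((\<lambda>\<tau>. T x \<tau>) has_real_derivative Tt x t) (at t within {\<tau>. 0 \<le> \<tau> \<and> x \<le> s \<tau>}) \<and>
           Tt x t = \<alpha> * Txx x t"
    and bdry_all: "\<forall>t>0. T 0 t = Tm + control_law \<alpha> \<beta> Tm c sr (\<lambda>x. T x t) (s t) \<and> T (s t) t = Tm \<and>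
           (s has_real_derivative - \<beta> * Tx (s t) t) (at t)"
    using sol unfolding closed_loop_solution_def stefan_solution_def
    by (elim conjE exE) (rule that)
  note deriv = deriv_all[rule_format] and bdry = bdry_all[rule_format]
  have int_0: "integral {0..s0} (\<lambda>x. x * (T x 0 - Tm)) = integral {0..s0} (\<lambda>x. x * (T0 x - Tm))"
    by (rule Henstock_Kurzweil_Integration.integral_cong) (simp add: T_0)
  have control: "T 0 t - Tm = - c * (integral {0..s t} (\<lambda>x. x * (T x t - Tm)) / \<alpha> + s t * (s t - sr) / \<beta>)"
    if "0 \<le> t" for t
  proof (cases "t = 0")
    case True
    then show ?thesis
      using comp s0 by (simp add: s_0 T_0 int_0 compatible_def control_law_def)
  next
    case False
    then show ?thesis using bdry[of t] that by (simp add: control_law_def)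
  qed
  have front: "T (s t) t = Tm" if "0 \<le> t" for t
    using bdry[of t] that comp s0 by (cases "t = 0") (auto simp: s_0 T_0 compatible_def)
  \<comment> \<open>Multiplied by \<open>s0 / \<beta>\<close>, the setpoint condition says that the
    bracket in the control law is negative at time 0.\<close>
  have input0: "0 < T 0 0 - Tm"
  proof -
    define I where "I = integral {0..s0} (\<lambda>x. x * (T0 x - Tm))"
    have "integral {0..s0} (\<lambda>x. x / s0 * (T0 x - Tm)) = I / s0"
      unfolding I_def by (subst Henstock_Kurzweil_Integration.integral_divide[symmetric]) simp
    then have "\<beta> / \<alpha> * (I / s0) < sr - s0"
      using sr s0 by (simp add: I_def)
    then have "s0 / \<beta> * (\<beta> / \<alpha> * (I / s0)) < s0 / \<beta> * (sr - s0)"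
      using s0 par by (intro mult_strict_left_mono) auto
    then have "I / \<alpha> + s0 * (s0 - sr) / \<beta> < 0"
      using s0 par by (simp add: right_diff_distrib diff_divide_distrib)
    then show ?thesis
      using control[of 0] par by (simp add: s_0 int_0 I_def[symmetric] mult_less_0_iff)
  qed
  show ?thesis
  proof (rule that[of Tx Txx Tt], unfold_locales)
    show "continuous_on (liquid_region s {0..}) (\<lambda>(x, t). T x t - Tm)"
      using T_cont unfolding case_prod_beta by (intro continuous_intros)
    show "(deriv T0 has_integral (T x 0 - Tm - (T 0 0 - Tm))) {0..x}" if "x \<in> {0..s 0}" for x
      using H1 that s0 by (auto simp: H1_on_def s_0 T_0)
    show "(\<lambda>x. (deriv T0 x)\<^sup>2) integrable_on {0..s 0}"
      using H1 by (simp add: H1_on_def s_0)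
    show "((\<lambda>y. T y t - Tm) has_real_derivative Tx x t) (at x within {0..s t})"
      "((\<lambda>\<tau>. T x \<tau> - Tm) has_real_derivative Tt x t) (at t within {\<tau>. 0 \<le> \<tau> \<and> x \<le> s \<tau>})"
      if "0 < t" "x \<in> {0..s t}" for t x
      using deriv[OF that] by (auto intro!: derivative_eq_intros)
    show "T 0 t - Tm = - c * (integral {0..s t} (\<lambda>x. x * (T x t - Tm)) / \<alpha> + s t * (s t - sr) / \<beta>)"
      if "0 \<le> t" for t
      by (rule control[OF that])
  qed (use par cont deriv bdry front s_pos s_cont input0 T0 in \<open>auto simp: s_0 T_0\<close>)
qed

text \<open>The exceptional set \<open>N\<close> serves time 0, where the slope exists only almost
  everywhere. The two endpoints are discarded as well, since there \<open>deriv\<close> may see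
  values outside the liquid.\<close>

lemma stability_norm_eq_integral:
  assumes deriv: "\<And>x. x \<in> {0<..<s t} - N \<Longrightarrow> ((\<lambda>y. T y t) has_real_derivative d x) (at x)"
    and "negligible N"
  shows "stability_norm Tm sr T s t
    = integral {0..s t} (\<lambda>x. (T x t - Tm)\<^sup>2) + integral {0..s t} (\<lambda>x. (d x)\<^sup>2) + (s t - sr)\<^sup>2"
proof -
  have "integral {0..s t} (\<lambda>x. (deriv (\<lambda>y. T y t - Tm) x)\<^sup>2) = integral {0..s t} (\<lambda>x. (d x)\<^sup>2)"
  proof (rule integral_spike)
    show "negligible (insert 0 (insert (s t) N))"
      using \<open>negligible N\<close> by simp
    fix x assume "x \<in> {0..s t} - insert 0 (insert (s t) N)"
    then have "((\<lambda>y. T y t - Tm) has_real_derivative d x - 0) (at x)"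
      by (intro DERIV_diff DERIV_const deriv) auto
    then show "(d x)\<^sup>2 = (deriv (\<lambda>y. T y t - Tm) x)\<^sup>2"
      by (simp add: DERIV_imp_deriv)
  qed
  then show ?thesis
    by (simp add: stability_norm_def H1_norm_sq_def L2_norm_sq_def)
qed

theorem theorem5:
  fixes \<alpha> \<beta> Tm c sr :: real
  assumes "\<alpha> > 0" and "\<beta> > 0" and "c > 0"
    and "c \<le> \<alpha> / (2 * sqrt 2 * sr)"
  shows "\<exists>D>0. \<exists>b>0. \<forall>(T0 :: real \<Rightarrow> real) (s0 :: real) (H :: real)
            (T :: real \<Rightarrow> real \<Rightarrow> real) (s :: real \<Rightarrow> real).
           s0 > 0 \<and>
           H1_on s0 T0 \<and>
           compatible \<alpha> \<beta> Tm c sr T0 s0 \<and>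
           (\<forall>x\<in>{0..s0}. 0 \<le> T0 x - Tm \<and> T0 x - Tm \<le> H * (s0 - x)) \<and>
           sr > s0 + \<beta> / \<alpha> * integral {0..s0} (\<lambda>x. x / s0 * (T0 x - Tm)) \<and>
           closed_loop_solution \<alpha> \<beta> Tm c sr T0 s0 T s
           \<longrightarrow> (\<forall>t\<ge>0. stability_norm Tm sr T s t
                        \<le> D * stability_norm Tm sr T s 0 * exp (- b * t))"
proof -
  \<comment> \<open>The constants are fixed before any solution is given. The hypotheses on a
    solution force \<open>0 < sr\<close>, so in the remaining case only \<open>b\<close> has to be
    positive.\<close>
  have "\<exists>p q a b. 0 < b \<and> (0 < sr \<longrightarrow> 0 < p \<and> 0 < q \<and> 0 < a \<and> lyapunov_rates \<alpha> \<beta> c sr p q a b)"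
    using lyapunov_rates_exist[OF assms(1-3), of sr] by (metis zero_less_one)
  then obtain p q a b where b: "0 < b"
    and rates: "0 < sr \<Longrightarrow> 0 < p \<and> 0 < q \<and> 0 < a \<and> lyapunov_rates \<alpha> \<beta> c sr p q a b" by blast
  \<comment> \<open>Replaced below by \<open>max 1 D'\<close>, which is positive for every
    \<open>sr\<close> and covers \<open>t = 0\<close>.\<close>
  define D' where "D' = (2 * sr\<^sup>2 + 2 + 2 / p) * exp (a * sr) * (1 / 2 + p / 2 + q / 2 * (c * sr / \<beta>)\<^sup>2)"
  have bound: "stability_norm Tm sr T s t \<le> max 1 D' * stability_norm Tm sr T s 0 * exp (- b * t)"
    if hyp: "s0 > 0" "H1_on s0 T0" "compatible \<alpha> \<beta> Tm c sr T0 s0"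
        "\<forall>x\<in>{0..s0}. 0 \<le> T0 x - Tm \<and> T0 x - Tm \<le> H * (s0 - x)"
        "sr > s0 + \<beta> / \<alpha> * integral {0..s0} (\<lambda>x. x / s0 * (T0 x - Tm))"
        "closed_loop_solution \<alpha> \<beta> Tm c sr T0 s0 T s" and t: "0 \<le> t" for T0 s0 H T s t
  proof -
    let ?\<Phi> = "stability_norm Tm sr T s"
    have s_0: "s 0 = s0" and T_0: "\<And>x. x \<in> {0..s0} \<Longrightarrow> T x 0 = T0 x"
      using hyp(6) by (auto simp: closed_loop_solution_def stefan_solution_def)
    have D: "D' * ?\<Phi> 0 * exp (- b * t) \<le> max 1 D' * ?\<Phi> 0 * exp (- b * t)"
      by (intro mult_right_mono stability_norm_nonneg) auto
    obtain Tx Txx Tt where "stefan_feedback \<alpha> \<beta> c sr H (\<lambda>x t. T x t - Tm) Tx Txx Tt s (deriv T0)"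
      by (rule closed_loop_is_stefan_feedback[OF assms(1-3) hyp])
    then interpret stefan_feedback \<alpha> \<beta> c sr H "\<lambda>x t. T x t - Tm" Tx Txx Tt s "deriv T0" .
    interpret stefan_lyapunov \<alpha> \<beta> c sr H "\<lambda>x t. T x t - Tm" Tx Txx Tt s "deriv T0" p q a b
      by unfold_locales (use rates[OF sr_pos] b in auto)
    show "?\<Phi> t \<le> max 1 D' * ?\<Phi> 0 * exp (- b * t)"
    proof (cases "t = 0")
      case True
      then show ?thesis
        using mult_right_mono[of 1 "max 1 D'", OF _ stability_norm_nonneg[of Tm sr T s 0]] by simp
    next
      case False
      with t have t: "0 < t" by simp
      have "?\<Phi> t = integral {0..s t} (\<lambda>x. (T x t - Tm)\<^sup>2) + integral {0..s t} (\<lambda>x. (Tx x t)\<^sup>2) + (s t - sr)\<^sup>2"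
      proof (rule stability_norm_eq_integral[where N = "{}"])
        fix x assume "x \<in> {0<..<s t} - {}"
        then have "((\<lambda>y. (T y t - Tm) + Tm) has_real_derivative Tx x t + 0) (at x)"
          using t by (intro DERIV_add DERIV_const u_deriv_interior) auto
        then show "((\<lambda>y. T y t) has_real_derivative Tx x t) (at x)" by simp
      qed simp
      also have "\<dots> \<le> D' * (integral {0..s 0} (\<lambda>x. (deriv T0 x)\<^sup>2) + (s 0 - sr)\<^sup>2) * exp (- b * t)"
        unfolding D'_def by (rule exponential_bound[OF t])
      also have "\<dots> \<le> D' * ?\<Phi> 0 * exp (- b * t)"
      proof (intro mult_right_mono mult_left_mono)
        \<comment> \<open>The initial slope energy is part of the norm at time 0 because
          \<open>deriv T0\<close> is the derivative of the initial profile outside the null set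
          \<open>N\<close>.\<close>
        obtain N where N: "negligible N" "\<And>x. x \<in> {0<..<s0} - N \<Longrightarrow> T0 field_differentiable (at x)"
          using hyp(2) by (auto simp: H1_on_def)
        have "?\<Phi> 0 = integral {0..s 0} (\<lambda>x. (T x 0 - Tm)\<^sup>2) + integral {0..s 0} (\<lambda>x. (deriv T0 x)\<^sup>2) + (s 0 - sr)\<^sup>2"
        proof (rule stability_norm_eq_integral[where N = N])
          fix x assume x: "x \<in> {0<..<s 0} - N"
          then have "(T0 has_real_derivative deriv T0 x) (at x)"
            using N(2) by (simp add: s_0 field_differentiable_derivI)
          then show "((\<lambda>y. T y 0) has_real_derivative deriv T0 x) (at x)"
          proof (rule has_field_derivative_transform_within_open[of _ _ _ "{0<..<s0}"])
            show "x \<in> {0<..<s0}" using x by (simp add: s_0)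
          qed (auto simp: T_0)
        qed (rule N(1))
        moreover have "0 \<le> integral {0..s 0} (\<lambda>x. (T x 0 - Tm)\<^sup>2)"
          by (intro integral_nonneg integrable_continuous_interval continuous_intros slices) auto
        ultimately show "integral {0..s 0} (\<lambda>x. (deriv T0 x)\<^sup>2) + (s 0 - sr)\<^sup>2 \<le> ?\<Phi> 0"
          by simp
        show "0 \<le> D'"
          unfolding D'_def using p q by (intro mult_nonneg_nonneg add_nonneg_nonneg) auto
      qed simp
      also note D
      finally show ?thesis .
    qed
  qed
  show ?thesis
    by (rule exI[of _ "max 1 D'"], rule conjI, simp, rule exI[of _ b]) (use b bound in blast)
qed

end
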